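(* Consider random sequential adsorption on the random geometric graph with $N$ points in a box of volume $N/\lambda$ and interaction radius $r$, as described in the context. Let $z(t)$ be the limiting fraction of explored points and $T^*=\inf\{t>0:z(t)=1\}$. Let $c=\lambda|B(\cdot,r)|$, where $|B(\cdot,r)|$ is the volume of a ball of radius $r$. Then for all $t\in[0,T^*]$, $$l(t)\le z(t)\le u(t),$$ where $l$ and $u$ are the solutions of $$\dot l(t)=1+c\Bigl(1-\frac{3ct}{1-l(t)}e^{-\int_0^t\frac{1}{1-l(s)}ds}\Bigr)e^{-\int_0^t\frac1{1-l(s)}ds},\qquad l(0)=0,$$ $$\dot u(t)=1+c\,e^{-\int_0^t\frac{1}{1-u(s)}ds},\qquad u(0)=0,$$ the latter being $u(t)=ct+\bigl(t-\tfrac1c\bigr)\ln(1-ct)$.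
   Context: Fix $d\ge1$, $\lambda>0$, $r>0$. $N$ points $X_1,\dots,X_N$ are i.i.d. uniform in a box (cube) $\mathcal{C}_N\subset\mathbb{R}^d$ of volume $N/\lambda$ (a Poisson point process of intensity $\lambda$ conditioned on having $N$ points); two points are neighbours if their Euclidean distance is at most $r$. Exploration: initially no point is explored. At each step, as long as unexplored points remain, a point is chosen uniformly at random among the unexplored points; it and all its unexplored neighbours become explored. $Z_n$ is the number of explored points after $n$ steps, with $Z_n=N$ once all points are explored. There exists a deterministic function $z:[0,\infty)\to[0,1]$ with $Z_{\lfloor tN\rfloor}/N\to z(t)$ almost surely and in $L^1$ as $N\to\infty$; this is the function in the claim. Convention: the differential equation for $u$ (and its explicit solution) is considered up to the first time $u$ reaches $1$, and $u(t):=1$ afterwards. *)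

theory Defs
  imports "HOL-Probability.Probability"
begin

definition cube_of_volume :: "real \<Rightarrow> 'a::euclidean_space set \<Rightarrow> bool" where
  "cube_of_volume v C \<longleftrightarrow>
     (\<exists>a. \<exists>e\<ge>0. C = cbox a (a + e *\<^sub>R One)) \<and> measure lborel C = v"

text \<open>The points are \<open>x 0, \<dots>, x (N - 1)\<close>; a state of the exploration is the set \<open>S\<close> of indices of
  the explored points.\<close>

definition explore_point :: "real \<Rightarrow> nat \<Rightarrow> (nat \<Rightarrow> 'a::metric_space) \<Rightarrow> nat set \<Rightarrow> nat \<Rightarrow> nat set" where
  "explore_point r N x S i = insert i S \<union> {j \<in> {..<N} - S. dist (x i) (x j) \<le> r}"

definition explore_step :: "real \<Rightarrow> nat \<Rightarrow> (nat \<Rightarrow> 'a::metric_space) \<Rightarrow> nat set \<Rightarrow> nat set pmf" where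
  "explore_step r N x S =
     (if {..<N} \<subseteq> S then return_pmf S
      else map_pmf (explore_point r N x S) (pmf_of_set ({..<N} - S)))"

primrec exploration :: "real \<Rightarrow> nat \<Rightarrow> (nat \<Rightarrow> 'a::metric_space) \<Rightarrow> nat \<Rightarrow> nat set pmf" where
  "exploration r N x 0 = return_pmf {}"
| "exploration r N x (Suc n) = bind_pmf (exploration r N x n) (explore_step r N x)"

text \<open>Law of the number of points explored after \<open>n\<close> steps: first \<open>N\<close> i.i.d. uniform points are drawn
  in \<open>C\<close>, then \<open>n\<close> steps of the exploration are run on them.\<close>

definition explored_count_law :: "real \<Rightarrow> nat \<Rightarrow> 'a::euclidean_space set \<Rightarrow> nat \<Rightarrow> nat measure" where
  "explored_count_law r N C n =
     bind (PiM {..<N} (\<lambda>_. uniform_measure lborel C))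
       (\<lambda>x. measure_pmf (map_pmf card (exploration r N x n)))"

text \<open>Solutions on \<open>[0,\<infinity>)\<close> of \<open>y' t = F t (y t) (exp (- \<integral>\<^sub>0\<^sup>t ds / (1 - y s)))\<close> with \<open>y 0 = 0\<close>, where the
  equation is required up to the first time \<open>y\<close> reaches 1 (after which the integral need not make
  sense), and \<open>y\<close> stays equal to 1 from then on.\<close>

definition stopped_solution :: "(real \<Rightarrow> real \<Rightarrow> real \<Rightarrow> real) \<Rightarrow> (real \<Rightarrow> real) \<Rightarrow> bool" where
  "stopped_solution F y \<longleftrightarrow>
     y 0 = 0 \<and> continuous_on {0..} y \<and>
     (\<forall>t\<ge>0. (\<forall>s\<in>{0..t}. y s < 1) \<longrightarrow>
        (y has_real_derivative F t (y t) (exp (- integral {0..t} (\<lambda>s. 1 / (1 - y s)))))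
          (at t within {0..})) \<and>
     (\<forall>t\<ge>0. (\<exists>s\<in>{0..t}. y s = 1) \<longrightarrow> y t = 1)"

definition lower_rhs :: "real \<Rightarrow> real \<Rightarrow> real \<Rightarrow> real \<Rightarrow> real" where
  "lower_rhs c t y E = 1 + c * (1 - 3 * c * t / (1 - y) * E) * E"

definition upper_rhs :: "real \<Rightarrow> real \<Rightarrow> real \<Rightarrow> real \<Rightarrow> real" where
  "upper_rhs c t y E = 1 + c * E"

definition stop_at_one :: "(real \<Rightarrow> real) \<Rightarrow> real \<Rightarrow> real" where
  "stop_at_one y t = (if \<exists>s\<in>{0..t}. y s = 1 then 1 else y t)"

text \<open>The formula reaches 1 at \<open>t = (1 - exp (- c)) / c\<close>, before the logarithm becomes singular.\<close>

definition upper_explicit :: "real \<Rightarrow> real \<Rightarrow> real" where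
  "upper_explicit c = stop_at_one (\<lambda>t. c * t + (t - 1 / c) * ln (1 - c * t))"

end

theory Submission
  imports Defs
begin

text \<open>
  Given the points chosen so far, the remaining unexplored points are independent and uniform on the
  region not covered by the balls around the chosen ones. Only two consequences of this are needed,
  and both avoid densities. First, the path weight \<open>\<Prod> 1 / U\<close> (with \<open>U\<close> the number of unexplored
  points before each step) depends on the position of an unexplored point \<open>k\<close> only through the fact
  that \<open>k\<close> is unexplored; deleting \<open>k\<close> multiplies it by \<open>\<Prod> U / (U - 1)\<close>, and \<open>k\<close> can then be
  resampled. Second, averaged over \<open>k\<close>, the law of the exploration of the graph without \<open>k\<close> is the
  law of the original exploration, because the point that comes last in a random greedy order does
  not influence the others. Together they bound the expected number of pairs of unexplored
  neighbours per unexplored point by \<open>c E (\<Prod> U / (U + 1))\<close> from above, and similarly from below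
  after subtracting the contribution of points near two others, which requires deleting two points.

  Since \<open>U / N\<close> concentrates at \<open>y = 1 - z\<close>, the products converge to powers of
  \<open>X t = exp (- \<integral>\<^sub>0\<^sup>t ds / y s)\<close>, so that in integrated form
  \<open>1 + c X - 3 c\<^sup>2 t X\<^sup>2 / y \<le> z' \<le> 1 + c X\<close>. In terms of the quotient \<open>h = y / X\<close> this says
  \<open>- c \<le> h' \<le> - c + 3 c\<^sup>2 t / h\<close>, with equalities for \<open>u\<close> and \<open>l\<close>; as \<open>X' = - 1 / h\<close>, the order
  of the quotients is inherited by \<open>X\<close> and hence by \<open>y\<close>.
\<close>

section \<open>Paths of the exploration of a graph\<close>

text \<open>The drift of the mean unexplored count is 1 plus the mean number of ordered pairs (j, k)
  of unexplored neighbours divided by U, and this is not a function of U alone. The obstacle is that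
  k must itself be unexplored, which ties its position to the whole path. The upper bound drops this
  condition. The lower bound corrects for dropping it by a union bound over the n chosen points b
  that may have explored k: both j and b are then near k, which costs (c / N)^2, and the n choices
  of b divided by U become t / y. To average over j as well as k, j has to be deleted too; this
  turns U / (U + 1) into U / (U + 2), hence X into X^2. In this correction U is estimated below by
  kappa N with kappa = y / 3, the source of the constant 3.

  Concentration is not derived from the dynamics: z is deterministic, so bounded convergence makes U
  / N close to y in mean at every fixed time. The limit y is only known to be Lipschitz, so the
  comparison works with one-sided difference quotients.\<close>

definition unexplored :: "nat set \<Rightarrow> (nat \<times> nat) set \<Rightarrow> nat list \<Rightarrow> nat set" where
  "unexplored J R l = {j \<in> J. \<forall>a\<in>set l. (a, j) \<notin> R}"

abbreviation ucount :: "nat set \<Rightarrow> (nat \<times> nat) set \<Rightarrow> nat list \<Rightarrow> real" where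
  "ucount J R l \<equiv> real (card (unexplored J R l))"

text \<open>The latest choice stands at the head of the list, so earlier stages of a path are its
  tails. A path that goes on after everything is explored gets weight 0: the weights of a given
  length form a sub-probability, and the missing mass is that of explorations that have
  ended.\<close>

primrec path_prob :: "nat set \<Rightarrow> (nat \<times> nat) set \<Rightarrow> nat list \<Rightarrow> real" where
  "path_prob J R [] = 1"
| "path_prob J R (i # l) =
     path_prob J R l * (if i \<in> unexplored J R l then 1 / ucount J R l else 0)"

primrec path_prod :: "(real \<Rightarrow> real) \<Rightarrow> nat set \<Rightarrow> (nat \<times> nat) set \<Rightarrow> nat list \<Rightarrow> real" where
  "path_prod g J R [] = 1"
| "path_prod g J R (i # l) = path_prod g J R l * g (ucount J R l)"

abbreviation damping :: "real \<Rightarrow> nat set \<Rightarrow> (nat \<times> nat) set \<Rightarrow> nat list \<Rightarrow> real" where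
  "damping d \<equiv> path_prod (\<lambda>u. u / (u + d))"

definition paths :: "nat set \<Rightarrow> nat \<Rightarrow> nat list set" where
  "paths J n = {l. set l \<subseteq> J \<and> length l = n}"

definition path_exp ::
    "nat set \<Rightarrow> (nat \<times> nat) set \<Rightarrow> nat \<Rightarrow> (nat list \<Rightarrow> real) \<Rightarrow> real" where
  "path_exp J R n f = (\<Sum>l\<in>paths J n. path_prob J R l * f l)"

lemma unexplored_Nil [simp]: "unexplored J R [] = J"
  by (simp add: unexplored_def)

lemma unexplored_Cons: "unexplored J R (i # l) = {j \<in> unexplored J R l. (i, j) \<notin> R}"
  by (auto simp: unexplored_def)

lemma unexplored_subset: "unexplored J R l \<subseteq> J"
  by (auto simp: unexplored_def)

lemma finite_unexplored: "finite J \<Longrightarrow> finite (unexplored J R l)"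
  by (meson finite_subset unexplored_subset)

text \<open>Deleting a vertex shrinks \<open>J\<close> and leaves \<open>R\<close> alone. On paths
  avoiding the deleted vertex its edges are no longer looked at, so the graphs with and without
  \<open>k\<close> can be compared path by path.\<close>

lemma unexplored_remove: "unexplored (J - {k}) R l = unexplored J R l - {k}"
  by (auto simp: unexplored_def)

lemma real_card_Diff_singleton:
  "finite A \<Longrightarrow> real (card (A - {k})) = real (card A) - (if k \<in> A then 1 else 0)"
  by (cases "k \<in> A") (auto dest: card_Suc_Diff1[of A k])

lemma ucount_remove:
  assumes "finite J"
  shows "ucount (J - {k}) R l = ucount J R l - (if k \<in> unexplored J R l then 1 else 0)"
  by (simp add: unexplored_remove real_card_Diff_singleton finite_unexplored[OF assms])

lemma ucount_mono: "finite J \<Longrightarrow> ucount J R (i # l) \<le> ucount J R l"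
  by (auto simp: unexplored_Cons intro!: card_mono finite_unexplored)

lemma ucount_pos: "finite J \<Longrightarrow> i \<in> unexplored J R l \<Longrightarrow> ucount J R l \<ge> 1"
  using finite_unexplored[of J R l]
  by (metis One_nat_def Suc_leI card_gt_0_iff empty_iff of_nat_1 of_nat_le_iff)

lemma ucount_Cons_le:
  assumes "finite J" "(i, i) \<in> R" "i \<in> unexplored J R l"
  shows "ucount J R (i # l) \<le> ucount J R l - 1"
proof -
  have "card (unexplored J R (i # l)) \<le> card (unexplored J R l - {i})"
    using assms by (intro card_mono) (auto simp: unexplored_Cons finite_unexplored)
  also have "real \<dots> = ucount J R l - 1"
    using assms by (subst real_card_Diff_singleton) (auto simp: finite_unexplored)
  finally show ?thesis by simp
qed

lemma path_prob_nonneg: "path_prob J R l \<ge> 0"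
  by (induction l) auto

lemma path_prod_nonneg: "(\<And>u. u \<ge> 0 \<Longrightarrow> g u \<ge> 0) \<Longrightarrow> path_prod g J R l \<ge> 0"
  by (induction l) auto

lemma path_prod_le_1:
  assumes "\<And>u. u \<ge> 0 \<Longrightarrow> g u \<ge> 0" "\<And>u. u \<ge> 0 \<Longrightarrow> g u \<le> 1"
  shows "path_prod g J R l \<le> 1"
proof (induction l)
  case (Cons i l)
  then show ?case
    using mult_le_one[OF Cons, of "g (ucount J R l)"] assms by simp
qed simp

lemma finite_paths: "finite J \<Longrightarrow> finite (paths J n)"
  by (simp add: paths_def finite_lists_length_eq)

lemma paths_0: "paths J 0 = {[]}"
  by (auto simp: paths_def)

lemma paths_Suc: "paths J (Suc n) = (\<lambda>(i, l). i # l) ` (J \<times> paths J n)"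
  by (auto simp: paths_def image_def length_Suc_conv)

lemma path_exp_0 [simp]: "path_exp J R 0 f = f []"
  by (simp add: path_exp_def paths_0)

lemma sum_paths_Suc:
  "(\<Sum>l\<in>paths J (Suc n). f l) = (\<Sum>l\<in>paths J n. \<Sum>i\<in>J. f (i # l))"
proof -
  have "(\<Sum>l\<in>paths J (Suc n). f l) = (\<Sum>(i, l)\<in>J \<times> paths J n. f (i # l))"
    unfolding paths_Suc by (subst sum.reindex) (auto simp: inj_on_def case_prod_unfold)
  also have "\<dots> = (\<Sum>l\<in>paths J n. \<Sum>i\<in>J. f (i # l))"
    by (subst sum.swap) (simp add: sum.cartesian_product)
  finally show ?thesis .
qed

lemma path_exp_Suc:
  assumes "finite J"
  shows "path_exp J R (Suc n) f =
         path_exp J R n (\<lambda>l. (\<Sum>i\<in>unexplored J R l. f (i # l)) / ucount J R l)"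
proof -
  have "path_exp J R (Suc n) f
      = (\<Sum>l\<in>paths J n. \<Sum>i\<in>J. path_prob J R (i # l) * f (i # l))"
    by (simp only: path_exp_def sum_paths_Suc)
  also have "\<dots> = (\<Sum>l\<in>paths J n. path_prob J R l *
                    ((\<Sum>i\<in>unexplored J R l. f (i # l)) / ucount J R l))"
  proof (rule sum.cong)
    fix l
    have "(\<Sum>i\<in>J. path_prob J R (i # l) * f (i # l))
        = (\<Sum>i\<in>J. if i \<in> unexplored J R l then path_prob J R l * (f (i # l) / ucount J R l) else 0)"
      by (rule sum.cong) auto
    also have "\<dots> = (\<Sum>i\<in>unexplored J R l. path_prob J R l * (f (i # l) / ucount J R l))"
      using assms unexplored_subset[of J R l]
      by (simp add: sum.If_cases Int_absorb1)
    finally show "(\<Sum>i\<in>J. path_prob J R (i # l) * f (i # l)) = path_prob J R l *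
                    ((\<Sum>i\<in>unexplored J R l. f (i # l)) / ucount J R l)"
      by (simp add: sum_distrib_left sum_divide_distrib)
  qed simp
  finally show ?thesis by (simp add: path_exp_def)
qed

lemma path_exp_mono:
  assumes "\<And>l. l \<in> paths J n \<Longrightarrow> path_prob J R l > 0 \<Longrightarrow> f l \<le> g l"
  shows "path_exp J R n f \<le> path_exp J R n g"
  unfolding path_exp_def
proof (rule sum_mono)
  fix l assume "l \<in> paths J n"
  then show "path_prob J R l * f l \<le> path_prob J R l * g l"
    using assms[of l] path_prob_nonneg[of J R l] by (cases "path_prob J R l = 0") auto
qed

lemma path_exp_nonneg:
  "(\<And>l. l \<in> paths J n \<Longrightarrow> f l \<ge> 0) \<Longrightarrow> path_exp J R n f \<ge> 0"
  unfolding path_exp_def by (intro sum_nonneg mult_nonneg_nonneg path_prob_nonneg) auto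

lemma path_exp_add: "path_exp J R n (\<lambda>l. f l + g l) = path_exp J R n f + path_exp J R n g"
  by (simp add: path_exp_def sum.distrib distrib_left)

lemma path_exp_diff: "path_exp J R n (\<lambda>l. f l - g l) = path_exp J R n f - path_exp J R n g"
  by (simp add: path_exp_def sum_subtractf right_diff_distrib)

lemma path_exp_cmult: "path_exp J R n (\<lambda>l. a * f l) = a * path_exp J R n f"
  by (simp add: path_exp_def sum_distrib_left mult_ac)

text \<open>The inner average over \<open>i\<close> is at most \<open>g l\<close>, and it is 0
  through division by zero when nothing is unexplored; nonnegativity of \<open>g\<close> lets the
  estimate survive this loss of mass.\<close>

lemma path_exp_Suc_le:
  assumes "finite J" "\<And>i l. f (i # l) \<le> g l" "\<And>l. g l \<ge> 0"
  shows "path_exp J R (Suc n) f \<le> path_exp J R n g"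
  unfolding path_exp_Suc[OF assms(1)]
proof (rule path_exp_mono)
  fix l
  have "(\<Sum>i\<in>unexplored J R l. f (i # l)) \<le> (\<Sum>i\<in>unexplored J R l. g l)"
    by (intro sum_mono assms)
  then show "(\<Sum>i\<in>unexplored J R l. f (i # l)) / ucount J R l \<le> g l"
    using assms(3)[of l] by (auto simp: divide_simps mult_ac)
qed

lemma path_exp_one_le: "finite J \<Longrightarrow> path_exp J R n (\<lambda>l. 1) \<le> 1"
proof (induction n)
  case (Suc n)
  have "path_exp J R (Suc n) (\<lambda>l. 1) \<le> path_exp J R n (\<lambda>l. 1)"
    by (rule path_exp_Suc_le) (use Suc in auto)
  with Suc show ?case by simp
qed simp

text \<open>With \<open>R\<close> reflexive, every step of positive weight explores at least the
  chosen vertex itself.\<close>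

lemma path_prob_pos_ucount:
  assumes "finite J" "\<And>i. i \<in> J \<Longrightarrow> (i, i) \<in> R" "path_prob J R l > 0"
  shows "ucount J R l + length l \<le> card J"
  using assms(3)
proof (induction l)
  case (Cons i l)
  then have pos: "path_prob J R l > 0" and i: "i \<in> unexplored J R l"
    using path_prob_nonneg[of J R l] by (auto split: if_splits simp: zero_less_mult_iff)
  have "(i, i) \<in> R"
    using i unexplored_subset[of J R l] assms(2) by blast
  from ucount_Cons_le[OF assms(1) this i] Cons.IH[OF pos] show ?case by simp
qed simp

section \<open>Removing one vertex\<close>

text \<open>The law of the path in the graph with one vertex \<open>k\<close> deleted, for any \<open>k\<close> that is still
  unexplored in the full graph at the end of the path.\<close>

primrec path_prob_minus :: "nat set \<Rightarrow> (nat \<times> nat) set \<Rightarrow> nat list \<Rightarrow> real" where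
  "path_prob_minus J R [] = 1"
| "path_prob_minus J R (i # l) = path_prob_minus J R l *
     (if i \<in> unexplored J R l then 1 / (ucount J R l - 1) else 0)"

text \<open>As long as \<open>k\<close> is unexplored, each count is lowered by exactly one,
  whichever \<open>k\<close> was deleted; the common value can be pulled out of a sum over
  \<open>k\<close>.\<close>

lemma path_prob_remove_unexplored:
  assumes "finite J" "\<And>i. i \<in> J \<Longrightarrow> (i, i) \<in> R" "k \<in> unexplored J R l"
  shows "path_prob (J - {k}) R l = path_prob_minus J R l"
  using assms(3)
proof (induction l)
  case (Cons i l)
  then have k: "k \<in> unexplored J R l" "(i, k) \<notin> R" by (auto simp: unexplored_Cons)
  then have "i \<noteq> k" using assms(2) unexplored_subset[of J R l] by blast
  then have "i \<in> unexplored (J - {k}) R l \<longleftrightarrow> i \<in> unexplored J R l"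
    by (simp add: unexplored_remove)
  then show ?case
    using Cons.IH[OF k(1)] k by (simp add: ucount_remove[OF assms(1)])
qed simp

text \<open>The vertex picked last by a uniformly random greedy order does not influence the others, so
  deleting a uniformly random vertex does not change the law of the path before it gets stuck.\<close>

lemma path_prob_remove_average:
  assumes "finite J" "\<And>i. i \<in> J \<Longrightarrow> (i, i) \<in> R" "set l \<subseteq> J"
  shows "(\<Sum>k\<in>J - set l. path_prob (J - {k}) R l) \<le> card J * path_prob J R l \<and>
         (unexplored J R l \<noteq> {} \<longrightarrow>
          (\<Sum>k\<in>J - set l. path_prob (J - {k}) R l) = card J * path_prob J R l)"
  using assms(3)
proof (induction l)
  case (Cons i l)
  let ?U = "unexplored J R l" and ?u = "ucount J R l"
  let ?p = "\<lambda>k. path_prob (J - {k}) R l"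
  show ?case
  proof (cases "i \<in> ?U")
    case False
    then have "(\<Sum>k\<in>J - set (i # l). path_prob (J - {k}) R (i # l)) = 0"
      by (simp add: unexplored_remove)
    then show ?thesis using False by simp
  next
    case True
    have disj: "?U \<inter> set l = {}"
      using assms(2) unexplored_subset[of J R l] by (auto simp: unexplored_def)
    have fin: "finite ?U" by (rule finite_unexplored[OF assms(1)])
    have u1: "?u \<ge> 1" using ucount_pos[OF assms(1) True] .
    let ?P = "path_prob_minus J R l"
    have p1: "?p k = ?P" if "k \<in> ?U" for k
      by (rule path_prob_remove_unexplored[OF assms(1,2) that])
    \<comment> \<open>A deleted vertex \<open>k\<close> off the path is either unexplored before
      \<open>i\<close> is chosen, which lowers the denominator of the last step, or already explored
      by a neighbour, and then the last step does not notice the deletion.\<close>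
    have split: "J - set (i # l) = (?U - {i}) \<union> (J - set l - ?U)"
      using disj True unexplored_subset[of J R l] by auto
    have mem: "i \<in> unexplored (J - {k}) R l" if "k \<noteq> i" for k
      using that True by (simp add: unexplored_remove)
    have term1: "path_prob (J - {k}) R (i # l) = ?P / (?u - 1)" if "k \<in> ?U - {i}" for k
      using that mem[of k] p1[of k] by (simp add: ucount_remove[OF assms(1)])
    have term2: "path_prob (J - {k}) R (i # l) = ?p k / ?u" if "k \<in> J - set l - ?U" for k
      using that True mem[of k] by (cases "k = i") (simp_all add: ucount_remove[OF assms(1)])
    have "(\<Sum>k\<in>J - set (i # l). path_prob (J - {k}) R (i # l))
        = (\<Sum>k\<in>?U - {i}. ?P / (?u - 1)) + (\<Sum>k\<in>J - set l - ?U. ?p k / ?u)"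
      unfolding split
      by (subst sum.union_disjoint) (use assms(1) fin term1 term2 in auto)
    also have "(\<Sum>k\<in>?U - {i}. ?P / (?u - 1)) = (?u - 1) * (?P / (?u - 1))"
      using True real_card_Diff_singleton[OF fin, of i] by (simp del: card_Diff_insert card_Diff_singleton)
    finally have eq: "(\<Sum>k\<in>J - set (i # l). path_prob (J - {k}) R (i # l))
        = (?u - 1) * (?P / (?u - 1)) + (\<Sum>k\<in>J - set l - ?U. ?p k / ?u)" .
    have "(\<Sum>k\<in>J - set l. ?p k) = (\<Sum>k\<in>?U. ?p k) + (\<Sum>k\<in>J - set l - ?U. ?p k)"
      using disj unexplored_subset[of J R l] assms(1) fin
      by (subst sum.union_disjoint[symmetric]) (auto intro!: sum.cong)
    also have "(\<Sum>k\<in>?U. ?p k) = ?u * ?P" using p1 by simp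
    finally have s: "(\<Sum>k\<in>J - set l. ?p k) / ?u = ?P + (\<Sum>k\<in>J - set l - ?U. ?p k / ?u)"
      using u1 by (simp add: add_divide_distrib sum_divide_distrib)
    have eq0: "(\<Sum>k\<in>J - set l. ?p k) / ?u = card J * path_prob J R (i # l)"
      using Cons True by auto
    have P: "?P \<ge> 0" using p1[OF True] path_prob_nonneg[of "J - {i}" R l] by simp
    \<comment> \<open>If \<open>i\<close> is the only unexplored vertex, the first sum is empty and
      the term \<open>?P\<close> is lost (in the formula, \<open>0 * (?P / 0) = 0\<close>). Then
      nothing is unexplored after \<open>i\<close>, and only the inequality is claimed.\<close>
    show ?thesis
    proof (cases "?u = 1")
      case u1': True
      then have "?U = {i}" using True fin by (metis One_nat_def card_1_singletonE of_nat_eq_1_iff singletonD)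
      then have "unexplored J R (i # l) = {}"
        using Cons.prems assms(2) by (auto simp: unexplored_Cons)
      then show ?thesis using eq s eq0 P u1' by simp
    next
      case False
      then show ?thesis using eq s eq0 by simp
    qed
  qed
qed simp

text \<open>With v unexplored vertices apart from \<open>k\<close>, a step has weight 1 / (v + 1) in
  the full graph and 1 / v without \<open>k\<close>; the ratio is v / (v + 1). Here v > 0, because
  the chosen vertex is one of the v.\<close>

lemma path_prob_remove:
  assumes "finite J" "\<And>i. i \<in> J \<Longrightarrow> (i, i) \<in> R" "k \<in> unexplored J R l"
  shows "path_prob J R l = path_prob (J - {k}) R l * damping 1 (J - {k}) R l"
  using assms(3)
proof (induction l)
  case (Cons i l)
  then have k: "k \<in> unexplored J R l" "(i, k) \<notin> R" by (auto simp: unexplored_Cons)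
  then have ik: "i \<noteq> k" using assms(2) unexplored_subset[of J R l] by blast
  have u: "ucount J R l = ucount (J - {k}) R l + 1"
    using k by (simp add: ucount_remove[OF assms(1)])
  have "ucount (J - {k}) R l > 0" if "i \<in> unexplored J R l"
    using that ik ucount_pos[of "J - {k}" i R l] assms(1) by (simp add: unexplored_remove)
  then show ?case
    using Cons.IH[OF k(1)] ik unfolding path_prob.simps path_prod.simps u
    by (auto simp: unexplored_remove)
qed simp

lemma path_prod_le:
  assumes "\<And>l. 0 \<le> g (ucount J R l)" "\<And>l. g (ucount J R l) \<le> h (ucount J' R l)"
  shows "path_prod g J R l \<le> path_prod h J' R l"
proof -
  have "0 \<le> path_prod g J R l \<and> path_prod g J R l \<le> path_prod h J' R l"
  proof (induction l)
    case (Cons i l)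
    then show ?case
      using assms[of l] by (auto intro!: mult_mono mult_nonneg_nonneg order.trans[OF assms(1) assms(2)])
  qed simp
  then show ?thesis ..
qed

lemma path_prod_mult:
  "path_prod g J R l * path_prod h J R l = path_prod (\<lambda>u. g u * h u) J R l"
  by (induction l) (auto simp: mult_ac)

lemma path_prod_cong:
  "(\<And>u. u \<ge> 0 \<Longrightarrow> g u = h u) \<Longrightarrow> path_prod g J R l = path_prod h J R l"
  by (induction l) auto

lemma path_prod_remove:
  assumes "finite J" "k \<in> unexplored J R l"
  shows "path_prod g J R l = path_prod (\<lambda>u. g (u + 1)) (J - {k}) R l"
  using assms(2)
proof (induction l)
  case (Cons i l)
  then have "k \<in> unexplored J R l" by (auto simp: unexplored_Cons)
  then show ?case using Cons.IH by (simp add: ucount_remove[OF assms(1)])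
qed simp

text \<open>Rewriting \<open>damping 1\<close> after the deletion of \<open>j\<close> shifts u to u
  + 1, and u / (u + 1) * ((u + 1) / (u + 2)) telescopes to u / (u + 2).\<close>

lemma path_prob_remove_twice:
  assumes "finite J" "\<And>i. i \<in> J \<Longrightarrow> (i, i) \<in> R" "j \<in> unexplored J R l"
  shows "path_prob J R l * damping 1 J R l =
         path_prob (J - {j}) R l * damping 2 (J - {j}) R l"
proof -
  have "path_prob J R l * damping 1 J R l =
        path_prob (J - {j}) R l * path_prod (\<lambda>u. u / (u + 1) * ((u + 1) / (u + 1 + 1))) (J - {j}) R l"
    unfolding path_prod_mult[symmetric] path_prod_remove[OF assms(1,3), of "\<lambda>u. u / (u + 1)"]
    using path_prob_remove[OF assms] by simp
  also have "path_prod (\<lambda>u. u / (u + 1) * ((u + 1) / (u + 1 + 1))) (J - {j}) R l =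
             damping 2 (J - {j}) R l"
    by (rule path_prod_cong) simp
  finally show ?thesis .
qed

section \<open>Averaging over the deleted vertex\<close>

lemma path_exp_eq_remove_sum:
  assumes "finite J" "\<And>i. i \<in> J \<Longrightarrow> (i, i) \<in> R"
  shows "(\<Sum>k\<in>J. path_exp (J - {k}) R n (f k)) =
         (\<Sum>l\<in>paths J n. \<Sum>k\<in>J - set l. path_prob (J - {k}) R l * f k l)"
proof -
  have "path_exp (J - {k}) R n (f k) =
        (\<Sum>l\<in>paths J n. if k \<in> set l then 0 else path_prob (J - {k}) R l * f k l)" for k
  proof -
    have "paths (J - {k}) n = paths J n - {l. k \<in> set l}"
      by (auto simp: paths_def)
    then show ?thesis
      unfolding path_exp_def using finite_paths[OF assms(1), of n]
      by (intro sum.mono_neutral_cong_left) auto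
  qed
  then have "(\<Sum>k\<in>J. path_exp (J - {k}) R n (f k)) =
    (\<Sum>l\<in>paths J n. \<Sum>k\<in>J. if k \<in> set l then 0 else path_prob (J - {k}) R l * f k l)"
    by (simp add: sum.swap[of _ J])
  also have "\<dots> = (\<Sum>l\<in>paths J n. \<Sum>k\<in>J - set l. path_prob (J - {k}) R l * f k l)"
    using assms(1) by (intro sum.cong refl sum.mono_neutral_cong_right) auto
  finally show ?thesis .
qed

lemma path_exp_remove_average_le:
  assumes "finite J" "\<And>i. i \<in> J \<Longrightarrow> (i, i) \<in> R" "\<And>l. f l \<ge> 0"
  shows "(\<Sum>k\<in>J. path_exp (J - {k}) R n f) \<le> card J * path_exp J R n f"
proof -
  have "(\<Sum>k\<in>J - set l. path_prob (J - {k}) R l * f l) \<le> card J * (path_prob J R l * f l)"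
    if "l \<in> paths J n" for l
    using path_prob_remove_average[OF assms(1,2), of l] that assms(3)[of l]
      mult_right_mono[of "(\<Sum>k\<in>J - set l. path_prob (J - {k}) R l)" _ "f l"]
    by (simp add: paths_def sum_distrib_right[symmetric] mult.assoc[symmetric])
  then show ?thesis
    using path_exp_eq_remove_sum[OF assms(1,2), where f = "\<lambda>_. f"]
    by (simp add: path_exp_def sum_distrib_left sum_mono)
qed

text \<open>The averaging identity for path weights may fail on paths after which nothing is
  unexplored, so \<open>f\<close> must vanish there; for the inequality above it is enough that
  \<open>f\<close> is nonnegative.\<close>

lemma path_exp_remove_average:
  assumes "finite J" "\<And>i. i \<in> J \<Longrightarrow> (i, i) \<in> R"
    and "\<And>l. unexplored J R l = {} \<Longrightarrow> f l = 0"
  shows "(\<Sum>k\<in>J. path_exp (J - {k}) R n f) = card J * path_exp J R n f"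
proof -
  have "(\<Sum>k\<in>J - set l. path_prob (J - {k}) R l * f l) = card J * (path_prob J R l * f l)"
    if "l \<in> paths J n" for l
    using path_prob_remove_average[OF assms(1,2), of l] that assms(3)[of l]
    by (cases "unexplored J R l = {}") (simp_all add: paths_def sum_distrib_right[symmetric])
  then show ?thesis
    using path_exp_eq_remove_sum[OF assms(1,2), where f = "\<lambda>_. f"]
    by (simp add: path_exp_def sum_distrib_left)
qed

section \<open>Neighbour pairs among the unexplored vertices\<close>

definition unexplored_pairs :: "nat set \<Rightarrow> (nat \<times> nat) set \<Rightarrow> nat list \<Rightarrow> real" where
  "unexplored_pairs J R l =
     (\<Sum>i\<in>unexplored J R l. \<Sum>k\<in>unexplored J R l - {i}. of_bool ((i, k) \<in> R))"

text \<open>The drift identity: choosing \<open>i\<close> removes \<open>i\<close> itself, provided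
  anything is left, and its unexplored neighbours; averaging the number of the latter over a uniform
  \<open>i\<close> counts every ordered pair once and divides by U.\<close>

lemma path_exp_ucount_Suc:
  assumes "finite J" "\<And>i. i \<in> J \<Longrightarrow> (i, i) \<in> R"
  shows "path_exp J R n (ucount J R) - path_exp J R (Suc n) (ucount J R) =
         path_exp J R n (\<lambda>l. of_bool (unexplored J R l \<noteq> {}) + unexplored_pairs J R l / ucount J R l)"
  unfolding path_exp_Suc[OF assms(1)] path_exp_diff[symmetric]
proof (rule arg_cong[where f = "path_exp J R n"], rule ext)
  fix l
  let ?U = "unexplored J R l"
  have fin: "finite ?U" by (rule finite_unexplored[OF assms(1)])
  have "ucount J R (i # l) = ucount J R l - 1 - (\<Sum>k\<in>?U - {i}. of_bool ((i, k) \<in> R))"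
    if "i \<in> ?U" for i
  proof -
    have "ucount J R l = (\<Sum>k\<in>?U. of_bool ((i, k) \<notin> R) + of_bool ((i, k) \<in> R))"
      by (subst sum.cong[OF refl, of _ _ "\<lambda>_. 1"]) auto
    also have "\<dots> = (\<Sum>k\<in>?U. of_bool ((i, k) \<notin> R)) + (\<Sum>k\<in>?U. of_bool ((i, k) \<in> R))"
      by (rule sum.distrib)
    also have "(\<Sum>k\<in>?U. of_bool ((i, k) \<notin> R) :: real) = ucount J R (i # l)"
      using fin by (simp add: unexplored_Cons sum.If_cases of_bool_def Int_def)
    also have "(\<Sum>k\<in>?U. of_bool ((i, k) \<in> R) :: real) = 1 + (\<Sum>k\<in>?U - {i}. of_bool ((i, k) \<in> R))"
      using fin that assms(2)[of i] unexplored_subset[of J R l]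
      by (subst sum.remove[OF fin that]) auto
    finally show ?thesis by simp
  qed
  then have "(\<Sum>i\<in>?U. ucount J R (i # l)) =
             (\<Sum>i\<in>?U. ucount J R l - 1 - (\<Sum>k\<in>?U - {i}. of_bool ((i, k) \<in> R)))"
    by simp
  also have "\<dots> = ucount J R l * (ucount J R l - 1) - unexplored_pairs J R l"
    unfolding sum_subtractf[of "\<lambda>i. ucount J R l - 1"] unexplored_pairs_def by simp
  finally have eq: "(\<Sum>i\<in>?U. ucount J R (i # l)) =
             ucount J R l * (ucount J R l - 1) - unexplored_pairs J R l" .
  show "ucount J R l - (\<Sum>i\<in>?U. ucount J R (i # l)) / ucount J R l =
        of_bool (?U \<noteq> {}) + unexplored_pairs J R l / ucount J R l"
  proof (cases "?U = {}")
    case True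
    then show ?thesis by (simp add: unexplored_pairs_def)
  next
    case False
    then have "ucount J R l \<noteq> 0" using fin by simp
    then show ?thesis using False by (simp add: eq field_simps)
  qed
qed

text \<open>The part of the weight of a path that does not depend on the position of vertex \<open>k\<close>.\<close>

definition removed_weight ::
    "real \<Rightarrow> nat set \<Rightarrow> nat \<Rightarrow> nat \<Rightarrow> nat list \<Rightarrow> (nat \<times> nat) set \<Rightarrow> real" where
  "removed_weight a J k j l R =
     path_prob (J - {k}) R l * damping 1 (J - {k}) R l *
     (of_bool (a \<le> ucount (J - {k}) R l + 1) / (ucount (J - {k}) R l + 1)) *
     of_bool (j \<in> unexplored (J - {k}) R l)"

lemma removed_weight_nonneg: "removed_weight a J k j l R \<ge> 0"
  unfolding removed_weight_def
  by (intro mult_nonneg_nonneg path_prob_nonneg path_prod_nonneg) auto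

text \<open>The pairs are sorted by the endpoint \<open>k\<close> that will be resampled. Paths
  through \<open>k\<close> drop out by reflexivity, and on the others the position of
  \<open>k\<close> survives only in the last two indicators.\<close>

lemma path_exp_unexplored_pairs:
  assumes "finite J" "\<And>i. i \<in> J \<Longrightarrow> (i, i) \<in> R"
  shows "path_exp J R n (\<lambda>l. of_bool (a \<le> ucount J R l) * (unexplored_pairs J R l / ucount J R l)) =
    (\<Sum>k\<in>J. \<Sum>l\<in>paths (J - {k}) n. \<Sum>j\<in>J - {k}. removed_weight a J k j l R *
       (of_bool (k \<in> unexplored J R l) * of_bool ((j, k) \<in> R)))"
proof -
  have pairs: "unexplored_pairs J R l =
      (\<Sum>k\<in>J. \<Sum>j\<in>J - {k}. of_bool (k \<in> unexplored J R l) *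
          of_bool (j \<in> unexplored (J - {k}) R l) * of_bool ((j, k) \<in> R))" for l
  proof -
    let ?b = "\<lambda>i k. i \<in> unexplored J R l \<and> k \<in> unexplored J R l \<and> i \<noteq> k \<and> (i, k) \<in> R"
    have "unexplored_pairs J R l = (\<Sum>i\<in>unexplored J R l. \<Sum>k\<in>J. of_bool (?b i k))"
      unfolding unexplored_pairs_def using unexplored_subset[of J R l] assms(1)
      by (intro sum.cong[OF refl] sum.mono_neutral_cong_left) auto
    also have "\<dots> = (\<Sum>i\<in>J. \<Sum>k\<in>J. of_bool (?b i k))"
      using unexplored_subset[of J R l] assms(1) by (intro sum.mono_neutral_left) auto
    also have "\<dots> = (\<Sum>k\<in>J. \<Sum>j\<in>J. of_bool (?b j k))" by (rule sum.swap)
    also have "\<dots> = (\<Sum>k\<in>J. \<Sum>j\<in>J - {k}. of_bool (k \<in> unexplored J R l) *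
          of_bool (j \<in> unexplored (J - {k}) R l) * of_bool ((j, k) \<in> R))"
      using assms(1)
      by (intro sum.cong[OF refl] sum.mono_neutral_cong_right) (auto simp: unexplored_remove)
    finally show ?thesis .
  qed
  have "path_exp J R n (\<lambda>l. of_bool (a \<le> ucount J R l) * (unexplored_pairs J R l / ucount J R l)) =
     (\<Sum>l\<in>paths J n. \<Sum>k\<in>J. path_prob J R l * of_bool (a \<le> ucount J R l) / ucount J R l *
        (\<Sum>j\<in>J - {k}. of_bool (k \<in> unexplored J R l) *
          of_bool (j \<in> unexplored (J - {k}) R l) * of_bool ((j, k) \<in> R)))"
    by (simp add: path_exp_def pairs sum_distrib_left sum_divide_distrib mult_ac)
  also have "\<dots> = (\<Sum>k\<in>J. \<Sum>l\<in>paths J n. path_prob J R l * of_bool (a \<le> ucount J R l) / ucount J R l *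
        (\<Sum>j\<in>J - {k}. of_bool (k \<in> unexplored J R l) *
          of_bool (j \<in> unexplored (J - {k}) R l) * of_bool ((j, k) \<in> R)))"
    by (rule sum.swap)
  also have "\<dots> = (\<Sum>k\<in>J. \<Sum>l\<in>paths (J - {k}) n. \<Sum>j\<in>J - {k}. removed_weight a J k j l R *
       (of_bool (k \<in> unexplored J R l) * of_bool ((j, k) \<in> R)))"
  proof (rule sum.cong[OF refl], rule sum.mono_neutral_cong_right)
    fix k assume k: "k \<in> J"
    show "finite (paths J n)" by (rule finite_paths[OF assms(1)])
    show "paths (J - {k}) n \<subseteq> paths J n" by (auto simp: paths_def)
    show "\<forall>l\<in>paths J n - paths (J - {k}) n. path_prob J R l * of_bool (a \<le> ucount J R l) / ucount J R l *
        (\<Sum>j\<in>J - {k}. of_bool (k \<in> unexplored J R l) *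
          of_bool (j \<in> unexplored (J - {k}) R l) * of_bool ((j, k) \<in> R)) = 0"
      using assms(2)[OF k] by (auto simp: paths_def unexplored_def)
    fix l assume "l \<in> paths (J - {k}) n"
    show "path_prob J R l * of_bool (a \<le> ucount J R l) / ucount J R l *
        (\<Sum>j\<in>J - {k}. of_bool (k \<in> unexplored J R l) *
          of_bool (j \<in> unexplored (J - {k}) R l) * of_bool ((j, k) \<in> R)) =
       (\<Sum>j\<in>J - {k}. removed_weight a J k j l R *
       (of_bool (k \<in> unexplored J R l) * of_bool ((j, k) \<in> R)))"
    proof (cases "k \<in> unexplored J R l")
      case True
      have u: "ucount (J - {k}) R l + 1 = ucount J R l"
        using True by (simp add: ucount_remove[OF assms(1)])
      have "removed_weight a J k j l R =
          path_prob J R l * (of_bool (a \<le> ucount J R l) / ucount J R l) *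
          of_bool (j \<in> unexplored (J - {k}) R l)" for j
        unfolding removed_weight_def u using path_prob_remove[OF assms True] by presburger
      then show ?thesis
        unfolding sum_distrib_left by (intro sum.cong refl) (simp only: times_divide_eq_right times_divide_eq_left mult_ac)
    qed simp
  qed
  finally show ?thesis .
qed

text \<open>When \<open>j\<close> is unexplored it can be deleted too, which frees the bound from
  the position of \<open>j\<close> on paths avoiding it; the threshold \<open>a\<close> replaces the
  random divisor by a constant.\<close>

lemma removed_weight_le:
  assumes "finite J" "\<And>i. i \<in> J \<Longrightarrow> (i, i) \<in> R" "a > 0"
  shows "removed_weight a J k j l R \<le>
     path_prob (J - {k} - {j}) R l * damping 2 (J - {k} - {j}) R l / a"
proof (cases "j \<in> unexplored (J - {k}) R l")
  case True
  let ?q = "path_prob (J - {k} - {j}) R l * damping 2 (J - {k} - {j}) R l"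
  let ?u = "ucount (J - {k}) R l"
  have eq: "path_prob (J - {k}) R l * damping 1 (J - {k}) R l = ?q"
    by (rule path_prob_remove_twice) (use assms True in auto)
  have "removed_weight a J k j l R = ?q * (of_bool (a \<le> ?u + 1) / (?u + 1))"
    unfolding removed_weight_def eq using True by simp
  also have "\<dots> \<le> ?q * (1 / a)"
  proof (rule mult_left_mono)
    show "of_bool (a \<le> ?u + 1) / (?u + 1) \<le> 1 / a"
      using assms(3) by (cases "a \<le> ?u + 1") (simp_all add: frac_le)
    show "?q \<ge> 0" by (intro mult_nonneg_nonneg path_prob_nonneg path_prod_nonneg) simp_all
  qed
  finally show ?thesis by simp
next
  case False
  have "0 \<le> path_prob (J - {k} - {j}) R l * damping 2 (J - {k} - {j}) R l / a"
    using assms(3) by (intro divide_nonneg_nonneg mult_nonneg_nonneg path_prob_nonneg path_prod_nonneg) auto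
  then show ?thesis using False by (simp add: removed_weight_def)
qed

lemma removed_weight_le_remove:
  assumes "finite J" "\<And>i. i \<in> J \<Longrightarrow> (i, i) \<in> R" "a > 0" "j \<in> J - {k}" "\<And>l. f l \<ge> 0"
  shows "(\<Sum>l\<in>paths (J - {k}) n. removed_weight a J k j l R * f l) \<le>
    (\<Sum>l\<in>paths (J - {k} - {j}) n. path_prob (J - {k} - {j}) R l *
       damping 2 (J - {k} - {j}) R l / a * f l)"
proof -
  have "(\<Sum>l\<in>paths (J - {k}) n. removed_weight a J k j l R * f l) =
        (\<Sum>l\<in>paths (J - {k} - {j}) n. removed_weight a J k j l R * f l)"
    using assms by (intro sum.mono_neutral_right finite_paths)
      (auto simp: paths_def removed_weight_def unexplored_def)
  also have "\<dots> \<le> (\<Sum>l\<in>paths (J - {k} - {j}) n. path_prob (J - {k} - {j}) R l *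
       damping 2 (J - {k} - {j}) R l / a * f l)"
    by (intro sum_mono mult_right_mono removed_weight_le assms) (use assms in auto)
  finally show ?thesis .
qed

lemma sum_removed_weight:
  assumes "finite J"
  shows "(\<Sum>j\<in>J - {k}. removed_weight a J k j l R) =
     path_prob (J - {k}) R l * damping 1 (J - {k}) R l *
     (of_bool (a \<le> ucount (J - {k}) R l + 1) * (ucount (J - {k}) R l / (ucount (J - {k}) R l + 1)))"
proof -
  have "(\<Sum>j\<in>J - {k}. of_bool (j \<in> unexplored (J - {k}) R l) :: real) = ucount (J - {k}) R l"
    using assms unexplored_subset[of "J - {k}" R l] by (simp add: sum.If_cases of_bool_def Int_absorb1)
  then show ?thesis
    unfolding removed_weight_def sum_distrib_left[symmetric] by simp
qed

text \<open>Summing the indicator of \<open>j\<close> gives the count, which cancels against the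
  divisor up to a factor at most 1. Since u / (u + 1) increases with u, the damping may be computed
  in the full graph; it is then the same functional for every deleted \<open>k\<close>, and the
  averaging lemma applies.\<close>

lemma sum_removed_weight_le:
  assumes "finite J" "\<And>i. i \<in> J \<Longrightarrow> (i, i) \<in> R"
  shows "(\<Sum>k\<in>J. \<Sum>l\<in>paths (J - {k}) n. \<Sum>j\<in>J - {k}. removed_weight a J k j l R) \<le>
         card J * path_exp J R n (damping 1 J R)"
proof -
  have "(\<Sum>k\<in>J. \<Sum>l\<in>paths (J - {k}) n. \<Sum>j\<in>J - {k}. removed_weight a J k j l R) \<le>
        (\<Sum>k\<in>J. path_exp (J - {k}) R n (damping 1 J R))"
    unfolding path_exp_def sum_removed_weight[OF assms(1)] mult.assoc
  proof (intro sum_mono mult_left_mono path_prob_nonneg)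
    fix k l
    let ?u = "ucount (J - {k}) R l"
    have "damping 1 (J - {k}) R l * (of_bool (a \<le> ?u + 1) * (?u / (?u + 1))) \<le>
          damping 1 (J - {k}) R l * 1"
      by (rule mult_left_mono[OF _ path_prod_nonneg]) simp_all
    also have "\<dots> \<le> damping 1 J R l"
    proof -
      have "ucount (J - {k}) R l' / (ucount (J - {k}) R l' + 1) \<le> ucount J R l' / (ucount J R l' + 1)" for l'
        unfolding ucount_remove[OF assms(1)]
        using ucount_pos[OF assms(1), of k R l'] by (auto simp: field_simps)
      then have "damping 1 (J - {k}) R l \<le> damping 1 J R l"
        by (rule path_prod_le[rotated]) simp
      then show ?thesis by simp
    qed
    finally show "damping 1 (J - {k}) R l * (of_bool (a \<le> ?u + 1) * (?u / (?u + 1))) \<le>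
          damping 1 J R l" .
  qed
  also have "\<dots> \<le> card J * path_exp J R n (damping 1 J R)"
    by (intro path_exp_remove_average_le assms path_prod_nonneg) auto
  finally show ?thesis .
qed

text \<open>Deleting \<open>k\<close> lowers u by at most one, so u / (u + 1) without
  \<open>k\<close> is at least (u - 1) / u in the full graph. By \<open>a > 0\<close> the integrand
  vanishes when nothing is unexplored, as the exact averaging identity demands.\<close>

lemma sum_removed_weight_ge:
  assumes "finite J" "\<And>i. i \<in> J \<Longrightarrow> (i, i) \<in> R" "a > 0"
  shows "(\<Sum>k\<in>J. \<Sum>l\<in>paths (J - {k}) n. \<Sum>j\<in>J - {k}. removed_weight a J k j l R) \<ge>
         card J * path_exp J R n (\<lambda>l. path_prod (\<lambda>u. (u - 1) / u) J R l *
           (of_bool (a \<le> ucount J R l) * ((ucount J R l - 1) / ucount J R l)))"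
proof -
  let ?f = "\<lambda>l. path_prod (\<lambda>u. (u - 1) / u) J R l *
           (of_bool (a \<le> ucount J R l) * ((ucount J R l - 1) / ucount J R l))"
  \<comment> \<open>For u = 0 the quotient is 0 through division by zero, and otherwise the integer
    u is at least 1.\<close>
  have nn: "0 \<le> (ucount J R l - 1) / ucount J R l" for l
    by (cases "card (unexplored J R l) = 0") (simp_all add: Suc_leI)
  have le: "(ucount J R l - 1) / ucount J R l \<le> ucount (J - {k}) R l / (ucount (J - {k}) R l + 1)" for k l
  proof (cases "k \<in> unexplored J R l \<or> card (unexplored J R l) = 0")
    case True
    then show ?thesis by (auto simp: ucount_remove[OF assms(1)])
  next
    case False
    then have "(ucount J R l - 1) / ucount J R l \<le> ucount J R l / (ucount J R l + 1)"
      by (intro divide_le_eq[THEN iffD2]) (simp add: field_simps)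
    then show ?thesis using False by (simp add: ucount_remove[OF assms(1)])
  qed
  have "card J * path_exp J R n ?f = (\<Sum>k\<in>J. path_exp (J - {k}) R n ?f)"
    by (rule path_exp_remove_average[OF assms(1,2), symmetric]) (use assms(3) in auto)
  also have "\<dots> \<le> (\<Sum>k\<in>J. \<Sum>l\<in>paths (J - {k}) n. \<Sum>j\<in>J - {k}. removed_weight a J k j l R)"
    unfolding path_exp_def sum_removed_weight[OF assms(1)] mult.assoc
  proof (intro sum_mono mult_left_mono path_prob_nonneg mult_mono)
    fix k l
    show "path_prod (\<lambda>u. (u - 1) / u) J R l \<le> damping 1 (J - {k}) R l"
      by (rule path_prod_le[where g = "\<lambda>u. (u - 1) / u", OF nn le])
    show "of_bool (a \<le> ucount J R l) \<le> (of_bool (a \<le> ucount (J - {k}) R l + 1) :: real)"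
      by (auto simp: ucount_remove[OF assms(1)])
    show "(ucount J R l - 1) / ucount J R l \<le> ucount (J - {k}) R l / (ucount (J - {k}) R l + 1)"
      by (rule le)
    show "0 \<le> damping 1 (J - {k}) R l"
      by (rule path_prod_nonneg) auto
    show "0 \<le> of_bool (a \<le> ucount J R l) * ((ucount J R l - 1) / ucount J R l)"
      by (rule mult_nonneg_nonneg[OF _ nn]) simp
    show "0 \<le> (ucount J R l - 1) / ucount J R l" by (rule nn)
  qed simp_all
  finally show ?thesis .
qed

text \<open>Averaging is applied to \<open>j\<close> in the graph without \<open>k\<close> and then
  to \<open>k\<close>; each time, monotonicity in the vertex set first replaces the damping by that
  of the larger graph.\<close>

lemma sum_remove_twice_le:
  assumes "finite J" "\<And>i. i \<in> J \<Longrightarrow> (i, i) \<in> R"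
  shows "(\<Sum>k\<in>J. \<Sum>j\<in>J - {k}. path_exp (J - {k} - {j}) R n
            (damping 2 (J - {k} - {j}) R)) \<le>
         (card J)\<^sup>2 * path_exp J R n (damping 2 J R)"
proof -
  let ?f = "\<lambda>J. damping 2 J R"
  have mono: "?f (J - {k}) l \<le> ?f J l" if "finite J" for J k l
  proof -
    have "ucount (J - {k}) R l / (ucount (J - {k}) R l + 2) \<le> ucount J R l / (ucount J R l + 2)" for l
      unfolding ucount_remove[OF that]
      using ucount_pos[OF that, of k R l] by (auto simp: field_simps)
    then show ?thesis by (intro path_prod_le) auto
  qed
  have nn: "?f J l \<ge> 0" for J l by (rule path_prod_nonneg) auto
  have step: "(\<Sum>j\<in>J. path_exp (J - {j}) R n (?f (J - {j}))) \<le> card J * path_exp J R n (?f J)"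
    if "finite J" "\<And>i. i \<in> J \<Longrightarrow> (i, i) \<in> R" for J
    by (rule order.trans[OF sum_mono[OF path_exp_mono[OF mono[OF that(1)]]] path_exp_remove_average_le])
       (use that nn in auto)
  have "(\<Sum>k\<in>J. \<Sum>j\<in>J - {k}. path_exp (J - {k} - {j}) R n (?f (J - {k} - {j}))) \<le>
        (\<Sum>k\<in>J. card J * path_exp (J - {k}) R n (?f (J - {k})))"
  proof (rule sum_mono)
    fix k assume "k \<in> J"
    have "(\<Sum>j\<in>J - {k}. path_exp (J - {k} - {j}) R n (?f (J - {k} - {j}))) \<le>
          card (J - {k}) * path_exp (J - {k}) R n (?f (J - {k}))"
      by (rule step) (use assms in auto)
    also have "\<dots> \<le> card J * path_exp (J - {k}) R n (?f (J - {k}))"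
      using assms(1) by (intro mult_right_mono path_exp_nonneg nn) (auto intro!: card_mono)
    finally show "(\<Sum>j\<in>J - {k}. path_exp (J - {k} - {j}) R n (?f (J - {k} - {j}))) \<le> \<dots>" .
  qed
  also have "\<dots> \<le> card J * (card J * path_exp J R n (?f J))"
    unfolding sum_distrib_left[symmetric]
    by (intro mult_left_mono step assms) auto
  finally show ?thesis by (simp add: power2_eq_square mult_ac)
qed

section \<open>Random geometric graphs\<close>

text \<open>Only edges from chosen vertices into \<open>J\<close> matter. For a path in
  \<open>{..<N} - {k}\<close>, with \<open>J\<close> this same set, these congruences say that point
  \<open>k\<close> can be moved freely.\<close>

lemma unexplored_cong:
  "(\<And>a j. a \<in> set l \<Longrightarrow> j \<in> J \<Longrightarrow> (a, j) \<in> R \<longleftrightarrow> (a, j) \<in> R') \<Longrightarrow> unexplored J R l = unexplored J R' l"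
  by (auto simp: unexplored_def)

lemma path_prob_cong:
  "(\<And>a j. a \<in> set l \<Longrightarrow> j \<in> J \<Longrightarrow> (a, j) \<in> R \<longleftrightarrow> (a, j) \<in> R') \<Longrightarrow> path_prob J R l = path_prob J R' l"
proof (induction l)
  case (Cons i l)
  moreover have "unexplored J R l = unexplored J R' l"
    by (rule unexplored_cong) (use Cons.prems in auto)
  ultimately show ?case by simp
qed simp

lemma path_prod_graph_cong:
  "(\<And>a j. a \<in> set l \<Longrightarrow> j \<in> J \<Longrightarrow> (a, j) \<in> R \<longleftrightarrow> (a, j) \<in> R') \<Longrightarrow> path_prod g J R l = path_prod g J R' l"
proof (induction l)
  case (Cons i l)
  moreover have "unexplored J R l = unexplored J R' l"
    by (rule unexplored_cong) (use Cons.prems in auto)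
  ultimately show ?case by simp
qed simp

text \<open>\<open>\<beta>\<close> stands for c / N. It is only an upper bound for the measure of a
  ball, because balls around points near the boundary of the cube are cut off.\<close>

locale random_points = prob_space \<mu> for \<mu> :: "'a::euclidean_space measure" +
  fixes r \<beta> :: real and N :: nat
  assumes sets_\<mu> [measurable_cong]: "sets \<mu> = sets borel"
    and r_nonneg: "r \<ge> 0"
    and cball_le: "\<And>z. measure \<mu> (cball z r) \<le> \<beta>"
begin

abbreviation "P \<equiv> PiM {..<N} (\<lambda>_. \<mu>)"

definition geom_graph :: "(nat \<Rightarrow> 'a) \<Rightarrow> (nat \<times> nat) set" where
  "geom_graph x = {(i, j). i < N \<and> j < N \<and> dist (x i) (x j) \<le> r}"

definition graph_exp :: "((nat \<times> nat) set \<Rightarrow> real) \<Rightarrow> real" where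
  "graph_exp h = (\<integral>x. h (geom_graph x) \<partial>P)"

sublocale P: product_prob_space "\<lambda>_. \<mu>" "{..<N}"
  by unfold_locales

lemma space_\<mu>: "space \<mu> = UNIV"
  using sets_eq_imp_space_eq[OF sets_\<mu>] by simp

lemma component_measurable [measurable]: "i < N \<Longrightarrow> (\<lambda>x. x i) \<in> borel_measurable P"
proof -
  assume "i < N"
  then have "(\<lambda>x. x i) \<in> measurable P \<mu>"
    by (intro measurable_component_singleton) simp
  then show "(\<lambda>x. x i) \<in> borel_measurable P"
    by (simp add: measurable_cong_sets[OF refl sets_\<mu>])
qed

lemma \<beta>_nonneg: "\<beta> \<ge> 0"
  using cball_le[of 0] measure_nonneg[of \<mu> "cball 0 r"] by linarith

lemma geom_graph_refl: "i < N \<Longrightarrow> (i, i) \<in> geom_graph x"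
  by (simp add: geom_graph_def r_nonneg)

text \<open>The random graph takes finitely many values, and the event that it equals a given graph
  is a finite combination of distance events. Every real function of the graph is therefore
  measurable and bounded, and its expectation exists.\<close>

lemma geom_graph_measurable [measurable]: "geom_graph \<in> measurable P (count_space UNIV)"
proof -
  let ?S = "Pow ({..<N} \<times> {..<N})"
  have sub: "geom_graph x \<in> ?S" for x
    by (auto simp: geom_graph_def)
  have pre: "geom_graph -` {A} \<inter> space P \<in> sets P" if "A \<in> ?S" for A
  proof -
    have iff: "geom_graph x = A \<longleftrightarrow> (\<forall>i<N. \<forall>j<N. (dist (x i) (x j) \<le> r) = ((i, j) \<in> A))" for x
      unfolding set_eq_iff split_paired_All geom_graph_def mem_Collect_eq case_prod_conv
      using that by (meson Pow_iff lessThan_iff mem_Sigma_iff subsetD)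
    have "geom_graph -` {A} \<inter> space P = space P -
        (\<Union>(i, j)\<in>{..<N} \<times> {..<N}. {x \<in> space P. (dist (x i) (x j) \<le> r) \<noteq> ((i, j) \<in> A)})"
      unfolding vimage_def singleton_iff iff by fastforce
    also have "\<dots> \<in> sets P"
    proof (intro sets.Diff sets.top sets.finite_UN)
      fix p assume "p \<in> {..<N} \<times> {..<N}"
      then obtain i j where p: "p = (i, j)" "i < N" "j < N" by auto
      have "(\<lambda>x. dist (x i) (x j)) \<in> borel_measurable P"
        using borel_measurable_dist[OF component_measurable[OF p(2)] component_measurable[OF p(3)]] .
      then have 1: "{x \<in> space P. dist (x i) (x j) \<le> r} \<in> sets P"
        using borel_measurable_iff_le[of "\<lambda>x. dist (x i) (x j)" P] by blast
      have "{x \<in> space P. (dist (x i) (x j) \<le> r) \<noteq> ((i, j) \<in> A)} =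
          (if (i, j) \<in> A then space P - {x \<in> space P. dist (x i) (x j) \<le> r}
           else {x \<in> space P. dist (x i) (x j) \<le> r})"
        by auto
      also have "\<dots> \<in> sets P" using 1 by auto
      finally show "(case p of (i, j) \<Rightarrow> {x \<in> space P. (dist (x i) (x j) \<le> r) \<noteq> ((i, j) \<in> A)}) \<in> sets P"
        by (simp add: p)
    qed simp
    finally show ?thesis .
  qed
  have "geom_graph \<in> measurable P (count_space ?S)"
    using sub pre by (simp add: measurable_count_space_eq2 del: Pow_iff)
  moreover have "(\<lambda>A. A) \<in> measurable (count_space ?S) (count_space UNIV)"
    by (simp add: measurable_def)
  ultimately show ?thesis by (rule measurable_compose)
qed

lemma graph_fun_measurable [measurable]: "(\<lambda>x. h (geom_graph x)) \<in> borel_measurable P" for h :: "_ \<Rightarrow> real"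
  by (rule measurable_compose[OF geom_graph_measurable]) simp

lemma graph_fun_bounded: "\<exists>B. \<forall>x. \<bar>h (geom_graph x)\<bar> \<le> B" for h :: "_ \<Rightarrow> real"
proof -
  let ?A = "(\<lambda>R. \<bar>h R\<bar>) ` Pow ({..<N} \<times> {..<N})"
  have "\<bar>h (geom_graph x)\<bar> \<le> Max ?A" for x
    by (rule Max_ge) (auto simp: geom_graph_def)
  then show ?thesis by blast
qed

lemma bounded_integrable:
  fixes f :: "(nat \<Rightarrow> 'a) \<Rightarrow> real"
  assumes "f \<in> borel_measurable P" "\<And>x. \<bar>f x\<bar> \<le> B"
  shows "integrable P f"
  by (rule P.P.integrable_const_bound[where B = B]) (use assms in auto)

lemma graph_fun_integrable: "integrable P (\<lambda>x. h (geom_graph x))" for h :: "_ \<Rightarrow> real"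
  using graph_fun_bounded[of h] by (auto intro: bounded_integrable)

lemma graph_exp_mono:
  assumes "\<And>R. (\<And>i. i < N \<Longrightarrow> (i, i) \<in> R) \<Longrightarrow> h R \<le> g R"
  shows "graph_exp h \<le> graph_exp g"
  unfolding graph_exp_def
  by (intro integral_mono graph_fun_integrable assms geom_graph_refl)

lemma graph_exp_nonneg: "(\<And>R. h R \<ge> 0) \<Longrightarrow> graph_exp h \<ge> 0"
  unfolding graph_exp_def by (intro Bochner_Integration.integral_nonneg) auto

lemma graph_exp_sum: "graph_exp (\<lambda>R. \<Sum>i\<in>I. h i R) = (\<Sum>i\<in>I. graph_exp (h i))"
  unfolding graph_exp_def by (intro Bochner_Integration.integral_sum graph_fun_integrable)

lemma graph_exp_add: "graph_exp (\<lambda>R. h R + g R) = graph_exp h + graph_exp g"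
  unfolding graph_exp_def by (intro Bochner_Integration.integral_add graph_fun_integrable)

lemma graph_exp_diff: "graph_exp (\<lambda>R. h R - g R) = graph_exp h - graph_exp g"
  unfolding graph_exp_def by (intro Bochner_Integration.integral_diff graph_fun_integrable)

lemma graph_exp_cmult: "graph_exp (\<lambda>R. a * h R) = a * graph_exp h"
  unfolding graph_exp_def by simp

lemma graph_exp_const: "graph_exp (\<lambda>R. a) = a"
  unfolding graph_exp_def by (simp add: P.P.prob_space)

section \<open>Resampling the position of one point\<close>

lemma integral_resample:
  fixes f :: "(nat \<Rightarrow> 'a) \<Rightarrow> real"
  assumes k: "k < N" and f: "f \<in> borel_measurable P" and B: "\<And>x. \<bar>f x\<bar> \<le> B"
  shows "(\<integral>x. f x \<partial>P) = (\<integral>x. (\<integral>y. f (x(k := y)) \<partial>\<mu>) \<partial>P)"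
    and "(\<lambda>x. \<integral>y. f (x(k := y)) \<partial>\<mu>) \<in> borel_measurable P"
    and "\<bar>\<integral>y. f (x(k := y)) \<partial>\<mu>\<bar> \<le> B"
proof -
  interpret product_sigma_finite "\<lambda>_. \<mu>" ..
  let ?J = "{..<N} - {k}"
  have J: "insert k ?J = {..<N}" using k by auto
  show bd: "\<bar>\<integral>y. f (x(k := y)) \<partial>\<mu>\<bar> \<le> B" for x
  proof (cases "integrable \<mu> (\<lambda>y. f (x(k := y)))")
    case True
    have "\<bar>\<integral>y. f (x(k := y)) \<partial>\<mu>\<bar> \<le> (\<integral>y. \<bar>f (x(k := y))\<bar> \<partial>\<mu>)"
      by (rule integral_abs_bound)
    also have "\<dots> \<le> (\<integral>y. B \<partial>\<mu>)"
      using True B by (intro integral_mono) auto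
    finally show ?thesis by (simp add: prob_space)
  next
    \<comment> \<open>A non-integrable integrand has integral 0, which the bound covers because
      \<open>B \<ge> 0\<close>.\<close>
    case False
    then show ?thesis
      using B[of x] by (simp add: not_integrable_integral_eq)
  qed
  have upd: "(\<lambda>(x, y). x(k := y)) \<in> measurable (P \<Otimes>\<^sub>M \<mu>) P"
  proof (rule measurable_PiM_single')
    show "(\<lambda>p. (case p of (x, y) \<Rightarrow> x(k := y)) i) \<in> measurable (P \<Otimes>\<^sub>M \<mu>) \<mu>" if "i \<in> {..<N}" for i
      using that by (cases "i = k") (auto simp: case_prod_unfold intro!: measurable_compose[OF measurable_fst] measurable_component_singleton)
    show "(\<lambda>(x, y). x(k := y)) \<in> space (P \<Otimes>\<^sub>M \<mu>) \<rightarrow> {..<N} \<rightarrow>\<^sub>E space \<mu>"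
      using k by (auto simp: space_pair_measure space_PiM PiE_def extensional_def)
  qed
  show meas: "(\<lambda>x. \<integral>y. f (x(k := y)) \<partial>\<mu>) \<in> borel_measurable P"
    using measurable_compose[OF upd f]
    by (intro borel_measurable_lebesgue_integral) (simp add: case_prod_unfold)
  have int: "integrable P f" using f B by (rule bounded_integrable)
  have int': "integrable P (\<lambda>x. \<integral>y. f (x(k := y)) \<partial>\<mu>)" using meas bd by (rule bounded_integrable)
  have "(\<integral>x. f x \<partial>P) = (\<integral>x. (\<integral>y. f (x(k := y)) \<partial>\<mu>) \<partial>PiM ?J (\<lambda>_. \<mu>))"
    using product_integral_insert[of ?J k f] int by (simp add: J del: insert_Diff_single)
  \<comment> \<open>The inner integral does not depend on coordinate \<open>k\<close>, so averaging
    it over a further value \<open>y'\<close> of that coordinate changes nothing; this restores the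
    integral over all \<open>N\<close> points.\<close>
  also have "\<dots> = (\<integral>x. (\<integral>y'. (\<integral>y. f ((x(k := y'))(k := y)) \<partial>\<mu>) \<partial>\<mu>) \<partial>PiM ?J (\<lambda>_. \<mu>))"
    by (simp add: prob_space)
  also have "\<dots> = (\<integral>x. (\<integral>y. f (x(k := y)) \<partial>\<mu>) \<partial>P)"
    using product_integral_insert[of ?J k "\<lambda>x. \<integral>y. f (x(k := y)) \<partial>\<mu>"] int' by (simp add: J del: insert_Diff_single)
  finally show "(\<integral>x. f x \<partial>P) = (\<integral>x. (\<integral>y. f (x(k := y)) \<partial>\<mu>) \<partial>P)" .
qed

lemma integral_resample_mult:
  fixes h :: "(nat \<times> nat) set \<Rightarrow> real"
  assumes k: "k < N" and h: "\<And>x y. h (geom_graph (x(k := y))) = h (geom_graph x)"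
    and f: "f \<in> borel_measurable P" and B: "\<And>x. \<bar>f x\<bar> \<le> B"
  shows "(\<integral>x. h (geom_graph x) * f x \<partial>P) = (\<integral>x. h (geom_graph x) * (\<integral>y. f (x(k := y)) \<partial>\<mu>) \<partial>P)"
proof -
  obtain A where A: "\<And>x. \<bar>h (geom_graph x)\<bar> \<le> A" using graph_fun_bounded[of h] by blast
  have "\<bar>h (geom_graph x) * f x\<bar> \<le> A * B" for x
    using mult_mono[OF A B, of x x] A[of x] by (simp add: abs_mult)
  from integral_resample(1)[OF k _ this] f show ?thesis by (simp add: h)
qed

lemma integral_resample_le:
  fixes h :: "(nat \<times> nat) set \<Rightarrow> real"
  assumes k: "k < N" and h: "\<And>x y. h (geom_graph (x(k := y))) = h (geom_graph x)"
    and h0: "\<And>R. h R \<ge> 0"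
    and f: "f \<in> borel_measurable P" and B: "\<And>x. \<bar>f x\<bar> \<le> B"
    and le: "\<And>x. (\<integral>y. f (x(k := y)) \<partial>\<mu>) \<le> b"
  shows "(\<integral>x. h (geom_graph x) * f x \<partial>P) \<le> b * graph_exp h"
proof -
  obtain A where A: "\<And>x. \<bar>h (geom_graph x)\<bar> \<le> A" using graph_fun_bounded[of h] by blast
  note [measurable] = integral_resample(2)[OF k f B]
  have "(\<integral>x. h (geom_graph x) * (\<integral>y. f (x(k := y)) \<partial>\<mu>) \<partial>P) \<le> (\<integral>x. b * h (geom_graph x) \<partial>P)"
  proof (rule integral_mono)
    have "\<bar>h (geom_graph x) * (\<integral>y. f (x(k := y)) \<partial>\<mu>)\<bar> \<le> A * B" for x
      using mult_mono[OF A integral_resample(3)[OF k f B], of x x] A[of x] by (simp add: abs_mult)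
    then show "integrable P (\<lambda>x. h (geom_graph x) * (\<integral>y. f (x(k := y)) \<partial>\<mu>))"
      by (intro bounded_integrable[where B = "A * B"]) auto
    show "integrable P (\<lambda>x. b * h (geom_graph x))"
      by (intro integrable_mult_right graph_fun_integrable)
    show "h (geom_graph x) * (\<integral>y. f (x(k := y)) \<partial>\<mu>) \<le> b * h (geom_graph x)" for x
      using mult_left_mono[OF le h0] by (simp add: mult_ac)
  qed
  then show ?thesis
    using integral_resample_mult[OF k h f B] by (simp add: graph_exp_def)
qed

text \<open>Only the moved endpoint is integrated; \<open>j \<noteq> k\<close> keeps the centre
  \<open>x j\<close> in place.\<close>

lemma integral_near:
  assumes "j \<noteq> k" "j < N" "k < N"
  shows "(\<integral>y. of_bool ((j, k) \<in> geom_graph (x(k := y))) \<partial>\<mu>) = measure \<mu> (cball (x j) r)"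
    and "(\<integral>y. of_bool ((k, j) \<in> geom_graph (x(k := y))) \<partial>\<mu>) = measure \<mu> (cball (x j) r)"
proof -
  have "(\<lambda>y. of_bool ((j, k) \<in> geom_graph (x(k := y))) :: real) = indicator (cball (x j) r)"
       "(\<lambda>y. of_bool ((k, j) \<in> geom_graph (x(k := y))) :: real) = indicator (cball (x j) r)"
    using assms by (auto simp: geom_graph_def fun_eq_iff indicator_def dist_commute)
  then show "(\<integral>y. of_bool ((j, k) \<in> geom_graph (x(k := y))) \<partial>\<mu>) = measure \<mu> (cball (x j) r)"
    "(\<integral>y. of_bool ((k, j) \<in> geom_graph (x(k := y))) \<partial>\<mu>) = measure \<mu> (cball (x j) r)"
    by (simp_all add: space_\<mu>)
qed

lemma graph_exp_near_le:
  assumes "j \<noteq> k" "j < N" "k < N"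
    and "\<And>x y. h (geom_graph (x(k := y))) = h (geom_graph x)" and "\<And>R. h R \<ge> 0"
  shows "graph_exp (\<lambda>R. h R * of_bool ((j, k) \<in> R)) \<le> \<beta> * graph_exp h"
    and "graph_exp (\<lambda>R. h R * of_bool ((k, j) \<in> R)) \<le> \<beta> * graph_exp h"
proof -
  have "(\<integral>x. h (geom_graph x) * of_bool (p \<in> geom_graph x) \<partial>P) \<le> \<beta> * graph_exp h"
    if "p \<in> {(j, k), (k, j)}" for p
  proof (rule integral_resample_le[OF assms(3), where B = 1])
    show "(\<lambda>x. of_bool (p \<in> geom_graph x) :: real) \<in> borel_measurable P" by (rule graph_fun_measurable)
    show "(\<integral>y. of_bool (p \<in> geom_graph (x(k := y))) \<partial>\<mu>) \<le> \<beta>" for x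
      using that integral_near[OF assms(1-3), of x] cball_le[of "x j"] by auto
  qed (use assms in auto)
  from this[of "(j, k)"] this[of "(k, j)"]
  show "graph_exp (\<lambda>R. h R * of_bool ((j, k) \<in> R)) \<le> \<beta> * graph_exp h"
    "graph_exp (\<lambda>R. h R * of_bool ((k, j) \<in> R)) \<le> \<beta> * graph_exp h"
    unfolding graph_exp_def by simp_all
qed

section \<open>Expected number of unexplored neighbour pairs\<close>

lemma geom_graph_upd: "a \<noteq> k \<Longrightarrow> j \<noteq> k \<Longrightarrow> (a, j) \<in> geom_graph (x(k := y)) \<longleftrightarrow> (a, j) \<in> geom_graph x"
  by (simp add: geom_graph_def)

lemma removed_weight_upd:
  assumes "l \<in> paths ({..<N} - {k}) n"
  shows "removed_weight a {..<N} k j l (geom_graph (x(k := y))) = removed_weight a {..<N} k j l (geom_graph x)"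
proof -
  have "(b, i) \<in> geom_graph (x(k := y)) \<longleftrightarrow> (b, i) \<in> geom_graph x"
    if "b \<in> set l" "i \<in> {..<N} - {k}" for b i
    using that assms by (intro geom_graph_upd) (auto simp: paths_def)
  note cong = unexplored_cong[OF this] path_prob_cong[OF this] path_prod_graph_cong[OF this]
  show ?thesis unfolding removed_weight_def by (simp only: cong)
qed

text \<open>Once the condition that \<open>k\<close> is unexplored is dropped, what remains is a
  weight independent of the position of \<open>k\<close> times the event that \<open>k\<close> is
  near \<open>j\<close>; averaging over that position gives at most \<open>\<beta>\<close>. The
  threshold is taken to be 0, hence void.\<close>

lemma pairs_le:
  "graph_exp (\<lambda>R. path_exp {..<N} R n (\<lambda>l. unexplored_pairs {..<N} R l / ucount {..<N} R l)) \<le>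
   real N * \<beta> * graph_exp (\<lambda>R. path_exp {..<N} R n (damping 1 {..<N} R))"
proof -
  let ?J = "{..<N}"
  let ?w = "removed_weight 0 {..<N}"
  have "graph_exp (\<lambda>R. path_exp ?J R n (\<lambda>l. unexplored_pairs ?J R l / ucount ?J R l)) \<le>
     graph_exp (\<lambda>R. \<Sum>k\<in>?J. \<Sum>l\<in>paths (?J - {k}) n. \<Sum>j\<in>?J - {k}. ?w k j l R * of_bool ((j, k) \<in> R))"
  proof (rule graph_exp_mono)
    fix R :: "(nat \<times> nat) set" assume "\<And>i. i < N \<Longrightarrow> (i, i) \<in> R"
    then have "path_exp ?J R n (\<lambda>l. unexplored_pairs ?J R l / ucount ?J R l) = (\<Sum>k\<in>?J. \<Sum>l\<in>paths (?J - {k}) n. \<Sum>j\<in>?J - {k}. ?w k j l R *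
       (of_bool (k \<in> unexplored ?J R l) * of_bool ((j, k) \<in> R)))"
      using path_exp_unexplored_pairs[of ?J R n 0] by simp
    also have "\<dots> \<le> (\<Sum>k\<in>?J. \<Sum>l\<in>paths (?J - {k}) n. \<Sum>j\<in>?J - {k}. ?w k j l R * of_bool ((j, k) \<in> R))"
    proof (rule sum_mono, rule sum_mono, rule sum_mono)
      fix k l j
      show "?w k j l R * (of_bool (k \<in> unexplored ?J R l) * of_bool ((j, k) \<in> R)) \<le> ?w k j l R * of_bool ((j, k) \<in> R)"
        by (rule mult_left_mono[OF _ removed_weight_nonneg]) simp
    qed
    finally show "path_exp ?J R n (\<lambda>l. unexplored_pairs ?J R l / ucount ?J R l) \<le> \<dots>" .
  qed
  also have "\<dots> = (\<Sum>k\<in>?J. \<Sum>l\<in>paths (?J - {k}) n. \<Sum>j\<in>?J - {k}. graph_exp (\<lambda>R. ?w k j l R * of_bool ((j, k) \<in> R)))"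
    by (simp only: graph_exp_sum)
  also have "\<dots> \<le> (\<Sum>k\<in>?J. \<Sum>l\<in>paths (?J - {k}) n. \<Sum>j\<in>?J - {k}. \<beta> * graph_exp (?w k j l))"
  proof (rule sum_mono, rule sum_mono, rule sum_mono)
    fix k l j assume *: "k \<in> ?J" "l \<in> paths (?J - {k}) n" "j \<in> ?J - {k}"
    show "graph_exp (\<lambda>R. ?w k j l R * of_bool ((j, k) \<in> R)) \<le> \<beta> * graph_exp (?w k j l)"
      by (rule graph_exp_near_le(1)[where h = "?w k j l"])
        (use * removed_weight_nonneg removed_weight_upd[OF *(2)] in auto)
  qed
  also have "\<dots> = \<beta> * graph_exp (\<lambda>R. \<Sum>k\<in>?J. \<Sum>l\<in>paths (?J - {k}) n. \<Sum>j\<in>?J - {k}. ?w k j l R)"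
    by (simp only: graph_exp_sum sum_distrib_left)
  also have "\<dots> \<le> \<beta> * graph_exp (\<lambda>R. card ?J * path_exp ?J R n (damping 1 ?J R))"
    by (rule mult_left_mono[OF graph_exp_mono[OF sum_removed_weight_le] \<beta>_nonneg]) simp_all
  finally show ?thesis by (simp add: graph_exp_cmult mult_ac)
qed


text \<open>Up to the factor 1 / a this majorizes \<open>removed_weight\<close>. On paths avoiding
  \<open>j\<close> and \<open>k\<close> it depends on neither position, so both points may be
  resampled.\<close>

definition doubly_removed :: "nat \<Rightarrow> nat \<Rightarrow> nat list \<Rightarrow> (nat \<times> nat) set \<Rightarrow> real" where
  "doubly_removed k j l R = path_prob ({..<N} - {k} - {j}) R l *
     damping 2 ({..<N} - {k} - {j}) R l"

lemma doubly_removed_nonneg: "doubly_removed k j l R \<ge> 0"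
  unfolding doubly_removed_def by (rule mult_nonneg_nonneg[OF path_prob_nonneg path_prod_nonneg]) simp

lemma doubly_removed_upd:
  assumes "l \<in> paths ({..<N} - {k} - {j}) n" "i \<in> {j, k}"
  shows "doubly_removed k j l (geom_graph (x(i := y))) = doubly_removed k j l (geom_graph x)"
proof -
  have "(b, m) \<in> geom_graph (x(i := y)) \<longleftrightarrow> (b, m) \<in> geom_graph x"
    if "b \<in> set l" "m \<in> {..<N} - {k} - {j}" for b m
    using that assms by (intro geom_graph_upd) (auto simp: paths_def)
  note cong = path_prob_cong[OF this] path_prod_graph_cong[OF this]
  show ?thesis unfolding doubly_removed_def by (simp only: cong)
qed

text \<open>Resampling \<open>k\<close> gives exactly the measure of the ball around point
  \<open>j\<close>, which is full when that point lies in \<open>D\<close>. Elsewhere only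
  nonnegativity of the measure is used, and the deficit is at most \<open>\<beta>\<close>.\<close>

lemma exp_removed_weight_near_ge:
  assumes D: "D \<in> sets borel" "\<And>z. z \<in> D \<Longrightarrow> measure \<mu> (cball z r) \<ge> \<beta>"
    and l: "l \<in> paths ({..<N} - {k}) n" and k: "k < N" and j: "j \<in> {..<N} - {k}"
  shows "graph_exp (\<lambda>R. removed_weight a {..<N} k j l R * of_bool ((j, k) \<in> R)) \<ge>
     \<beta> * graph_exp (removed_weight a {..<N} k j l) -
     \<beta> * (\<integral>x. removed_weight a {..<N} k j l (geom_graph x) * of_bool (x j \<notin> D) \<partial>P)"
proof -
  let ?w = "removed_weight a {..<N} k j l"
  let ?f = "\<lambda>x. of_bool ((j, k) \<in> geom_graph x) :: real"
  have meas [measurable]: "?f \<in> borel_measurable P" by (rule graph_fun_measurable)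
  have jk: "j \<noteq> k" "j < N" using j by auto
  have Dmeas [measurable]: "(\<lambda>x. of_bool (x j \<notin> D) :: real) \<in> borel_measurable P"
  proof -
    have "(\<lambda>z. of_bool (z \<notin> D) :: real) = indicator (- D)" by (auto simp: indicator_def)
    then have "(\<lambda>z. of_bool (z \<notin> D) :: real) \<in> borel_measurable borel" using D(1) by simp
    then show ?thesis by (rule measurable_compose[OF component_measurable[OF jk(2)]])
  qed
  obtain A where A: "\<And>x. \<bar>?w (geom_graph x)\<bar> \<le> A" using graph_fun_bounded[of ?w] by blast
  have b1: "\<bar>?f x\<bar> \<le> 1" for x by simp
  have inner: "(\<integral>y. ?f (x(k := y)) \<partial>\<mu>) = measure \<mu> (cball (x j) r)" for x
    by (rule integral_near(1)[OF jk k])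
  have intD: "integrable P (\<lambda>x. ?w (geom_graph x) * of_bool (x j \<notin> D))"
  proof (rule bounded_integrable[where B = A])
    show "\<bar>?w (geom_graph x) * of_bool (x j \<notin> D)\<bar> \<le> A" for x
      using A[of x] abs_ge_zero[of "?w (geom_graph x)"] by (cases "x j \<in> D") (auto simp del: abs_ge_zero)
  qed simp
  have "\<beta> * graph_exp ?w - \<beta> * (\<integral>x. ?w (geom_graph x) * of_bool (x j \<notin> D) \<partial>P) =
      (\<integral>x. \<beta> * ?w (geom_graph x) - \<beta> * (?w (geom_graph x) * of_bool (x j \<notin> D)) \<partial>P)"
    unfolding graph_exp_def using intD graph_fun_integrable[of ?w]
    by (subst Bochner_Integration.integral_diff) simp_all
  also have "\<dots> \<le> (\<integral>x. ?w (geom_graph x) * (\<integral>y. ?f (x(k := y)) \<partial>\<mu>) \<partial>P)"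
  proof (rule integral_mono)
    show "integrable P (\<lambda>x. \<beta> * ?w (geom_graph x) - \<beta> * (?w (geom_graph x) * of_bool (x j \<notin> D)))"
      using intD graph_fun_integrable[of ?w] by simp
    have "\<bar>?w (geom_graph x) * (\<integral>y. ?f (x(k := y)) \<partial>\<mu>)\<bar> \<le> A * 1" for x
      unfolding abs_mult
      using A[of x] integral_resample(3)[OF k meas b1, of x] abs_ge_zero[of "?w (geom_graph x)"]
      by (intro mult_mono) (auto simp del: abs_ge_zero)
    then show "integrable P (\<lambda>x. ?w (geom_graph x) * (\<integral>y. ?f (x(k := y)) \<partial>\<mu>))"
      using integral_resample(2)[OF k meas b1] by (intro bounded_integrable[where B = "A * 1"]) simp_all
    fix x
    have "\<beta> - \<beta> * of_bool (x j \<notin> D) \<le> measure \<mu> (cball (x j) r)"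
      using D(2)[of "x j"] by (cases "x j \<in> D") simp_all
    from mult_left_mono[OF this removed_weight_nonneg]
    show "\<beta> * ?w (geom_graph x) - \<beta> * (?w (geom_graph x) * of_bool (x j \<notin> D)) \<le>
        ?w (geom_graph x) * (\<integral>y. ?f (x(k := y)) \<partial>\<mu>)"
      unfolding inner by (simp add: algebra_simps)
  qed
  also have "\<dots> = graph_exp (\<lambda>R. ?w R * of_bool ((j, k) \<in> R))"
    unfolding graph_exp_def
    by (rule integral_resample_mult[OF k removed_weight_upd[OF l] meas b1, symmetric])
  finally show ?thesis .
qed

text \<open>The event concerns point \<open>j\<close>, on which \<open>removed_weight\<close>
  depends. Passing to \<open>doubly_removed\<close> removes this dependence, and resampling
  \<open>j\<close> then yields the probability of the boundary layer, at most
  \<open>\<gamma>\<close>.\<close>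

lemma exp_removed_weight_boundary_le:
  assumes D: "D \<in> sets borel" "measure \<mu> (- D) \<le> \<gamma>"
    and k: "k < N" and j: "j \<in> {..<N} - {k}" and a: "a > 0"
  shows "(\<Sum>l\<in>paths ({..<N} - {k}) n.
      \<integral>x. removed_weight a {..<N} k j l (geom_graph x) * of_bool (x j \<notin> D) \<partial>P) \<le>
    (\<Sum>l\<in>paths ({..<N} - {k} - {j}) n. \<gamma> / a * graph_exp (doubly_removed k j l))"
proof -
  have jk: "j \<noteq> k" "j < N" using j by auto
  have Deq: "(\<lambda>z. of_bool (z \<notin> D) :: real) = indicator (- D)" by (auto simp: indicator_def)
  have Dmeas: "(\<lambda>x. of_bool (x j \<notin> D) :: real) \<in> borel_measurable P"
  proof -
    have "(\<lambda>z. of_bool (z \<notin> D) :: real) \<in> borel_measurable borel" using D(1) by (simp add: Deq)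
    then show ?thesis by (rule measurable_compose[OF component_measurable[OF jk(2)]])
  qed
  have int: "integrable P (\<lambda>x. h (geom_graph x) * of_bool (x j \<notin> D))" for h :: "(nat \<times> nat) set \<Rightarrow> real"
  proof -
    obtain A where A: "\<And>x. \<bar>h (geom_graph x)\<bar> \<le> A" using graph_fun_bounded[of h] by blast
    show ?thesis
    proof (rule bounded_integrable[where B = A])
      show "\<bar>h (geom_graph x) * of_bool (x j \<notin> D)\<bar> \<le> A" for x
        using A[of x] abs_ge_zero[of "h (geom_graph x)"] by (cases "x j \<in> D") (auto simp del: abs_ge_zero)
      show "(\<lambda>x. h (geom_graph x) * of_bool (x j \<notin> D)) \<in> borel_measurable P"
        using Dmeas graph_fun_measurable[of h] by (rule borel_measurable_times[rotated])
    qed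
  qed
  have "(\<Sum>l\<in>paths ({..<N} - {k}) n.
      \<integral>x. removed_weight a {..<N} k j l (geom_graph x) * of_bool (x j \<notin> D) \<partial>P) =
    (\<integral>x. (\<Sum>l\<in>paths ({..<N} - {k}) n. removed_weight a {..<N} k j l (geom_graph x) * of_bool (x j \<notin> D)) \<partial>P)"
    by (rule Bochner_Integration.integral_sum[symmetric]) (rule int)
  also have "\<dots> \<le> (\<integral>x. (\<Sum>l\<in>paths ({..<N} - {k} - {j}) n. 1 / a * (doubly_removed k j l (geom_graph x) * of_bool (x j \<notin> D))) \<partial>P)"
  proof (rule integral_mono)
    show "integrable P (\<lambda>x. \<Sum>l\<in>paths ({..<N} - {k}) n. removed_weight a {..<N} k j l (geom_graph x) * of_bool (x j \<notin> D))"
      by (rule Bochner_Integration.integrable_sum) (rule int)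
    show "integrable P (\<lambda>x. \<Sum>l\<in>paths ({..<N} - {k} - {j}) n. 1 / a * (doubly_removed k j l (geom_graph x) * of_bool (x j \<notin> D)))"
      by (rule Bochner_Integration.integrable_sum, rule integrable_mult_right) (rule int)
    fix x
    show "(\<Sum>l\<in>paths ({..<N} - {k}) n. removed_weight a {..<N} k j l (geom_graph x) * of_bool (x j \<notin> D)) \<le>
      (\<Sum>l\<in>paths ({..<N} - {k} - {j}) n. 1 / a * (doubly_removed k j l (geom_graph x) * of_bool (x j \<notin> D)))"
      using removed_weight_le_remove[of "{..<N}" "geom_graph x" a j k "\<lambda>_. of_bool (x j \<notin> D)" n] a j
      by (simp add: geom_graph_refl doubly_removed_def)
  qed
  also have "\<dots> = (\<Sum>l\<in>paths ({..<N} - {k} - {j}) n. 1 / a * (\<integral>x. doubly_removed k j l (geom_graph x) * of_bool (x j \<notin> D) \<partial>P))"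
    by (subst Bochner_Integration.integral_sum) (use int in \<open>simp_all\<close>)
  also have "\<dots> \<le> (\<Sum>l\<in>paths ({..<N} - {k} - {j}) n. 1 / a * (\<gamma> * graph_exp (doubly_removed k j l)))"
  proof (rule sum_mono, rule mult_left_mono)
    fix l assume l: "l \<in> paths ({..<N} - {k} - {j}) n"
    show "(\<integral>x. doubly_removed k j l (geom_graph x) * of_bool (x j \<notin> D) \<partial>P) \<le> \<gamma> * graph_exp (doubly_removed k j l)"
    proof (rule integral_resample_le[OF jk(2) doubly_removed_upd[OF l] doubly_removed_nonneg Dmeas, where B = 1])
      show "(\<integral>y. of_bool ((x(j := y)) j \<notin> D) \<partial>\<mu>) \<le> \<gamma>" for x
        using D(2) by (simp add: Deq space_\<mu>)
    qed simp_all
  qed (use a in simp)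
  finally show ?thesis by simp
qed

text \<open>Three points are involved: \<open>j\<close> is averaged first, given the position of
  \<open>k\<close>, and then \<open>k\<close>, given that of \<open>b\<close>. In this order each
  average meets a single distance condition and gives one factor \<open>\<beta>\<close>; the path
  has at most \<open>n\<close> vertices \<open>b\<close>.\<close>

lemma exp_removed_weight_triple_le:
  assumes k: "k < N" and j: "j \<in> {..<N} - {k}" and a: "a > 0"
  shows "(\<Sum>l\<in>paths ({..<N} - {k}) n. graph_exp (\<lambda>R. removed_weight a {..<N} k j l R *
        (\<Sum>b\<in>set l. of_bool ((j, k) \<in> R) * of_bool ((b, k) \<in> R)))) \<le>
    (\<Sum>l\<in>paths ({..<N} - {k} - {j}) n. real n * \<beta>\<^sup>2 / a * graph_exp (doubly_removed k j l))"
proof -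
  have jk: "j \<noteq> k" "j < N" using j by auto
  have "(\<Sum>l\<in>paths ({..<N} - {k}) n. graph_exp (\<lambda>R. removed_weight a {..<N} k j l R *
        (\<Sum>b\<in>set l. of_bool ((j, k) \<in> R) * of_bool ((b, k) \<in> R)))) =
     graph_exp (\<lambda>R. \<Sum>l\<in>paths ({..<N} - {k}) n. removed_weight a {..<N} k j l R *
        (\<Sum>b\<in>set l. of_bool ((j, k) \<in> R) * of_bool ((b, k) \<in> R)))"
    by (rule graph_exp_sum[symmetric])
  also have "\<dots> \<le> graph_exp (\<lambda>R. \<Sum>l\<in>paths ({..<N} - {k} - {j}) n. 1 / a * (\<Sum>b\<in>set l.
        (doubly_removed k j l R * of_bool ((b, k) \<in> R)) * of_bool ((j, k) \<in> R)))"
  proof (rule graph_exp_mono)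
    fix R :: "(nat \<times> nat) set" assume "\<And>i. i < N \<Longrightarrow> (i, i) \<in> R"
    then have "(\<Sum>l\<in>paths ({..<N} - {k}) n. removed_weight a {..<N} k j l R *
        (\<Sum>b\<in>set l. of_bool ((j, k) \<in> R) * of_bool ((b, k) \<in> R))) \<le>
      (\<Sum>l\<in>paths ({..<N} - {k} - {j}) n. doubly_removed k j l R / a *
        (\<Sum>b\<in>set l. of_bool ((j, k) \<in> R) * of_bool ((b, k) \<in> R)))"
      unfolding doubly_removed_def using a j
      by (intro removed_weight_le_remove) (simp_all add: sum_nonneg)
    also have "\<dots> = (\<Sum>l\<in>paths ({..<N} - {k} - {j}) n. 1 / a * (\<Sum>b\<in>set l.
        (doubly_removed k j l R * of_bool ((b, k) \<in> R)) * of_bool ((j, k) \<in> R)))"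
      by (rule sum.cong[OF refl]) (simp only: sum_distrib_left times_divide_eq_left times_divide_eq_right mult_1_left mult_ac)
    finally show "(\<Sum>l\<in>paths ({..<N} - {k}) n. removed_weight a {..<N} k j l R *
        (\<Sum>b\<in>set l. of_bool ((j, k) \<in> R) * of_bool ((b, k) \<in> R))) \<le> \<dots>" .
  qed
  also have "\<dots> = (\<Sum>l\<in>paths ({..<N} - {k} - {j}) n. 1 / a * (\<Sum>b\<in>set l.
        graph_exp (\<lambda>R. (doubly_removed k j l R * of_bool ((b, k) \<in> R)) * of_bool ((j, k) \<in> R))))"
    by (simp only: graph_exp_sum graph_exp_cmult)
  also have "\<dots> \<le> (\<Sum>l\<in>paths ({..<N} - {k} - {j}) n. 1 / a * (\<Sum>b\<in>set l. \<beta> * (\<beta> * graph_exp (doubly_removed k j l))))"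
  proof (rule sum_mono, rule mult_left_mono, rule sum_mono)
    fix l b assume l: "l \<in> paths ({..<N} - {k} - {j}) n" and "b \<in> set l"
    then have b: "b \<noteq> k" "b \<noteq> j" "b < N" by (auto simp: paths_def)
    have "graph_exp (\<lambda>R. (doubly_removed k j l R * of_bool ((b, k) \<in> R)) * of_bool ((j, k) \<in> R)) \<le>
        \<beta> * graph_exp (\<lambda>R. doubly_removed k j l R * of_bool ((b, k) \<in> R))"
    proof (rule graph_exp_near_le(2)[OF _ k jk(2), where h = "\<lambda>R. doubly_removed k j l R * of_bool ((b, k) \<in> R)"])
      show "doubly_removed k j l (geom_graph (x(j := y))) * of_bool ((b, k) \<in> geom_graph (x(j := y))) =
          doubly_removed k j l (geom_graph x) * of_bool ((b, k) \<in> geom_graph x)" for x y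
        using doubly_removed_upd[OF l, of j x y] geom_graph_upd[of b j k x y] b jk by simp
    qed (use jk doubly_removed_nonneg in auto)
    also have "\<dots> \<le> \<beta> * (\<beta> * graph_exp (doubly_removed k j l))"
    proof (rule mult_left_mono[OF _ \<beta>_nonneg])
      show "graph_exp (\<lambda>R. doubly_removed k j l R * of_bool ((b, k) \<in> R)) \<le> \<beta> * graph_exp (doubly_removed k j l)"
        by (rule graph_exp_near_le(1)[OF b(1,3) k, where h = "doubly_removed k j l"])
          (use doubly_removed_upd[OF l, of k] doubly_removed_nonneg in auto)
    qed
    finally show "graph_exp (\<lambda>R. (doubly_removed k j l R * of_bool ((b, k) \<in> R)) * of_bool ((j, k) \<in> R)) \<le> \<dots>" .
  qed (use a in simp)
  also have "\<dots> \<le> (\<Sum>l\<in>paths ({..<N} - {k} - {j}) n. real n * \<beta>\<^sup>2 / a * graph_exp (doubly_removed k j l))"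
  proof (rule sum_mono)
    fix l assume "l \<in> paths ({..<N} - {k} - {j}) n"
    then have "real (card (set l)) \<le> real n" using card_length[of l] by (auto simp: paths_def)
    moreover have "\<beta>\<^sup>2 / a * graph_exp (doubly_removed k j l) \<ge> 0"
      using a by (intro mult_nonneg_nonneg graph_exp_nonneg doubly_removed_nonneg) simp_all
    ultimately have "real (card (set l)) * (\<beta>\<^sup>2 / a * graph_exp (doubly_removed k j l)) \<le>
        real n * (\<beta>\<^sup>2 / a * graph_exp (doubly_removed k j l))"
      by (rule mult_right_mono)
    then show "1 / a * (\<Sum>b\<in>set l. \<beta> * (\<beta> * graph_exp (doubly_removed k j l))) \<le>
      real n * \<beta>\<^sup>2 / a * graph_exp (doubly_removed k j l)"
      by (simp add: power2_eq_square mult_ac)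
  qed
  finally show ?thesis .
qed

lemma pairs_ge:
  assumes D: "D \<in> sets borel" "\<And>z. z \<in> D \<Longrightarrow> measure \<mu> (cball z r) \<ge> \<beta>"
    "measure \<mu> (- D) \<le> \<gamma>" and a: "a > 0"
  shows "graph_exp (\<lambda>R. path_exp {..<N} R n (\<lambda>l. of_bool (a \<le> ucount {..<N} R l) *
       (unexplored_pairs {..<N} R l / ucount {..<N} R l))) \<ge>
     real N * \<beta> * graph_exp (\<lambda>R. path_exp {..<N} R n (\<lambda>l. path_prod (\<lambda>u. (u - 1) / u) {..<N} R l *
       (of_bool (a \<le> ucount {..<N} R l) * ((ucount {..<N} R l - 1) / ucount {..<N} R l)))) -
     \<beta> * \<gamma> * (real N)\<^sup>2 / a -
     (real N * \<beta>)\<^sup>2 * (n / a) * graph_exp (\<lambda>R. path_exp {..<N} R n (damping 2 {..<N} R))"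
proof -
  let ?J = "{..<N}"
  let ?w = "removed_weight a ?J"
  let ?near = "\<lambda>j k R. of_bool ((j, k) \<in> R) :: real"
  let ?trip = "\<lambda>j k l R. \<Sum>b\<in>set l. ?near j k R * ?near b k R"
  let ?out = "\<lambda>k l j. \<integral>x. ?w k j l (geom_graph x) * of_bool (x j \<notin> D) \<partial>P"
  let ?V = "\<Sum>k\<in>?J. \<Sum>j\<in>?J - {k}. \<Sum>l\<in>paths (?J - {k} - {j}) n. graph_exp (doubly_removed k j l)"
  have \<gamma>: "\<gamma> \<ge> 0" using D(3) measure_nonneg[of \<mu> "- D"] by linarith
  have V: "?V = graph_exp (\<lambda>R. \<Sum>k\<in>?J. \<Sum>j\<in>?J - {k}. path_exp (?J - {k} - {j}) R n
            (damping 2 (?J - {k} - {j}) R))"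
    unfolding path_exp_def graph_exp_sum doubly_removed_def ..
  \<comment> \<open>Two bounds for \<open>?V\<close>: the sharp one keeps the damping, which becomes
    X^2 in the correction term; the crude one below suffices for the boundary term, whose factor
    \<open>\<gamma>\<close> will tend to 0.\<close>
  have V2: "?V \<le> (real N)\<^sup>2 * graph_exp (\<lambda>R. path_exp ?J R n (damping 2 ?J R))"
  proof -
    have "?V \<le> graph_exp (\<lambda>R. (real (card ?J))\<^sup>2 * path_exp ?J R n (damping 2 ?J R))"
      unfolding V by (rule graph_exp_mono, rule order.trans[OF sum_remove_twice_le]) simp_all
    then show ?thesis by (simp add: graph_exp_cmult)
  qed
  have V1: "?V \<le> (real N)\<^sup>2"
  proof -
    have "graph_exp (\<lambda>R. path_exp ?J R n (damping 2 ?J R)) \<le> graph_exp (\<lambda>R. 1)"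
    proof (rule graph_exp_mono)
      fix R
      have "path_exp ?J R n (damping 2 ?J R) \<le> path_exp ?J R n (\<lambda>l. 1)"
        by (rule path_exp_mono, rule path_prod_le_1) auto
      then show "path_exp ?J R n (damping 2 ?J R) \<le> 1"
        using path_exp_one_le[of ?J R n] by simp
    qed
    then have "(real N)\<^sup>2 * graph_exp (\<lambda>R. path_exp ?J R n (damping 2 ?J R)) \<le> (real N)\<^sup>2 * 1"
      by (intro mult_left_mono) (simp_all add: graph_exp_const)
    with V2 show ?thesis by simp
  qed
  have "real N * \<beta> * graph_exp (\<lambda>R. path_exp ?J R n (\<lambda>l. path_prod (\<lambda>u. (u - 1) / u) ?J R l *
       (of_bool (a \<le> ucount ?J R l) * ((ucount ?J R l - 1) / ucount ?J R l)))) =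
     \<beta> * graph_exp (\<lambda>R. card ?J * path_exp ?J R n (\<lambda>l. path_prod (\<lambda>u. (u - 1) / u) ?J R l *
       (of_bool (a \<le> ucount ?J R l) * ((ucount ?J R l - 1) / ucount ?J R l))))"
    by (simp add: graph_exp_cmult)
  also have "\<dots> \<le> \<beta> * graph_exp (\<lambda>R. \<Sum>k\<in>?J. \<Sum>l\<in>paths (?J - {k}) n. \<Sum>j\<in>?J - {k}. ?w k j l R)"
    by (rule mult_left_mono[OF graph_exp_mono[OF sum_removed_weight_ge] \<beta>_nonneg]) (simp_all add: a)
  also have "\<dots> = (\<Sum>k\<in>?J. \<Sum>l\<in>paths (?J - {k}) n. \<Sum>j\<in>?J - {k}. \<beta> * graph_exp (?w k j l))"
    by (simp only: graph_exp_sum sum_distrib_left)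
  also have "\<dots> \<le> (\<Sum>k\<in>?J. \<Sum>l\<in>paths (?J - {k}) n. \<Sum>j\<in>?J - {k}.
      graph_exp (\<lambda>R. ?w k j l R * ?near j k R) + \<beta> * ?out k l j)"
  proof (rule sum_mono, rule sum_mono, rule sum_mono)
    fix k l j assume *: "k \<in> ?J" "l \<in> paths (?J - {k}) n" "j \<in> ?J - {k}"
    show "\<beta> * graph_exp (?w k j l) \<le> graph_exp (\<lambda>R. ?w k j l R * ?near j k R) + \<beta> * ?out k l j"
      using exp_removed_weight_near_ge[OF D(1,2) *(2) _ *(3), of a] * by simp
  qed
  finally have A: "real N * \<beta> * graph_exp (\<lambda>R. path_exp ?J R n (\<lambda>l. path_prod (\<lambda>u. (u - 1) / u) ?J R l *
       (of_bool (a \<le> ucount ?J R l) * ((ucount ?J R l - 1) / ucount ?J R l)))) \<le>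
     (\<Sum>k\<in>?J. \<Sum>l\<in>paths (?J - {k}) n. \<Sum>j\<in>?J - {k}. graph_exp (\<lambda>R. ?w k j l R * ?near j k R)) +
     \<beta> * (\<Sum>k\<in>?J. \<Sum>l\<in>paths (?J - {k}) n. \<Sum>j\<in>?J - {k}. ?out k l j)"
    by (simp only: sum.distrib sum_distrib_left)
  have "(\<Sum>k\<in>?J. \<Sum>l\<in>paths (?J - {k}) n. \<Sum>j\<in>?J - {k}. ?out k l j) =
      (\<Sum>k\<in>?J. \<Sum>j\<in>?J - {k}. \<Sum>l\<in>paths (?J - {k}) n. ?out k l j)"
    by (rule sum.cong[OF refl], rule sum.swap)
  also have "\<dots> \<le> (\<Sum>k\<in>?J. \<Sum>j\<in>?J - {k}. \<Sum>l\<in>paths (?J - {k} - {j}) n. \<gamma> / a * graph_exp (doubly_removed k j l))"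
    by (rule sum_mono, rule sum_mono, rule exp_removed_weight_boundary_le[OF D(1,3)]) (simp_all add: a)
  also have "\<dots> = \<gamma> / a * ?V" by (simp only: sum_distrib_left)
  also have "\<dots> \<le> \<gamma> / a * (real N)\<^sup>2" using V1 \<gamma> a by (intro mult_left_mono) simp_all
  finally have B: "(\<Sum>k\<in>?J. \<Sum>l\<in>paths (?J - {k}) n. \<Sum>j\<in>?J - {k}. ?out k l j) \<le> \<gamma> / a * (real N)\<^sup>2" .
  have "(\<Sum>k\<in>?J. \<Sum>l\<in>paths (?J - {k}) n. \<Sum>j\<in>?J - {k}. graph_exp (\<lambda>R. ?w k j l R * ?trip j k l R)) =
      (\<Sum>k\<in>?J. \<Sum>j\<in>?J - {k}. \<Sum>l\<in>paths (?J - {k}) n. graph_exp (\<lambda>R. ?w k j l R * ?trip j k l R))"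
    by (rule sum.cong[OF refl], rule sum.swap)
  also have "\<dots> \<le> (\<Sum>k\<in>?J. \<Sum>j\<in>?J - {k}. \<Sum>l\<in>paths (?J - {k} - {j}) n. real n * \<beta>\<^sup>2 / a * graph_exp (doubly_removed k j l))"
    by (rule sum_mono, rule sum_mono, rule exp_removed_weight_triple_le) (simp_all add: a)
  also have "\<dots> = real n * \<beta>\<^sup>2 / a * ?V" by (simp only: sum_distrib_left)
  also have "\<dots> \<le> real n * \<beta>\<^sup>2 / a * ((real N)\<^sup>2 * graph_exp (\<lambda>R. path_exp ?J R n (damping 2 ?J R)))"
    using V2 a by (intro mult_left_mono) simp_all
  finally have C: "(\<Sum>k\<in>?J. \<Sum>l\<in>paths (?J - {k}) n. \<Sum>j\<in>?J - {k}. graph_exp (\<lambda>R. ?w k j l R * ?trip j k l R)) \<le> \<dots>" .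
  have "(\<Sum>k\<in>?J. \<Sum>l\<in>paths (?J - {k}) n. \<Sum>j\<in>?J - {k}. graph_exp (\<lambda>R. ?w k j l R * ?near j k R)) -
     (\<Sum>k\<in>?J. \<Sum>l\<in>paths (?J - {k}) n. \<Sum>j\<in>?J - {k}. graph_exp (\<lambda>R. ?w k j l R * ?trip j k l R)) =
     graph_exp (\<lambda>R. \<Sum>k\<in>?J. \<Sum>l\<in>paths (?J - {k}) n. \<Sum>j\<in>?J - {k}. ?w k j l R * ?near j k R - ?w k j l R * ?trip j k l R)"
    by (simp only: graph_exp_sum graph_exp_diff sum_subtractf)
  also have "\<dots> \<le> graph_exp (\<lambda>R. path_exp ?J R n (\<lambda>l. of_bool (a \<le> ucount ?J R l) *
       (unexplored_pairs ?J R l / ucount ?J R l)))"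
  proof (rule graph_exp_mono)
    fix R :: "(nat \<times> nat) set" assume R: "\<And>i. i < N \<Longrightarrow> (i, i) \<in> R"
    have "(\<Sum>k\<in>?J. \<Sum>l\<in>paths (?J - {k}) n. \<Sum>j\<in>?J - {k}. ?w k j l R * ?near j k R - ?w k j l R * ?trip j k l R) \<le>
      (\<Sum>k\<in>?J. \<Sum>l\<in>paths (?J - {k}) n. \<Sum>j\<in>?J - {k}. ?w k j l R *
       (of_bool (k \<in> unexplored ?J R l) * ?near j k R))"
    proof (rule sum_mono, rule sum_mono, rule sum_mono)
      fix k l j assume k: "k \<in> ?J"
      \<comment> \<open>Union bound: if \<open>k\<close> is explored, some \<open>b\<close> on the
        path is adjacent to it, and the corresponding summand of \<open>?trip\<close> already equals
        \<open>?near j k R\<close>.\<close>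
      have "?near j k R - ?trip j k l R \<le> of_bool (k \<in> unexplored ?J R l) * ?near j k R"
      proof (cases "k \<in> unexplored ?J R l")
        case True
        then show ?thesis by (simp add: sum_nonneg)
      next
        case False
        then obtain b where "b \<in> set l" "(b, k) \<in> R" using k by (auto simp: unexplored_def)
        then have "?near j k R \<le> ?trip j k l R"
          using member_le_sum[of b "set l" "\<lambda>b. ?near j k R * ?near b k R"] by simp
        then show ?thesis using False by simp
      qed
      from mult_left_mono[OF this removed_weight_nonneg]
      show "?w k j l R * ?near j k R - ?w k j l R * ?trip j k l R \<le> ?w k j l R *
       (of_bool (k \<in> unexplored ?J R l) * ?near j k R)"
        by (simp only: right_diff_distrib)
    qed
    also have "\<dots> = path_exp ?J R n (\<lambda>l. of_bool (a \<le> ucount ?J R l) * (unexplored_pairs ?J R l / ucount ?J R l))"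
      by (rule path_exp_unexplored_pairs[symmetric]) (simp_all add: R)
    finally show "(\<Sum>k\<in>?J. \<Sum>l\<in>paths (?J - {k}) n. \<Sum>j\<in>?J - {k}. ?w k j l R * ?near j k R - ?w k j l R * ?trip j k l R) \<le> \<dots>" .
  qed
  finally have E: "(\<Sum>k\<in>?J. \<Sum>l\<in>paths (?J - {k}) n. \<Sum>j\<in>?J - {k}. graph_exp (\<lambda>R. ?w k j l R * ?near j k R)) -
     (\<Sum>k\<in>?J. \<Sum>l\<in>paths (?J - {k}) n. \<Sum>j\<in>?J - {k}. graph_exp (\<lambda>R. ?w k j l R * ?trip j k l R)) \<le> \<dots>" .
  have "\<beta> * (\<Sum>k\<in>?J. \<Sum>l\<in>paths (?J - {k}) n. \<Sum>j\<in>?J - {k}. ?out k l j) \<le> \<beta> * (\<gamma> / a * (real N)\<^sup>2)"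
    by (rule mult_left_mono[OF B \<beta>_nonneg])
  then have B': "\<beta> * (\<Sum>k\<in>?J. \<Sum>l\<in>paths (?J - {k}) n. \<Sum>j\<in>?J - {k}. ?out k l j) \<le> \<beta> * \<gamma> * (real N)\<^sup>2 / a"
    by (simp only: times_divide_eq_left times_divide_eq_right mult.assoc)
  have "real n * \<beta>\<^sup>2 / a * ((real N)\<^sup>2 * v) = (real N * \<beta>)\<^sup>2 * (n / a) * v" for v
    by (simp add: power_mult_distrib)
  note C' = C[unfolded this]
  from A B' C' E show ?thesis by linarith
qed

end

section \<open>The law of the exploration\<close>

context random_points
begin

definition mean_unexplored :: "nat \<Rightarrow> real" where
  "mean_unexplored n = graph_exp (\<lambda>R. path_exp {..<N} R n (ucount {..<N} R))"

lemma mean_unexplored_Suc_ge: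
  "mean_unexplored n - mean_unexplored (Suc n) \<le>
   1 + real N * \<beta> * graph_exp (\<lambda>R. path_exp {..<N} R n (damping 1 {..<N} R))"
proof -
  let ?J = "{..<N}"
  have "mean_unexplored n - mean_unexplored (Suc n) =
     graph_exp (\<lambda>R. path_exp ?J R n (ucount ?J R) - path_exp ?J R (Suc n) (ucount ?J R))"
    by (simp add: mean_unexplored_def graph_exp_diff)
  also have "\<dots> \<le> graph_exp (\<lambda>R. 1 + path_exp ?J R n (\<lambda>l. unexplored_pairs ?J R l / ucount ?J R l))"
  proof (rule graph_exp_mono)
    fix R :: "(nat \<times> nat) set" assume R: "\<And>i. i < N \<Longrightarrow> (i, i) \<in> R"
    have "path_exp ?J R n (ucount ?J R) - path_exp ?J R (Suc n) (ucount ?J R) =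
        path_exp ?J R n (\<lambda>l. of_bool (unexplored ?J R l \<noteq> {}) + unexplored_pairs ?J R l / ucount ?J R l)"
      by (rule path_exp_ucount_Suc) (simp_all add: R)
    also have "\<dots> = path_exp ?J R n (\<lambda>l. of_bool (unexplored ?J R l \<noteq> {})) +
        path_exp ?J R n (\<lambda>l. unexplored_pairs ?J R l / ucount ?J R l)"
      by (rule path_exp_add)
    also have "path_exp ?J R n (\<lambda>l. of_bool (unexplored ?J R l \<noteq> {})) \<le> 1"
      by (rule order.trans[OF path_exp_mono path_exp_one_le]) simp_all
    finally show "path_exp ?J R n (ucount ?J R) - path_exp ?J R (Suc n) (ucount ?J R) \<le>
        1 + path_exp ?J R n (\<lambda>l. unexplored_pairs ?J R l / ucount ?J R l)" by simp
  qed
  also have "\<dots> = 1 + graph_exp (\<lambda>R. path_exp ?J R n (\<lambda>l. unexplored_pairs ?J R l / ucount ?J R l))"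
    by (simp add: graph_exp_add graph_exp_const)
  finally show ?thesis using pairs_le[of n] by linarith
qed

lemma mean_unexplored_Suc_le:
  assumes D: "D \<in> sets borel" "\<And>z. z \<in> D \<Longrightarrow> measure \<mu> (cball z r) \<ge> \<beta>"
    "measure \<mu> (- D) \<le> \<gamma>" and a: "a > 0"
  shows "mean_unexplored n - mean_unexplored (Suc n) \<ge>
     graph_exp (\<lambda>R. path_exp {..<N} R n (\<lambda>l. of_bool (a \<le> ucount {..<N} R l))) +
     real N * \<beta> * graph_exp (\<lambda>R. path_exp {..<N} R n (\<lambda>l. path_prod (\<lambda>u. (u - 1) / u) {..<N} R l *
       (of_bool (a \<le> ucount {..<N} R l) * ((ucount {..<N} R l - 1) / ucount {..<N} R l)))) -
     \<beta> * \<gamma> * (real N)\<^sup>2 / a -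
     (real N * \<beta>)\<^sup>2 * (n / a) * graph_exp (\<lambda>R. path_exp {..<N} R n (damping 2 {..<N} R))"
proof -
  let ?J = "{..<N}"
  have "graph_exp (\<lambda>R. path_exp ?J R n (\<lambda>l. of_bool (a \<le> ucount ?J R l))) +
     graph_exp (\<lambda>R. path_exp ?J R n (\<lambda>l. of_bool (a \<le> ucount ?J R l) * (unexplored_pairs ?J R l / ucount ?J R l))) =
     graph_exp (\<lambda>R. path_exp ?J R n (\<lambda>l. of_bool (a \<le> ucount ?J R l) + of_bool (a \<le> ucount ?J R l) * (unexplored_pairs ?J R l / ucount ?J R l)))"
    by (simp add: graph_exp_add path_exp_add)
  also have "\<dots> \<le> graph_exp (\<lambda>R. path_exp ?J R n (ucount ?J R) - path_exp ?J R (Suc n) (ucount ?J R))"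
  proof (rule graph_exp_mono)
    fix R :: "(nat \<times> nat) set" assume R: "\<And>i. i < N \<Longrightarrow> (i, i) \<in> R"
    have "path_exp ?J R n (\<lambda>l. of_bool (a \<le> ucount ?J R l) + of_bool (a \<le> ucount ?J R l) * (unexplored_pairs ?J R l / ucount ?J R l)) \<le>
        path_exp ?J R n (\<lambda>l. of_bool (unexplored ?J R l \<noteq> {}) + unexplored_pairs ?J R l / ucount ?J R l)"
    proof (rule path_exp_mono)
      fix l
      have "unexplored_pairs ?J R l / ucount ?J R l \<ge> 0"
        unfolding unexplored_pairs_def by (intro divide_nonneg_nonneg sum_nonneg) simp_all
      then show "of_bool (a \<le> ucount ?J R l) + of_bool (a \<le> ucount ?J R l) * (unexplored_pairs ?J R l / ucount ?J R l) \<le>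
        of_bool (unexplored ?J R l \<noteq> {}) + unexplored_pairs ?J R l / ucount ?J R l"
        using a by (cases "unexplored ?J R l = {}"; cases "a \<le> ucount ?J R l") simp_all
    qed
    also have "\<dots> = path_exp ?J R n (ucount ?J R) - path_exp ?J R (Suc n) (ucount ?J R)"
      by (rule path_exp_ucount_Suc[symmetric]) (simp_all add: R)
    finally show "path_exp ?J R n (\<lambda>l. of_bool (a \<le> ucount ?J R l) + of_bool (a \<le> ucount ?J R l) * (unexplored_pairs ?J R l / ucount ?J R l)) \<le> \<dots>" .
  qed
  also have "\<dots> = mean_unexplored n - mean_unexplored (Suc n)"
    by (simp add: mean_unexplored_def graph_exp_diff)
  finally show ?thesis using pairs_ge[OF D a, of n] by linarith
qed

lemma explore_point_unexplored:
  assumes "i \<in> unexplored {..<N} (geom_graph x) l"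
  shows "explore_point r N x ({..<N} - unexplored {..<N} (geom_graph x) l) i =
         {..<N} - unexplored {..<N} (geom_graph x) (i # l)"
  using assms unexplored_subset[of "{..<N}" "geom_graph x" l] r_nonneg
  unfolding explore_point_def unexplored_Cons
  by (auto simp: geom_graph_def)

text \<open>The exploration stays at a full state, whereas path weights lose their mass there. The
  two laws agree elsewhere, so they are compared on functions vanishing at full states.\<close>

lemma nn_integral_exploration:
  fixes F :: "nat set \<Rightarrow> ennreal"
  assumes "\<And>S. {..<N} \<subseteq> S \<Longrightarrow> F S = 0"
  shows "(\<integral>\<^sup>+S. F S \<partial>measure_pmf (exploration r N x n)) =
    (\<Sum>l\<in>paths {..<N} n. ennreal (path_prob {..<N} (geom_graph x) l) *
       F ({..<N} - unexplored {..<N} (geom_graph x) l))"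
  using assms
proof (induction n arbitrary: F)
  case 0
  then show ?case by (simp add: paths_0)
next
  case (Suc n)
  let ?J = "{..<N}" and ?U = "unexplored {..<N} (geom_graph x)"
  let ?p = "path_prob {..<N} (geom_graph x)"
  have "(\<integral>\<^sup>+S. F S \<partial>measure_pmf (exploration r N x (Suc n))) =
      (\<integral>\<^sup>+S. (\<integral>\<^sup>+S'. F S' \<partial>measure_pmf (explore_step r N x S)) \<partial>measure_pmf (exploration r N x n))"
    by (simp only: exploration.simps nn_integral_bind_pmf)
  \<comment> \<open>The induction hypothesis is used for the one-step average of \<open>F\<close>,
    which again vanishes on full states because these are absorbing.\<close>
  also have "\<dots> = (\<Sum>l\<in>paths ?J n. ennreal (?p l) *
      (\<integral>\<^sup>+S'. F S' \<partial>measure_pmf (explore_step r N x (?J - ?U l))))"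
    by (rule Suc.IH) (simp add: explore_step_def Suc.prems)
  also have "\<dots> = (\<Sum>l\<in>paths ?J n. \<Sum>i\<in>?J. ennreal (?p (i # l)) * F (?J - ?U (i # l)))"
  proof (rule sum.cong[OF refl])
    fix l
    have fin: "finite (?U l)" by (simp add: finite_unexplored)
    have sub: "?U l \<subseteq> ?J" by (rule unexplored_subset)
    then have JU: "?J - (?J - ?U l) = ?U l" by auto
    have rhs: "(\<Sum>i\<in>?J. ennreal (?p (i # l)) * F (?J - ?U (i # l))) =
        (\<Sum>i\<in>?U l. ennreal (?p l / ucount ?J (geom_graph x) l) * F (?J - ?U (i # l)))"
      using sub by (intro sum.mono_neutral_cong_right) auto
    show "ennreal (?p l) * (\<integral>\<^sup>+S'. F S' \<partial>measure_pmf (explore_step r N x (?J - ?U l))) =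
        (\<Sum>i\<in>?J. ennreal (?p (i # l)) * F (?J - ?U (i # l)))"
    proof (cases "?U l = {}")
      case True
      then show ?thesis unfolding rhs by (simp add: explore_step_def Suc.prems)
    next
      case False
      have "explore_step r N x (?J - ?U l) = map_pmf (explore_point r N x (?J - ?U l)) (pmf_of_set (?U l))"
        using False sub unfolding explore_step_def JU by auto
      then have "(\<integral>\<^sup>+S'. F S' \<partial>measure_pmf (explore_step r N x (?J - ?U l))) =
          (\<Sum>i\<in>?U l. F (explore_point r N x (?J - ?U l) i)) / ennreal (ucount ?J (geom_graph x) l)"
        using False fin by (simp add: nn_integral_pmf_of_set ennreal_of_nat_eq_real_of_nat)
      also have "(\<Sum>i\<in>?U l. F (explore_point r N x (?J - ?U l) i)) = (\<Sum>i\<in>?U l. F (?J - ?U (i # l)))"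
        by (rule sum.cong) (simp_all add: explore_point_unexplored)
      finally have "ennreal (?p l) * (\<integral>\<^sup>+S'. F S' \<partial>measure_pmf (explore_step r N x (?J - ?U l))) =
          (ennreal (?p l) / ennreal (ucount ?J (geom_graph x) l)) * (\<Sum>i\<in>?U l. F (?J - ?U (i # l)))"
        by (simp add: divide_ennreal_def mult_ac)
      also have "ennreal (?p l) / ennreal (ucount ?J (geom_graph x) l) = ennreal (?p l / ucount ?J (geom_graph x) l)"
        using False fin by (intro divide_ennreal path_prob_nonneg) (simp add: card_gt_0_iff)
      finally show ?thesis unfolding rhs by (simp add: sum_distrib_left)
    qed
  qed
  also have "\<dots> = (\<Sum>l\<in>paths ?J (Suc n). ennreal (?p l) * F (?J - ?U l))"
    by (simp only: sum_paths_Suc)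
  finally show ?case .
qed

lemma exploration_cong:
  assumes "geom_graph x = geom_graph y"
  shows "exploration r N x n = exploration r N y n"
proof (induction n)
  case (Suc n)
  have near: "dist (x i) (x j) \<le> r \<longleftrightarrow> dist (y i) (y j) \<le> r" if "i < N" "j < N" for i j
    using that arg_cong[OF assms, of "\<lambda>R. (i, j) \<in> R"] by (simp add: geom_graph_def)
  have "explore_step r N x S = explore_step r N y S" for S
  proof (cases "{..<N} \<subseteq> S")
    case False
    have "map_pmf (explore_point r N x S) (pmf_of_set ({..<N} - S)) =
        map_pmf (explore_point r N y S) (pmf_of_set ({..<N} - S))"
    proof (rule map_pmf_cong[OF refl])
      fix i assume "i \<in> set_pmf (pmf_of_set ({..<N} - S))"
      then have "i < N" using False by (subst (asm) set_pmf_of_set) auto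
      then show "explore_point r N x S i = explore_point r N y S i"
        using near by (auto simp: explore_point_def)
    qed
    then show ?thesis by (simp add: explore_step_def)
  qed (simp add: explore_step_def)
  then show ?case using Suc by (simp cong: bind_pmf_cong)
qed simp

text \<open>The law depends on the points only through their graph. Factoring it through the graph,
  with an arbitrary choice of points realizing each graph, leaves a map on a discrete space, where
  measurability is automatic.\<close>

lemma exploration_measurable:
  "(\<lambda>x :: nat \<Rightarrow> 'a. measure_pmf (map_pmf card (exploration r N x n))) \<in> measurable P (subprob_algebra (count_space UNIV))"
proof -
  let ?g = "\<lambda>R. measure_pmf (map_pmf card (exploration r N (SOME y. geom_graph y = R) n))"
  have "exploration r N x n = exploration r N (SOME y. geom_graph y = geom_graph x) n" for x :: "nat \<Rightarrow> 'a"
    by (rule exploration_cong, rule someI_ex[where P = "\<lambda>y. geom_graph y = geom_graph x", symmetric]) blast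
  then have "(\<lambda>x. measure_pmf (map_pmf card (exploration r N x n))) = (\<lambda>x. ?g (geom_graph x))"
    by simp
  moreover have "?g \<in> measurable (count_space UNIV) (subprob_algebra (count_space UNIV))"
    by (simp add: measure_pmf_in_subprob_algebra)
  ultimately show ?thesis
    using measurable_compose[OF geom_graph_measurable] by simp
qed

text \<open>\<open>F 0 = 0\<close> hides the mass that the path weights lose once everything is
  explored.\<close>

lemma nn_integral_explored_count:
  assumes "F 0 = 0" "\<And>u. F u \<ge> 0"
  shows "(\<integral>\<^sup>+z. ennreal (F (N - z)) \<partial>(bind P (\<lambda>x. measure_pmf (map_pmf card (exploration r N x n))))) =
    ennreal (graph_exp (\<lambda>R. path_exp {..<N} R n (\<lambda>l. F (card (unexplored {..<N} R l)))))"
proof -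
  let ?J = "{..<N}"
  let ?F = "\<lambda>R. path_exp ?J R n (\<lambda>l. F (card (unexplored ?J R l)))"
  have F0: "?F R \<ge> 0" for R by (rule path_exp_nonneg) (rule assms)
  have "(\<integral>\<^sup>+z. ennreal (F (N - z)) \<partial>(bind P (\<lambda>x. measure_pmf (map_pmf card (exploration r N x n))))) =
      (\<integral>\<^sup>+x. (\<integral>\<^sup>+z. ennreal (F (N - z)) \<partial>measure_pmf (map_pmf card (exploration r N x n))) \<partial>P)"
    by (rule nn_integral_bind[OF _ exploration_measurable]) simp
  also have "\<dots> = (\<integral>\<^sup>+x. ennreal (?F (geom_graph x)) \<partial>P)"
  proof (rule nn_integral_cong)
    fix x :: "nat \<Rightarrow> 'a"
    have "(\<integral>\<^sup>+z. ennreal (F (N - z)) \<partial>measure_pmf (map_pmf card (exploration r N x n))) =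
        (\<integral>\<^sup>+S. ennreal (F (N - card S)) \<partial>measure_pmf (exploration r N x n))"
      by simp
    also have "\<dots> = (\<integral>\<^sup>+S. ennreal (F (card (?J - S))) \<partial>measure_pmf (exploration r N x n))"
    proof (rule nn_integral_cong_AE, rule AE_pmfI)
      fix S assume "S \<in> set_pmf (exploration r N x n)"
      moreover have "S \<subseteq> ?J" if "S \<in> set_pmf (exploration r N x n)" for S n
        using that
      proof (induction n arbitrary: S)
        case (Suc n)
        then obtain S' where S': "S' \<in> set_pmf (exploration r N x n)" "S \<in> set_pmf (explore_step r N x S')"
          by auto
        then show ?case
          using Suc.IH[OF S'(1)]
          by (auto simp: explore_step_def explore_point_def split: if_splits)
      qed simp
      ultimately have "S \<subseteq> ?J" by blast
      then have "card (?J - S) = N - card S" by (simp add: card_Diff_subset finite_subset)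
      then show "ennreal (F (N - card S)) = ennreal (F (card (?J - S)))" by simp
    qed
    also have "\<dots> = (\<Sum>l\<in>paths ?J n. ennreal (path_prob ?J (geom_graph x) l) *
       ennreal (F (card (?J - (?J - unexplored ?J (geom_graph x) l)))))"
    proof (rule nn_integral_exploration)
      fix S assume "?J \<subseteq> S"
      then have "?J - S = {}" by auto
      then show "ennreal (F (card (?J - S))) = 0" using assms(1) by (simp only: card.empty ennreal_0)
    qed
    also have "\<dots> = (\<Sum>l\<in>paths ?J n. ennreal (path_prob ?J (geom_graph x) l * F (card (unexplored ?J (geom_graph x) l))))"
      using unexplored_subset[of ?J "geom_graph x"]
      by (intro sum.cong refl) (simp add: double_diff ennreal_mult assms path_prob_nonneg)
    also have "\<dots> = ennreal (?F (geom_graph x))"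
      unfolding path_exp_def by (rule sum_ennreal) (simp add: assms path_prob_nonneg)
    finally show "(\<integral>\<^sup>+z. ennreal (F (N - z)) \<partial>measure_pmf (map_pmf card (exploration r N x n))) =
      ennreal (?F (geom_graph x))" .
  qed
  also have "\<dots> = ennreal (graph_exp ?F)"
    unfolding graph_exp_def by (rule nn_integral_eq_integral[OF graph_fun_integrable]) (simp add: F0)
  finally show ?thesis .
qed

end

section \<open>Concentration along paths\<close>

text \<open>Discrete analogue of the integral of 1 / y: the logarithm of \<open>damping d\<close> is
  close to - d times this sum.\<close>

primrec path_harmonic :: "nat set \<Rightarrow> (nat \<times> nat) set \<Rightarrow> nat list \<Rightarrow> real" where
  "path_harmonic J R [] = 0"
| "path_harmonic J R (i # l) = path_harmonic J R l + 1 / ucount J R l"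

text \<open>Only paths on which unexplored vertices remain are counted, so that the explored graph
  contributes nothing.\<close>

definition deviation :: "real \<Rightarrow> real \<Rightarrow> real" where
  "deviation u w = (if u = 0 then 0 else \<bar>u - w\<bar>)"

primrec path_deviation :: "(nat \<Rightarrow> real) \<Rightarrow> nat set \<Rightarrow> (nat \<times> nat) set \<Rightarrow> nat list \<Rightarrow> real" where
  "path_deviation v J R [] = 0"
| "path_deviation v J R (i # l) = path_deviation v J R l + deviation (ucount J R l) (v (length l))"

lemma deviation_nonneg: "deviation u w \<ge> 0"
  by (simp add: deviation_def)

lemma path_deviation_nonneg: "path_deviation v J R l \<ge> 0"
  by (induction l) (auto simp: deviation_nonneg)

text \<open>Term by term, \<open>\<bar>1 / u - 1 / v\<bar> = \<bar>u - v\<bar> / (u * v)\<close>.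
  Counts decrease along a path, so the lower bound \<open>a\<close> at its end holds
  throughout.\<close>

lemma path_harmonic_approx:
  assumes "finite J" "a > 0" "b > 0" "ucount J R l \<ge> a" "\<And>q. q < length l \<Longrightarrow> v q \<ge> b"
  shows "\<bar>path_harmonic J R l - (\<Sum>q<length l. 1 / v q)\<bar> \<le> path_deviation v J R l / (a * b)"
  using assms(4,5)
proof (induction l)
  case (Cons i l)
  let ?u = "ucount J R l" and ?v = "v (length l)"
  have u: "?u \<ge> a" using Cons.prems(1) ucount_mono[OF assms(1), of R i l] by simp
  have v: "?v \<ge> b" using Cons.prems(2) by simp
  have IH: "\<bar>path_harmonic J R l - (\<Sum>q<length l. 1 / v q)\<bar> \<le> path_deviation v J R l / (a * b)"
    by (rule Cons.IH[OF u]) (use Cons.prems(2) in auto)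
  have "\<bar>1 / ?u - 1 / ?v\<bar> = \<bar>?u - ?v\<bar> / (?u * ?v)"
  proof -
    have "1 / ?u - 1 / ?v = - ((?u - ?v) / (?u * ?v))" using u v assms(2,3) by (simp add: field_simps)
    then show ?thesis using u v assms(2,3) by (simp add: abs_mult)
  qed
  also have "\<dots> \<le> \<bar>?u - ?v\<bar> / (a * b)"
    using u v assms(2,3) by (intro divide_left_mono mult_mono mult_pos_pos) auto
  finally have "\<bar>1 / ?u - 1 / ?v\<bar> \<le> \<bar>?u - ?v\<bar> / (a * b)" .
  with IH u assms(2) show ?case by (auto simp: add_divide_distrib deviation_def)
qed simp

text \<open>From \<open>1 - x \<le> exp (- x)\<close> with x = d / (u + d); replacing d / (u + d) by
  d / u costs at most \<open>d\<^sup>2 / a\<^sup>2\<close> per step.\<close>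

lemma path_prod_exp_le:
  assumes "finite J" "a > 0" "ucount J R l \<ge> a" "d \<ge> 0"
  shows "damping d J R l \<le>
         exp (- d * path_harmonic J R l + d\<^sup>2 * real (length l) / a\<^sup>2)"
  using assms(3)
proof (induction l)
  case (Cons i l)
  let ?u = "ucount J R l"
  have u: "?u \<ge> a" using Cons.prems ucount_mono[OF assms(1), of R i l] by simp
  then have u0: "?u > 0" using assms(2) by simp
  have IH: "damping d J R l \<le> exp (- d * path_harmonic J R l + d\<^sup>2 * real (length l) / a\<^sup>2)"
    by (rule Cons.IH[OF u])
  have "?u / (?u + d) = 1 - d / (?u + d)" using u0 assms(4) by (simp add: field_simps)
  also have "\<dots> \<le> exp (- (d / (?u + d)))" using exp_ge_add_one_self[of "- (d / (?u + d))"] by simp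
  also have "\<dots> \<le> exp (- d * (1 / ?u) + d\<^sup>2 / a\<^sup>2)"
  proof -
    have "d / ?u - d / (?u + d) = d\<^sup>2 / (?u * (?u + d))"
      using u0 assms(4) by (simp add: field_simps power2_eq_square)
    also have "\<dots> \<le> d\<^sup>2 / (a * a)"
      using u u0 assms(2,4) by (intro divide_left_mono mult_mono mult_pos_pos) auto
    finally show ?thesis by (simp add: power2_eq_square)
  qed
  finally have "?u / (?u + d) \<le> exp (- d * (1 / ?u) + d\<^sup>2 / a\<^sup>2)" .
  with IH have "damping d J R l * (?u / (?u + d)) \<le>
      exp (- d * path_harmonic J R l + d\<^sup>2 * real (length l) / a\<^sup>2) * exp (- d * (1 / ?u) + d\<^sup>2 / a\<^sup>2)"
    using u0 assms(4) by (intro mult_mono) auto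
  also have "\<dots> = exp (- d * path_harmonic J R (i # l) + d\<^sup>2 * real (length (i # l)) / a\<^sup>2)"
    by (simp add: exp_add[symmetric] algebra_simps add_divide_distrib)
  finally show ?case by simp
qed simp

text \<open>The reciprocal u / (u - 1) is at most exp (1 / (u - 1)), and 1 / (u - 1) exceeds 1 / u
  by at most \<open>2 / a\<^sup>2\<close>, because u - 1 is at least a / 2 once
  \<open>a \<ge> 2\<close>.\<close>

lemma path_prod_exp_ge:
  assumes "finite J" "a \<ge> 2" "ucount J R l \<ge> a"
  shows "path_prod (\<lambda>u. (u - 1) / u) J R l \<ge> exp (- path_harmonic J R l - 2 * real (length l) / a\<^sup>2)"
  using assms(3)
proof (induction l)
  case (Cons i l)
  let ?u = "ucount J R l"
  have u: "?u \<ge> a" using Cons.prems ucount_mono[OF assms(1), of R i l] by simp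
  then have u2: "?u \<ge> 2" using assms(2) by simp
  have IH: "exp (- path_harmonic J R l - 2 * real (length l) / a\<^sup>2) \<le> path_prod (\<lambda>u. (u - 1) / u) J R l"
    by (rule Cons.IH[OF u])
  have "exp (1 / ?u + 2 / a\<^sup>2) \<ge> exp (1 / (?u - 1))"
  proof -
    have "1 / (?u - 1) - 1 / ?u = 1 / (?u * (?u - 1))"
      using u2 by (simp add: field_simps)
    also have "\<dots> \<le> 1 / (a * (a / 2))"
      using u u2 assms(2) by (intro divide_left_mono mult_mono mult_pos_pos) auto
    finally show ?thesis by (simp add: power2_eq_square)
  qed
  moreover have "exp (1 / (?u - 1)) \<ge> ?u / (?u - 1)"
  proof -
    have "?u / (?u - 1) = 1 + 1 / (?u - 1)" using u2 by (simp add: field_simps)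
    then show ?thesis using exp_ge_add_one_self[of "1 / (?u - 1)"] by simp
  qed
  ultimately have "?u / (?u - 1) \<le> exp (1 / ?u + 2 / a\<^sup>2)" by linarith
  then have "inverse (exp (1 / ?u + 2 / a\<^sup>2)) \<le> inverse (?u / (?u - 1))"
    using u2 by (intro le_imp_inverse_le) auto
  then have *: "exp (- (1 / ?u) - 2 / a\<^sup>2) \<le> (?u - 1) / ?u"
    by (simp add: exp_minus[symmetric])
  have "exp (- path_harmonic J R (i # l) - 2 * real (length (i # l)) / a\<^sup>2) =
      exp (- path_harmonic J R l - 2 * real (length l) / a\<^sup>2) * exp (- (1 / ?u) - 2 / a\<^sup>2)"
    by (simp add: exp_add[symmetric] algebra_simps add_divide_distrib)
  also have "\<dots> \<le> path_prod (\<lambda>u. (u - 1) / u) J R l * ((?u - 1) / ?u)"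
    using u2 order.trans[OF exp_ge_zero IH] by (intro mult_mono IH *) auto
  finally show ?case by simp
qed simp

text \<open>Each deviation is charged at the time it occurs; mass lost later only decreases the
  left-hand side.\<close>

lemma path_exp_deviation_le:
  assumes "finite J"
  shows "path_exp J R n (path_deviation v J R) \<le> (\<Sum>q<n. path_exp J R q (\<lambda>l. deviation (ucount J R l) (v q)))"
proof (induction n)
  case (Suc n)
  have "path_exp J R (Suc n) (path_deviation v J R) \<le>
      path_exp J R n (\<lambda>l. path_deviation v J R l + deviation (ucount J R l) (v (length l)))"
    by (rule path_exp_Suc_le[OF assms]) (simp_all add: path_deviation_nonneg deviation_nonneg)
  also have "\<dots> = path_exp J R n (path_deviation v J R) + path_exp J R n (\<lambda>l. deviation (ucount J R l) (v (length l)))"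
    by (rule path_exp_add)
  also have "path_exp J R n (\<lambda>l. deviation (ucount J R l) (v (length l))) = path_exp J R n (\<lambda>l. deviation (ucount J R l) (v n))"
    unfolding path_exp_def by (rule sum.cong) (auto simp: paths_def)
  finally show ?case using Suc by simp
qed simp

section \<open>Replacing path products by deterministic exponentials\<close>

context random_points
begin

definition alive :: "real \<Rightarrow> nat \<Rightarrow> real" where
  "alive a n = graph_exp (\<lambda>R. path_exp {..<N} R n (\<lambda>l. of_bool (a \<le> ucount {..<N} R l)))"

definition mean_deviation :: "(nat \<Rightarrow> real) \<Rightarrow> nat \<Rightarrow> real" where
  "mean_deviation v q = graph_exp (\<lambda>R. path_exp {..<N} R q (\<lambda>l. deviation (ucount {..<N} R l) (v q)))"

lemma alive_antimono:
  assumes "m \<le> n"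
  shows "alive a n \<le> alive a m"
proof -
  have "alive a (Suc n) \<le> alive a n" for n
    unfolding alive_def
  proof (rule graph_exp_mono)
    fix R
    show "path_exp {..<N} R (Suc n) (\<lambda>l. of_bool (a \<le> ucount {..<N} R l)) \<le>
        path_exp {..<N} R n (\<lambda>l. of_bool (a \<le> ucount {..<N} R l))"
    proof (rule path_exp_Suc_le)
      show "of_bool (a \<le> ucount {..<N} R (i # l)) \<le> (of_bool (a \<le> ucount {..<N} R l) :: real)" for i l
        using ucount_mono[of "{..<N}" R i l] by auto
    qed simp_all
  qed
  then show ?thesis using assms by (rule lift_Suc_antimono_le)
qed

lemma mean_unexplored_antimono:
  assumes "m \<le> n"
  shows "mean_unexplored n \<le> mean_unexplored m"
proof -
  have "mean_unexplored (Suc n) \<le> mean_unexplored n" for n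
    unfolding mean_unexplored_def
  proof (rule graph_exp_mono)
    show "path_exp {..<N} R (Suc n) (ucount {..<N} R) \<le> path_exp {..<N} R n (ucount {..<N} R)" for R
    proof (rule path_exp_Suc_le)
      show "ucount {..<N} R (i # l) \<le> ucount {..<N} R l" for i l
        by (rule ucount_mono) simp
    qed simp_all
  qed
  then show ?thesis using assms by (rule lift_Suc_antimono_le)
qed

lemma mean_unexplored_card: "mean_unexplored N = 0"
proof -
  have "mean_unexplored N \<le> graph_exp (\<lambda>R. 0)"
    unfolding mean_unexplored_def
  proof (rule graph_exp_mono)
    fix R :: "(nat \<times> nat) set" assume R: "\<And>i. i < N \<Longrightarrow> (i, i) \<in> R"
    have "path_exp {..<N} R N (ucount {..<N} R) \<le> path_exp {..<N} R N (\<lambda>l. 0)"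
    proof (rule path_exp_mono)
      fix l assume "l \<in> paths {..<N} N" "path_prob {..<N} R l > 0"
      then show "ucount {..<N} R l \<le> 0"
        using path_prob_pos_ucount[of "{..<N}" R l] R by (simp add: paths_def)
    qed
    then show "path_exp {..<N} R N (ucount {..<N} R) \<le> 0" by (simp add: path_exp_def)
  qed
  moreover have "mean_unexplored N \<ge> 0"
    unfolding mean_unexplored_def by (rule graph_exp_nonneg, rule path_exp_nonneg) simp
  ultimately show ?thesis by (simp add: graph_exp_const)
qed

lemma graph_exp_path_exp_mono:
  assumes "\<And>R l. length l = n \<Longrightarrow> f R l \<le> g R l"
  shows "graph_exp (\<lambda>R. path_exp {..<N} R n (f R)) \<le> graph_exp (\<lambda>R. path_exp {..<N} R n (g R))"
  by (rule graph_exp_mono, rule path_exp_mono, rule assms) (simp add: paths_def)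

lemma graph_exp_path_exp_one_le: "graph_exp (\<lambda>R. path_exp {..<N} R n (\<lambda>l. 1)) \<le> 1"
  using graph_exp_mono[of "\<lambda>R. path_exp {..<N} R n (\<lambda>l. 1)" "\<lambda>R. 1"]
  by (simp add: path_exp_one_le graph_exp_const)

lemma deviation_prob_le:
  assumes "\<delta> > 0"
  shows "graph_exp (\<lambda>R. path_exp {..<N} R n (\<lambda>l. of_bool (path_deviation v {..<N} R l > \<delta>))) \<le>
         (\<Sum>q<n. mean_deviation v q) / \<delta>"
proof -
  have "graph_exp (\<lambda>R. path_exp {..<N} R n (\<lambda>l. of_bool (path_deviation v {..<N} R l > \<delta>))) \<le>
        graph_exp (\<lambda>R. path_exp {..<N} R n (\<lambda>l. 1 / \<delta> * path_deviation v {..<N} R l))"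
  proof (rule graph_exp_path_exp_mono)
    fix R l
    show "of_bool (path_deviation v {..<N} R l > \<delta>) \<le> 1 / \<delta> * path_deviation v {..<N} R l"
      using assms path_deviation_nonneg[of v "{..<N}" R l]
      by (cases "path_deviation v {..<N} R l > \<delta>") simp_all
  qed
  also have "\<dots> = 1 / \<delta> * graph_exp (\<lambda>R. path_exp {..<N} R n (path_deviation v {..<N} R))"
    by (simp only: path_exp_cmult graph_exp_cmult)
  also have "\<dots> \<le> 1 / \<delta> * graph_exp (\<lambda>R. \<Sum>q<n. path_exp {..<N} R q (\<lambda>l. deviation (ucount {..<N} R l) (v q)))"
    using assms by (intro mult_left_mono[OF graph_exp_mono[OF path_exp_deviation_le]]) simp_all
  also have "\<dots> = (\<Sum>q<n. mean_deviation v q) / \<delta>"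
    by (simp add: graph_exp_sum mean_deviation_def)
  finally show ?thesis .
qed

text \<open>On the event that at least \<open>a\<close> vertices are unexplored and the total
  deviation is at most \<open>\<delta>\<close>, the exponential bounds the product. Off this event
  the product is at most 1, and the probability is controlled by \<open>1 - alive a n\<close> plus a
  Markov estimate.\<close>

lemma exp_path_prod_le:
  assumes "a > 0" "b > 0" "\<delta> > 0" "d \<ge> 0" "\<And>q. q < n \<Longrightarrow> v q \<ge> b"
  shows "graph_exp (\<lambda>R. path_exp {..<N} R n (damping d {..<N} R)) \<le>
     exp (- d * (\<Sum>q<n. 1 / v q) + d * \<delta> / (a * b) + d\<^sup>2 * real n / a\<^sup>2) +
     (1 - alive a n) + (\<Sum>q<n. mean_deviation v q) / \<delta>"
proof -
  let ?J = "{..<N}"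
  let ?e = "exp (- d * (\<Sum>q<n. 1 / v q) + d * \<delta> / (a * b) + d\<^sup>2 * real n / a\<^sup>2)"
  let ?dev = "\<lambda>R l. of_bool (path_deviation v ?J R l > \<delta>) :: real"
  let ?al = "\<lambda>R l. of_bool (a \<le> ucount ?J R l) :: real"
  have "graph_exp (\<lambda>R. path_exp ?J R n (damping d ?J R)) \<le>
     graph_exp (\<lambda>R. path_exp ?J R n (\<lambda>l. (?e * 1 + (1 - ?al R l)) + ?dev R l))"
  proof (rule graph_exp_path_exp_mono)
    fix R and l :: "nat list" assume l: "length l = n"
    show "damping d ?J R l \<le> ?e * 1 + (1 - ?al R l) + ?dev R l"
    proof (cases "a \<le> ucount ?J R l \<and> path_deviation v ?J R l \<le> \<delta>")
      case True
      have "\<bar>path_harmonic ?J R l - (\<Sum>q<n. 1 / v q)\<bar> \<le> path_deviation v ?J R l / (a * b)"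
        using path_harmonic_approx[of ?J a b R l v] True assms l by simp
      also have "\<dots> \<le> \<delta> / (a * b)" using True assms by (intro divide_right_mono) auto
      finally have "d * path_harmonic ?J R l \<ge> d * ((\<Sum>q<n. 1 / v q) - \<delta> / (a * b))"
        using assms(4) by (intro mult_left_mono) auto
      then have "exp (- d * path_harmonic ?J R l + d\<^sup>2 * real (length l) / a\<^sup>2) \<le> ?e"
        using l by (simp add: right_diff_distrib)
      moreover have "damping d ?J R l \<le> exp (- d * path_harmonic ?J R l + d\<^sup>2 * real (length l) / a\<^sup>2)"
        using True assms by (intro path_prod_exp_le) auto
      ultimately have "damping d ?J R l \<le> ?e" by (rule order.trans[rotated])
      moreover have "?al R l = 1" "?dev R l = 0" using True by auto
      ultimately show ?thesis by linarith
    next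
      case False
      have "damping d ?J R l \<le> 1"
        using assms(4) by (intro path_prod_le_1) (auto simp: divide_le_eq_1)
      moreover have "?e \<ge> 0" by simp
      ultimately show ?thesis using False
        by (cases "a \<le> ucount ?J R l"; cases "path_deviation v ?J R l \<le> \<delta>") (simp_all del: exp_ge_zero)
    qed
  qed
  also have "\<dots> = ?e * graph_exp (\<lambda>R. path_exp ?J R n (\<lambda>l. 1)) +
      (graph_exp (\<lambda>R. path_exp ?J R n (\<lambda>l. 1)) - alive a n) + graph_exp (\<lambda>R. path_exp ?J R n (?dev R))"
    by (simp only: path_exp_add path_exp_diff path_exp_cmult graph_exp_add graph_exp_diff graph_exp_cmult alive_def)
  also have "\<dots> \<le> ?e * 1 + (1 - alive a n) + (\<Sum>q<n. mean_deviation v q) / \<delta>"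
    by (intro add_mono diff_mono mult_left_mono graph_exp_path_exp_one_le deviation_prob_le assms) simp_all
  finally show ?thesis by simp
qed

lemma exp_path_prod_ge:
  assumes "a \<ge> 2" "b > 0" "\<delta> > 0" "\<And>q. q < n \<Longrightarrow> v q \<ge> b"
  shows "graph_exp (\<lambda>R. path_exp {..<N} R n (\<lambda>l. path_prod (\<lambda>u. (u - 1) / u) {..<N} R l *
       (of_bool (a \<le> ucount {..<N} R l) * ((ucount {..<N} R l - 1) / ucount {..<N} R l)))) \<ge>
     exp (- (\<Sum>q<n. 1 / v q) - \<delta> / (a * b) - 2 * real n / a\<^sup>2) * (1 - 1 / a) *
     (alive a n - (\<Sum>q<n. mean_deviation v q) / \<delta>)"
proof -
  let ?J = "{..<N}"
  let ?e = "exp (- (\<Sum>q<n. 1 / v q) - \<delta> / (a * b) - 2 * real n / a\<^sup>2) * (1 - 1 / a)"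
  let ?dev = "\<lambda>R l. of_bool (path_deviation v ?J R l > \<delta>) :: real"
  let ?al = "\<lambda>R l. of_bool (a \<le> ucount ?J R l) :: real"
  have e0: "?e \<ge> 0" using assms by simp
  have nn: "0 \<le> (ucount ?J R l - 1) / ucount ?J R l" for R l
    by (cases "card (unexplored ?J R l) = 0") (simp_all add: Suc_leI)
  have "?e * (alive a n - (\<Sum>q<n. mean_deviation v q) / \<delta>) \<le>
      ?e * (alive a n - graph_exp (\<lambda>R. path_exp ?J R n (?dev R)))"
    by (intro mult_left_mono diff_mono deviation_prob_le assms e0 order.refl)
  also have "\<dots> = graph_exp (\<lambda>R. path_exp ?J R n (\<lambda>l. ?e * (?al R l - ?dev R l)))"
    by (simp only: path_exp_diff path_exp_cmult graph_exp_diff graph_exp_cmult alive_def)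
  also have "\<dots> \<le> graph_exp (\<lambda>R. path_exp ?J R n (\<lambda>l. path_prod (\<lambda>u. (u - 1) / u) ?J R l *
       (?al R l * ((ucount ?J R l - 1) / ucount ?J R l))))"
  proof (rule graph_exp_path_exp_mono)
    fix R and l :: "nat list" assume l: "length l = n"
    have p0: "path_prod (\<lambda>u. (u - 1) / u) ?J R l \<ge> 0" for l
      by (induction l) (simp_all only: path_prod.simps mult_nonneg_nonneg nn zero_le_one)
    show "?e * (?al R l - ?dev R l) \<le> path_prod (\<lambda>u. (u - 1) / u) ?J R l *
       (?al R l * ((ucount ?J R l - 1) / ucount ?J R l))"
    proof (cases "a \<le> ucount ?J R l \<and> path_deviation v ?J R l \<le> \<delta>")
      case True
      have "\<bar>path_harmonic ?J R l - (\<Sum>q<n. 1 / v q)\<bar> \<le> path_deviation v ?J R l / (a * b)"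
        using path_harmonic_approx[of ?J a b R l v] True assms l by simp
      also have "\<dots> \<le> \<delta> / (a * b)" using True assms by (intro divide_right_mono) auto
      finally have "exp (- (\<Sum>q<n. 1 / v q) - \<delta> / (a * b) - 2 * real n / a\<^sup>2) \<le> exp (- path_harmonic ?J R l - 2 * real (length l) / a\<^sup>2)"
        using l by simp
      also have "\<dots> \<le> path_prod (\<lambda>u. (u - 1) / u) ?J R l"
        using True assms by (intro path_prod_exp_ge) auto
      finally have 1: "exp (- (\<Sum>q<n. 1 / v q) - \<delta> / (a * b) - 2 * real n / a\<^sup>2) \<le> path_prod (\<lambda>u. (u - 1) / u) ?J R l" .
      have "1 / ucount ?J R l \<le> 1 / a" using True assms by (intro divide_left_mono) auto
      then have "1 - 1 / a \<le> (ucount ?J R l - 1) / ucount ?J R l"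
        using True assms by (simp add: diff_divide_distrib)
      with 1 have "?e \<le> path_prod (\<lambda>u. (u - 1) / u) ?J R l * ((ucount ?J R l - 1) / ucount ?J R l)"
        using assms p0 by (intro mult_mono) auto
      then show ?thesis using True by simp
    next
      case False
      \<comment> \<open>The difference of indicators is at most the indicator of the good event: off
        that event it is not positive, while the right-hand side of the claim is
        nonnegative.\<close>
      then have "?al R l - ?dev R l \<le> 0" by auto
      then have "?e * (?al R l - ?dev R l) \<le> 0" using e0 by (rule mult_nonneg_nonpos[rotated])
      also have "0 \<le> path_prod (\<lambda>u. (u - 1) / u) ?J R l * (?al R l * ((ucount ?J R l - 1) / ucount ?J R l))"
        by (intro mult_nonneg_nonneg p0 nn) simp
      finally show ?thesis .
    qed
  qed
  finally show ?thesis .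
qed

end

section \<open>Points in a cube\<close>

lemma cube_of_volume_emeasure:
  assumes "cube_of_volume v C" "v > 0"
  shows "C \<in> sets borel" "emeasure lborel C \<noteq> 0" "emeasure lborel C \<noteq> \<infinity>" "measure lborel C = v"
proof -
  from assms obtain a e where C: "C = cbox a (a + e *\<^sub>R One)" and m: "measure lborel C = v"
    by (auto simp: cube_of_volume_def)
  show "C \<in> sets borel" using C by simp
  show "emeasure lborel C \<noteq> \<infinity>"
    using emeasure_lborel_cbox_finite[of a "a + e *\<^sub>R One"] by (simp add: C less_top)
  show "measure lborel C = v" by (rule m)
  then show "emeasure lborel C \<noteq> 0" using assms(2) by (auto simp: measure_def)
qed

lemma measure_cball_eq_ball:
  fixes z :: "'a::euclidean_space"
  assumes "r \<ge> 0"
  shows "measure lborel (cball z r) = measure lborel (ball (0::'a) r)"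
  using assms by (simp add: content_cball content_ball)

lemma random_points_cube:
  fixes C :: "'a::euclidean_space set"
  assumes "cube_of_volume v C" "v > 0" "r \<ge> 0"
  shows "random_points (uniform_measure lborel C) r (measure lborel (ball (0::'a) r) / v)"
proof -
  note C = cube_of_volume_emeasure[OF assms(1,2)]
  interpret prob_space "uniform_measure lborel C"
    by (rule prob_space_uniform_measure[OF C(2,3)])
  have "measure (uniform_measure lborel C) (cball z r) \<le> measure lborel (ball (0::'a) r) / v" for z
  proof -
    have "measure lborel (C \<inter> cball z r) \<le> measure lborel (cball z r)"
    proof (rule measure_mono_fmeasurable)
      show "cball z r \<in> fmeasurable lborel"
        using emeasure_bounded_finite[OF bounded_cball, of z r] by (intro fmeasurableI) simp_all
    qed (use C(1) in auto)
    then show ?thesis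
      using C assms(2) measure_cball_eq_ball[OF assms(3), of z]
      by (simp add: measure_uniform_measure divide_right_mono)
  qed
  then show ?thesis
    using assms(3) by unfold_locales simp_all
qed

text \<open>\<open>D\<close> is the cube shrunk by \<open>r\<close> on every side: balls centred
  there stay inside the cube, and its share of the volume is a power of its share of the side
  length.\<close>

lemma cube_interior:
  fixes C :: "'a::euclidean_space set"
  assumes "cube_of_volume v C" "v > 0" "r \<ge> 0" "2 * r < v powr (1 / DIM('a))"
  shows "\<exists>D\<in>sets borel. (\<forall>z\<in>D. measure (uniform_measure lborel C) (cball z r) \<ge> measure lborel (ball (0::'a) r) / v) \<and>
    measure (uniform_measure lborel C) (- D) \<le> 1 - (1 - 2 * r / v powr (1 / DIM('a))) ^ DIM('a)"
proof -
  note C = cube_of_volume_emeasure[OF assms(1,2)]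
  interpret prob_space "uniform_measure lborel C"
    by (rule prob_space_uniform_measure[OF C(2,3)])
  from assms obtain a e where Ceq: "C = cbox a (a + e *\<^sub>R One)" and e: "e \<ge> 0"
    by (auto simp: cube_of_volume_def)
  have "v = e ^ DIM('a)"
    using C(4) e by (simp add: Ceq content_cbox_if box_eq_empty inner_add_left inner_sum_left inner_Basis if_distrib sum.If_cases cong: if_cong)
  then have ve: "v powr (1 / DIM('a)) = e"
    using e assms(2) by (cases "e = 0") (simp_all add: powr_powr flip: powr_realpow)
  let ?D = "cbox (a + r *\<^sub>R One) (a + (e - r) *\<^sub>R One)"
  have One: "One \<bullet> b = 1" if "b \<in> Basis" for b :: 'a
    using that by (simp add: inner_sum_left inner_Basis if_distrib sum.If_cases cong: if_cong)
  have e2: "2 * r < e" using assms(4) ve by simp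
  have sub: "cball z r \<subseteq> C" if "z \<in> ?D" for z
  proof
    fix y assume y: "y \<in> cball z r"
    have "\<bar>(y - z) \<bullet> b\<bar> \<le> r" if "b \<in> Basis" for b
      using Basis_le_norm[OF that, of "y - z"] y by (simp add: dist_norm norm_minus_commute)
    then show "y \<in> C"
      using \<open>z \<in> ?D\<close> by (fastforce simp: Ceq mem_box inner_add_left inner_diff_left One)
  qed
  have D_C: "?D \<subseteq> C"
    using sub assms(3) by (meson centre_in_cball subset_eq)
  have mD: "measure lborel ?D = (e - 2 * r) ^ DIM('a)"
    using e2 assms(3) by (subst content_cbox) (auto simp: inner_add_left One)
  have "measure (uniform_measure lborel C) ?D = (1 - 2 * r / e) ^ DIM('a)"
  proof -
    have "measure (uniform_measure lborel C) ?D = (e - 2 * r) ^ DIM('a) / e ^ DIM('a)"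
      using C D_C mD \<open>v = e ^ DIM('a)\<close> by (simp add: measure_uniform_measure Int_absorb1)
    also have "\<dots> = ((e - 2 * r) / e) ^ DIM('a)" by (simp add: power_divide)
    also have "(e - 2 * r) / e = 1 - 2 * r / e" using e2 assms(3) by (simp add: diff_divide_distrib)
    finally show ?thesis .
  qed
  then have "measure (uniform_measure lborel C) (- ?D) = 1 - (1 - 2 * r / e) ^ DIM('a)"
    using prob_compl[of ?D] by (simp add: Compl_eq_Diff_UNIV)
  moreover have "measure (uniform_measure lborel C) (cball z r) = measure lborel (ball (0::'a) r) / v"
    if "z \<in> ?D" for z
    using C sub[OF that] measure_cball_eq_ball[OF assms(3), of z]
    by (simp add: measure_uniform_measure Int_absorb1)
  ultimately show ?thesis
    unfolding ve by (intro bexI[of _ ?D]) auto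
qed

section \<open>The limit of the unexplored fraction\<close>

locale sequential_adsorption = M: prob_space M for M :: "'w measure" +
  fixes lam r c :: real and C :: "nat \<Rightarrow> 'a::euclidean_space set"
    and Z :: "nat \<Rightarrow> nat \<Rightarrow> 'w \<Rightarrow> nat" and z :: "real \<Rightarrow> real"
  assumes lam: "lam > 0" and r: "r > 0"
    and cube: "\<And>N. N \<ge> 1 \<Longrightarrow> cube_of_volume (real N / lam) (C N)"
    and Z_measurable: "\<And>N n. N \<ge> 1 \<Longrightarrow> Z N n \<in> measurable M (count_space UNIV)"
    and Z_law: "\<And>N n. N \<ge> 1 \<Longrightarrow> distr M (count_space UNIV) (Z N n) = explored_count_law r N (C N) n"
    and z_bounds: "\<And>t. t \<ge> 0 \<Longrightarrow> z t \<in> {0..1}"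
    and Z_limit: "\<And>t. t \<ge> 0 \<Longrightarrow>
           AE \<omega> in M. (\<lambda>N. real (Z N (nat \<lfloor>t * real N\<rfloor>) \<omega>) / real N) \<longlonglongrightarrow> z t"
    and c_def: "c = lam * measure lborel (ball (0::'a) r)"
begin

abbreviation "unif N \<equiv> uniform_measure lborel (C N)"

lemma c_pos: "c > 0"
  unfolding c_def using lam r content_ball_pos[of r 0] by simp

lemma points: "N \<ge> 1 \<Longrightarrow> random_points (unif N) r (c / real N)"
  using random_points_cube[OF cube, of N r] lam r by (simp add: c_def mult_ac)

text \<open>Moves expectations of the unexplored count from \<open>M\<close> to the random graph,
  where vertices can be deleted and resampled.\<close>

lemma integral_count:
  fixes F :: "nat \<Rightarrow> real"
  assumes N: "N \<ge> 1" and F: "F 0 = 0" "\<And>u. F u \<ge> 0"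
  shows "(\<integral>\<omega>. F (N - Z N n \<omega>) \<partial>M) =
    random_points.graph_exp (unif N) r N (\<lambda>R. path_exp {..<N} R n (\<lambda>l. F (card (unexplored {..<N} R l))))"
    (is "_ = ?G")
proof -
  interpret random_points "unif N" r "c / real N" N by (rule points[OF N])
  note [measurable] = Z_measurable[OF N, of n]
  have "(\<integral>\<omega>. F (N - Z N n \<omega>) \<partial>M) = enn2real (\<integral>\<^sup>+\<omega>. ennreal (F (N - Z N n \<omega>)) \<partial>M)"
    by (rule integral_eq_nn_integral) (simp_all add: F)
  also have "(\<integral>\<^sup>+\<omega>. ennreal (F (N - Z N n \<omega>)) \<partial>M) =
      (\<integral>\<^sup>+k. ennreal (F (N - k)) \<partial>distr M (count_space UNIV) (Z N n))"
    by (rule nn_integral_distr[symmetric]) simp_all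
  also have "\<dots> = ennreal ?G"
    unfolding Z_law[OF N] explored_count_law_def by (rule nn_integral_explored_count[where F = F, OF F])
  also have "enn2real (ennreal ?G) = ?G"
    by (intro enn2real_ennreal graph_exp_nonneg path_exp_nonneg F)
  finally show ?thesis .
qed

definition unexplored_mean :: "nat \<Rightarrow> nat \<Rightarrow> real" where
  "unexplored_mean N n = (\<integral>\<omega>. real (N - Z N n \<omega>) \<partial>M)"

definition dev :: "nat \<Rightarrow> nat \<Rightarrow> real \<Rightarrow> real" where
  "dev N n w = (\<integral>\<omega>. \<bar>real (N - Z N n \<omega>) / real N - w\<bar> \<partial>M)"

text \<open>Natural subtraction confines the count to \<open>{..N}\<close> at every point of
  \<open>M\<close>, so any function of it is bounded.\<close>

lemma count_integrable:
  assumes "N \<ge> 1"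
  shows "integrable M (\<lambda>\<omega>. F (N - Z N n \<omega>) :: real)"
proof (rule M.integrable_const_bound)
  note [measurable] = Z_measurable[OF assms, of n]
  show "(\<lambda>\<omega>. F (N - Z N n \<omega>)) \<in> borel_measurable M" by simp
  show "AE \<omega> in M. norm (F (N - Z N n \<omega>)) \<le> Max ((\<lambda>u. norm (F u)) ` {..N})"
    by (intro AE_I2 Max_ge) auto
qed

lemma dev_nonneg: "dev N n w \<ge> 0"
  unfolding dev_def by simp

lemma dev_diff_le:
  assumes "N \<ge> 1"
  shows "dev N n w \<le> dev N n w' + \<bar>w - w'\<bar>"
proof -
  have "dev N n w \<le> (\<integral>\<omega>. \<bar>real (N - Z N n \<omega>) / real N - w'\<bar> + \<bar>w - w'\<bar> \<partial>M)"
    unfolding dev_def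
    using count_integrable[OF assms, of "\<lambda>u. \<bar>real u / real N - w\<bar>" n]
      count_integrable[OF assms, of "\<lambda>u. \<bar>real u / real N - w'\<bar> + \<bar>w - w'\<bar>" n]
    by (intro integral_mono) simp_all
  also have "\<dots> = dev N n w' + \<bar>w - w'\<bar>"
    unfolding dev_def using count_integrable[OF assms, of "\<lambda>u. \<bar>real u / real N - w'\<bar>" n]
    by (subst Bochner_Integration.integral_add) (simp_all add: M.prob_space)
  finally show ?thesis .
qed

lemma dev_le_1:
  assumes "N \<ge> 1" "0 \<le> w" "w \<le> 1"
  shows "dev N n w \<le> 1"
proof -
  have "dev N n w \<le> (\<integral>\<omega>. 1 \<partial>M)"
    unfolding dev_def
  proof (rule integral_mono)
    show "integrable M (\<lambda>\<omega>. \<bar>real (N - Z N n \<omega>) / real N - w\<bar>)"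
      by (rule count_integrable[OF assms(1), of "\<lambda>u. \<bar>real u / real N - w\<bar>"])
    fix \<omega>
    have "0 \<le> real (N - Z N n \<omega>) / real N" "real (N - Z N n \<omega>) / real N \<le> 1" using assms(1) by simp_all
    then show "\<bar>real (N - Z N n \<omega>) / real N - w\<bar> \<le> 1" using assms(2,3) by linarith
  qed simp
  then show ?thesis by (simp add: M.prob_space)
qed

lemma unexplored_mean_dev:
  assumes "N \<ge> 1"
  shows "\<bar>unexplored_mean N n / real N - w\<bar> \<le> dev N n w"
proof -
  have "unexplored_mean N n / real N - w = (\<integral>\<omega>. real (N - Z N n \<omega>) / real N - w \<partial>M)"
    unfolding unexplored_mean_def using count_integrable[OF assms, of "\<lambda>u. real u / real N" n]
    by (subst Bochner_Integration.integral_diff) (simp_all add: M.prob_space)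
  also have "\<bar>\<dots>\<bar> \<le> dev N n w" unfolding dev_def by (rule integral_abs_bound)
  finally show ?thesis .
qed

text \<open>Almost sure convergence to a constant becomes convergence in mean, the integrands being
  bounded by 1.\<close>

lemma dev_limit:
  assumes "t \<ge> 0"
  shows "(\<lambda>N. dev N (nat \<lfloor>t * real N\<rfloor>) (1 - z t)) \<longlonglongrightarrow> 0"
proof -
  let ?f = "\<lambda>N \<omega>. \<bar>real (N - Z N (nat \<lfloor>t * real N\<rfloor>) \<omega>) / real N - (1 - z t)\<bar>"
  \<comment> \<open>The index is shifted because measurability of \<open>Z N n\<close> is available
    for \<open>N \<ge> 1\<close>.\<close>
  have "(\<lambda>N. \<integral>\<omega>. ?f (Suc N) \<omega> \<partial>M) \<longlonglongrightarrow> (\<integral>\<omega>. 0 \<partial>M)"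
  proof (rule integral_dominated_convergence[where w = "\<lambda>_. 1"])
    have meas: "?f N \<in> borel_measurable M" if "N \<ge> 1" for N
      using borel_measurable_integrable[OF count_integrable[OF that, of "\<lambda>u. \<bar>real u / real N - (1 - z t)\<bar>"]] .
    show "?f (Suc N) \<in> borel_measurable M" for N by (rule meas) simp
    have "?f N \<omega> \<le> 1" if "N \<ge> 1" for N \<omega>
    proof -
      have "0 \<le> real (N - Z N (nat \<lfloor>t * real N\<rfloor>) \<omega>) / real N"
        "real (N - Z N (nat \<lfloor>t * real N\<rfloor>) \<omega>) / real N \<le> 1" using that by simp_all
      then show ?thesis using z_bounds[OF assms] unfolding atLeastAtMost_iff by linarith
    qed
    from this[of "Suc N" for N] show "AE \<omega> in M. norm (?f (Suc N) \<omega>) \<le> 1" for N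
      by (intro AE_I2) (simp del: of_nat_Suc)
    show "AE \<omega> in M. (\<lambda>N. ?f (Suc N) \<omega>) \<longlonglongrightarrow> 0"
      using Z_limit[OF assms]
    proof eventually_elim
      case (elim \<omega>)
      have lim: "(\<lambda>N. \<bar>real (Z N (nat \<lfloor>t * real N\<rfloor>) \<omega>) / real N - z t\<bar>) \<longlonglongrightarrow> 0"
        using tendsto_rabs[OF tendsto_diff[OF elim tendsto_const[of "z t"]]] by simp
      have "?f N \<omega> \<le> \<bar>real (Z N (nat \<lfloor>t * real N\<rfloor>) \<omega>) / real N - z t\<bar>" if "N \<ge> 1" for N
      proof (cases "Z N (nat \<lfloor>t * real N\<rfloor>) \<omega> \<le> N")
        case True
        then have "real (N - Z N (nat \<lfloor>t * real N\<rfloor>) \<omega>) / real N = 1 - real (Z N (nat \<lfloor>t * real N\<rfloor>) \<omega>) / real N"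
          using that by (simp add: of_nat_diff diff_divide_distrib)
        then show ?thesis by simp
      next
        \<comment> \<open>If the count exceeds \<open>N\<close>, the truncated difference is 0 and
          the left-hand side is \<open>1 - z t\<close>, while the ratio on the right is at least
          1.\<close>
        case False
        then have "real (Z N (nat \<lfloor>t * real N\<rfloor>) \<omega>) / real N \<ge> 1" using that by simp
        then show ?thesis using False z_bounds[OF assms] by simp
      qed
      then have "(\<lambda>N. ?f N \<omega>) \<longlonglongrightarrow> 0"
        by (intro tendsto_sandwich[OF _ _ tendsto_const lim]) (auto intro: eventually_sequentiallyI[of 1])
      then show ?case by (rule LIMSEQ_Suc)
    qed
  qed simp_all
  then have "(\<lambda>N. dev (Suc N) (nat \<lfloor>t * real (Suc N)\<rfloor>) (1 - z t)) \<longlonglongrightarrow> 0"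
    by (simp add: dev_def)
  then show ?thesis by (rule LIMSEQ_imp_Suc)
qed

lemma unexplored_mean_limit:
  assumes "t \<ge> 0"
  shows "(\<lambda>N. unexplored_mean N (nat \<lfloor>t * real N\<rfloor>) / real N) \<longlonglongrightarrow> 1 - z t"
proof -
  have "(\<lambda>N. unexplored_mean N (nat \<lfloor>t * real N\<rfloor>) / real N - (1 - z t)) \<longlonglongrightarrow> 0"
    by (rule Lim_null_comparison[OF _ dev_limit[OF assms]])
      (auto intro!: eventually_sequentiallyI[of 1] unexplored_mean_dev)
  then show ?thesis by (simp add: LIM_zero_iff)
qed

lemma unexplored_mean_eq:
  "N \<ge> 1 \<Longrightarrow> unexplored_mean N n = random_points.mean_unexplored (unif N) r N n"
  unfolding unexplored_mean_def random_points.mean_unexplored_def[OF points]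
  by (rule integral_count) simp_all

text \<open>\<open>deviation\<close> vanishes at count 0, as \<open>integral_count\<close> requires,
  and is at most the absolute difference.\<close>

lemma mean_deviation_le:
  assumes "N \<ge> 1" "w q \<ge> 0"
  shows "random_points.mean_deviation (unif N) r N (\<lambda>q. real N * w q) q \<le> real N * dev N q (w q)"
proof -
  have "random_points.mean_deviation (unif N) r N (\<lambda>q. real N * w q) q =
      (\<integral>\<omega>. deviation (real (N - Z N q \<omega>)) (real N * w q) \<partial>M)"
    unfolding random_points.mean_deviation_def[OF points[OF assms(1)]]
    by (rule integral_count[OF assms(1), symmetric]) (simp_all add: deviation_def)
  also have "\<dots> \<le> (\<integral>\<omega>. real N * \<bar>real (N - Z N q \<omega>) / real N - w q\<bar> \<partial>M)"
  proof (rule integral_mono)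
    show "integrable M (\<lambda>\<omega>. deviation (real (N - Z N q \<omega>)) (real N * w q))"
      by (rule count_integrable[OF assms(1), of "\<lambda>u. deviation (real u) (real N * w q)"])
    show "integrable M (\<lambda>\<omega>. real N * \<bar>real (N - Z N q \<omega>) / real N - w q\<bar>)"
      by (rule count_integrable[OF assms(1), of "\<lambda>u. real N * \<bar>real u / real N - w q\<bar>"])
    fix \<omega>
    have "real N * \<bar>u / real N - w q\<bar> = \<bar>u - real N * w q\<bar>" for u
    proof -
      have "real N * \<bar>u / real N - w q\<bar> = \<bar>real N * (u / real N - w q)\<bar>" by (simp add: abs_mult)
      also have "real N * (u / real N - w q) = u - real N * w q" using assms(1) by (simp add: right_diff_distrib)
      finally show ?thesis .
    qed
    then show "deviation (real (N - Z N q \<omega>)) (real N * w q) \<le> real N * \<bar>real (N - Z N q \<omega>) / real N - w q\<bar>"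
      by (simp add: deviation_def)
  qed
  finally show ?thesis by (simp add: dev_def)
qed

text \<open>If fewer than \<open>\<kappa> * real N\<close> points are unexplored at time
  \<open>T\<close>, the fraction misses \<open>w\<close> by at least \<open>w - \<kappa>\<close>, so
  Markov's inequality applies; monotonicity carries the bound back to
  \<open>n \<le> T\<close>.\<close>

lemma alive_ge:
  assumes N: "N \<ge> 1" and "n \<le> T" "0 < \<kappa>" "\<kappa> < w"
  shows "1 - random_points.alive (unif N) r N (\<kappa> * real N) n \<le> dev N T w / (w - \<kappa>)"
proof -
  interpret random_points "unif N" r "c / real N" N by (rule points[OF N])
  have "alive (\<kappa> * real N) T = (\<integral>\<omega>. of_bool (\<kappa> * real N \<le> real (N - Z N T \<omega>)) \<partial>M)"
  proof -
    have "\<kappa> * real N > 0" using N assms(3) by simp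
    then show ?thesis
      unfolding alive_def by (intro integral_count[OF N, symmetric]) simp_all
  qed
  also have "\<dots> \<ge> (\<integral>\<omega>. 1 - \<bar>real (N - Z N T \<omega>) / real N - w\<bar> / (w - \<kappa>) \<partial>M)"
  proof (rule integral_mono)
    show "integrable M (\<lambda>\<omega>. 1 - \<bar>real (N - Z N T \<omega>) / real N - w\<bar> / (w - \<kappa>))"
      by (rule count_integrable[OF N, of "\<lambda>u. 1 - \<bar>real u / real N - w\<bar> / (w - \<kappa>)"])
    show "integrable M (\<lambda>\<omega>. of_bool (\<kappa> * real N \<le> real (N - Z N T \<omega>)) :: real)"
      by (rule count_integrable[OF N, of "\<lambda>u. of_bool (\<kappa> * real N \<le> real u)"])
    fix \<omega>
    show "1 - \<bar>real (N - Z N T \<omega>) / real N - w\<bar> / (w - \<kappa>) \<le> of_bool (\<kappa> * real N \<le> real (N - Z N T \<omega>))"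
    proof (cases "\<kappa> * real N \<le> real (N - Z N T \<omega>)")
      case False
      then have "real (N - Z N T \<omega>) / real N < \<kappa>" using N by (simp add: divide_less_eq)
      then have "w - \<kappa> \<le> \<bar>real (N - Z N T \<omega>) / real N - w\<bar>" by simp
      then show ?thesis using False assms by simp
    qed (use assms in simp)
  qed
  also have "(\<integral>\<omega>. 1 - \<bar>real (N - Z N T \<omega>) / real N - w\<bar> / (w - \<kappa>) \<partial>M) = 1 - dev N T w / (w - \<kappa>)"
    unfolding dev_def using count_integrable[OF N, of "\<lambda>u. \<bar>real u / real N - w\<bar> / (w - \<kappa>)" T]
    by (subst Bochner_Integration.integral_diff) (simp_all add: M.prob_space)
  finally show ?thesis using alive_antimono[OF assms(2), of "\<kappa> * real N"] by simp
qed


section \<open>Bounds for one step of the mean count\<close>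

lemma step_le_const:
  assumes N: "N \<ge> 1"
  shows "unexplored_mean N n - unexplored_mean N (Suc n) \<le> 1 + c"
proof -
  interpret random_points "unif N" r "c / real N" N by (rule points[OF N])
  have "graph_exp (\<lambda>R. path_exp {..<N} R n (damping 1 {..<N} R)) \<le>
      graph_exp (\<lambda>R. path_exp {..<N} R n (\<lambda>l. 1))"
    by (rule graph_exp_path_exp_mono, rule path_prod_le_1) auto
  also have "\<dots> \<le> 1" by (rule graph_exp_path_exp_one_le)
  finally have "c * graph_exp (\<lambda>R. path_exp {..<N} R n (damping 1 {..<N} R)) \<le> c * 1"
    using c_pos by (intro mult_left_mono) simp_all
  then show ?thesis
    using mean_unexplored_Suc_ge[of n] N by (simp add: unexplored_mean_eq)
qed

lemma sum_mean_deviation_le: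
  assumes N: "N \<ge> 1" and \<delta>: "\<delta> > 0" and Y: "\<And>q. q < n \<Longrightarrow> Y q \<ge> 0"
  shows "(\<Sum>q<n. random_points.mean_deviation (unif N) r N (\<lambda>q. real N * Y q) q) / (\<delta> * (real N)\<^sup>2) \<le>
     (\<Sum>q<n. dev N q (Y q)) / (real N * \<delta>)"
proof -
  have "(\<Sum>q<n. random_points.mean_deviation (unif N) r N (\<lambda>q. real N * Y q) q) \<le> (\<Sum>q<n. real N * dev N q (Y q))"
    by (rule sum_mono, rule mean_deviation_le[OF N]) (simp add: Y)
  then have "(\<Sum>q<n. random_points.mean_deviation (unif N) r N (\<lambda>q. real N * Y q) q) / (\<delta> * (real N)\<^sup>2) \<le>
      (\<Sum>q<n. real N * dev N q (Y q)) / (\<delta> * (real N)\<^sup>2)"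
    using \<delta> by (intro divide_right_mono) simp_all
  also have "\<dots> = (real N * (\<Sum>q<n. dev N q (Y q))) / (real N * (real N * \<delta>))"
    by (simp add: power2_eq_square sum_distrib_left mult_ac)
  also have "\<dots> = (\<Sum>q<n. dev N q (Y q)) / (real N * \<delta>)"
    using N by simp
  finally show ?thesis .
qed

text \<open>The scaling: counts are of order N, and the sum of deviations over the path is allowed
  to reach \<open>\<delta> * (real N)\<^sup>2\<close>. After division by
  \<open>(\<kappa> * real N) * (w * real N)\<close> its effect on the exponent no longer depends on
  \<open>N\<close>.\<close>

lemma path_prod_dev_le:
  assumes N: "N \<ge> 1" and n: "n \<le> T" and \<kappa>: "0 < \<kappa>" "\<kappa> < w" and \<delta>: "\<delta> > 0" and d: "d \<ge> 0"
    and Y: "\<And>q. q < n \<Longrightarrow> Y q \<ge> w"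
  shows "random_points.graph_exp (unif N) r N (\<lambda>R. path_exp {..<N} R n (damping d {..<N} R)) \<le>
     exp (- d * (\<Sum>q<n. 1 / (real N * Y q)) + d * \<delta> / (\<kappa> * w) + d\<^sup>2 * real n / (\<kappa> * real N)\<^sup>2) +
     dev N T w / (w - \<kappa>) + (\<Sum>q<n. dev N q (Y q)) / (real N * \<delta>)"
proof -
  interpret random_points "unif N" r "c / real N" N by (rule points[OF N])
  have "graph_exp (\<lambda>R. path_exp {..<N} R n (damping d {..<N} R)) \<le>
     exp (- d * (\<Sum>q<n. 1 / (real N * Y q)) + d * (\<delta> * (real N)\<^sup>2) / ((\<kappa> * real N) * (w * real N)) + d\<^sup>2 * real n / (\<kappa> * real N)\<^sup>2) +
     (1 - alive (\<kappa> * real N) n) + (\<Sum>q<n. mean_deviation (\<lambda>q. real N * Y q) q) / (\<delta> * (real N)\<^sup>2)"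
  proof (rule exp_path_prod_le)
    show "w * real N \<le> real N * Y q" if "q < n" for q
      using mult_left_mono[OF Y[OF that], of "real N"] by (simp add: mult.commute)
  qed (use N \<kappa> \<delta> d in simp_all)
  note main = this
  have eq: "d * (\<delta> * (real N)\<^sup>2) / ((\<kappa> * real N) * (w * real N)) = d * \<delta> / (\<kappa> * w)"
    using N by (simp add: power2_eq_square)
  have "(\<Sum>q<n. mean_deviation (\<lambda>q. real N * Y q) q) / (\<delta> * (real N)\<^sup>2) \<le> (\<Sum>q<n. dev N q (Y q)) / (real N * \<delta>)"
    using Y \<kappa> by (intro sum_mean_deviation_le[OF N \<delta>]) (meson less_imp_le order.trans)
  with main[unfolded eq] alive_ge[OF N n \<kappa>] show ?thesis by linarith
qed

lemma step_le:
  assumes N: "N \<ge> 1" and n: "n \<le> T" and \<kappa>: "0 < \<kappa>" "\<kappa> < w" and \<delta>: "\<delta> > 0"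
    and Y: "\<And>q. q < n \<Longrightarrow> Y q \<ge> w"
  shows "unexplored_mean N n - unexplored_mean N (Suc n) \<le>
    1 + c * (exp (- (\<Sum>q<n. 1 / (real N * Y q)) + \<delta> / (\<kappa> * w) + n / (\<kappa> * real N)\<^sup>2) +
      dev N T w / (w - \<kappa>) + (\<Sum>q<n. dev N q (Y q)) / (real N * \<delta>))"
proof -
  interpret random_points "unif N" r "c / real N" N by (rule points[OF N])
  have "c * graph_exp (\<lambda>R. path_exp {..<N} R n (damping 1 {..<N} R)) \<le>
     c * (exp (- (\<Sum>q<n. 1 / (real N * Y q)) + \<delta> / (\<kappa> * w) + n / (\<kappa> * real N)\<^sup>2) +
      dev N T w / (w - \<kappa>) + (\<Sum>q<n. dev N q (Y q)) / (real N * \<delta>))"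
    using path_prod_dev_le[OF N n \<kappa> \<delta> _ Y, of 1] c_pos by (intro mult_left_mono) simp_all
  then show ?thesis
    using mean_unexplored_Suc_ge[of n] N by (simp add: unexplored_mean_eq)
qed

definition boundary :: "nat \<Rightarrow> real" where
  "boundary N = 1 - (1 - 2 * r / (real N / lam) powr (1 / DIM('a))) ^ DIM('a)"

lemma margin_limit: "(\<lambda>N. 2 * r / (real N / lam) powr (1 / DIM('a))) \<longlonglongrightarrow> 0"
proof -
  have "filterlim (\<lambda>N. 1 / lam * real N) at_top sequentially"
    using lam by (intro filterlim_tendsto_pos_mult_at_top[OF tendsto_const] filterlim_real_sequentially) simp
  then have "(\<lambda>N. (1 / lam * real N) powr (- (1 / DIM('a)))) \<longlonglongrightarrow> 0"
    by (intro tendsto_neg_powr) simp_all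
  then have "(\<lambda>N. 2 * r * (1 / lam * real N) powr (- (1 / DIM('a)))) \<longlonglongrightarrow> 2 * r * 0"
    by (intro tendsto_mult tendsto_const)
  then show ?thesis by (simp add: powr_minus_divide)
qed

lemma boundary_limit: "boundary \<longlonglongrightarrow> 0"
proof -
  have "boundary \<longlonglongrightarrow> 1 - (1 - 0) ^ DIM('a)"
    unfolding boundary_def[abs_def] by (intro tendsto_intros margin_limit)
  then show ?thesis by simp
qed

lemma step_ge:
  assumes N: "N \<ge> 1" and n: "n \<le> T" and \<kappa>: "0 < \<kappa>" "\<kappa> < w" and \<delta>: "\<delta> > 0"
    and Y: "\<And>q. q < n \<Longrightarrow> Y q \<ge> w"
    and big: "2 * r < (real N / lam) powr (1 / DIM('a))" "\<kappa> * real N \<ge> 2"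
  shows "unexplored_mean N n - unexplored_mean N (Suc n) \<ge>
    (1 - dev N T w / (w - \<kappa>)) +
    c * (exp (- (\<Sum>q<n. 1 / (real N * Y q)) - \<delta> / (\<kappa> * w) - 2 * real n / (\<kappa> * real N)\<^sup>2) * (1 - 1 / (\<kappa> * real N)) *
      (1 - dev N T w / (w - \<kappa>) - (\<Sum>q<n. dev N q (Y q)) / (real N * \<delta>))) -
    c * boundary N / \<kappa> -
    c\<^sup>2 * (n / (\<kappa> * real N)) * (exp (- 2 * (\<Sum>q<n. 1 / (real N * Y q)) + 2 * \<delta> / (\<kappa> * w) + 4 * real n / (\<kappa> * real N)\<^sup>2) +
      dev N T w / (w - \<kappa>) + (\<Sum>q<n. dev N q (Y q)) / (real N * \<delta>))"
proof -
  interpret random_points "unif N" r "c / real N" N by (rule points[OF N])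
  let ?a = "\<kappa> * real N"
  let ?H = "\<Sum>q<n. 1 / (real N * Y q)"
  have a0: "?a > 0" using N \<kappa> by simp
  have cN: "measure lborel (ball (0::'a) r) / (real N / lam) = c / real N"
    by (simp add: c_def mult_ac)
  have "real N / lam > 0" using N lam by simp
  from cube_interior[OF cube[OF N] this _ big(1)] r obtain D where D: "D \<in> sets borel"
    "\<And>z. z \<in> D \<Longrightarrow> measure (unif N) (cball z r) \<ge> c / real N" "measure (unif N) (- D) \<le> boundary N"
    unfolding cN boundary_def by fastforce
  have E: "(\<Sum>q<n. mean_deviation (\<lambda>q. real N * Y q) q) / (\<delta> * (real N)\<^sup>2) \<le> (\<Sum>q<n. dev N q (Y q)) / (real N * \<delta>)"
    using Y \<kappa> by (intro sum_mean_deviation_le[OF N \<delta>]) (meson less_imp_le order.trans)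
  have al: "alive ?a n \<ge> 1 - dev N T w / (w - \<kappa>)" using alive_ge[OF N n \<kappa>] by simp
  let ?G = "graph_exp (\<lambda>R. path_exp {..<N} R n (\<lambda>l. path_prod (\<lambda>u. (u - 1) / u) {..<N} R l *
       (of_bool (?a \<le> ucount {..<N} R l) * ((ucount {..<N} R l - 1) / ucount {..<N} R l))))"
  have "exp (- ?H - (\<delta> * (real N)\<^sup>2) / (?a * (w * real N)) - 2 * real n / ?a\<^sup>2) * (1 - 1 / ?a) *
      (alive ?a n - (\<Sum>q<n. mean_deviation (\<lambda>q. real N * Y q) q) / (\<delta> * (real N)\<^sup>2)) \<le> ?G"
  proof (rule exp_path_prod_ge)
    show "w * real N \<le> real N * Y q" if "q < n" for q
      using mult_left_mono[OF Y[OF that], of "real N"] by (simp add: mult.commute)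
  qed (use N \<kappa> \<delta> big in simp_all)
  note main = this
  have eq: "(\<delta> * (real N)\<^sup>2) / (?a * (w * real N)) = \<delta> / (\<kappa> * w)"
    using N by (simp add: power2_eq_square)
  have "exp (- ?H - \<delta> / (\<kappa> * w) - 2 * real n / ?a\<^sup>2) * (1 - 1 / ?a) *
      (1 - dev N T w / (w - \<kappa>) - (\<Sum>q<n. dev N q (Y q)) / (real N * \<delta>)) \<le>
      exp (- ?H - \<delta> / (\<kappa> * w) - 2 * real n / ?a\<^sup>2) * (1 - 1 / ?a) *
      (alive ?a n - (\<Sum>q<n. mean_deviation (\<lambda>q. real N * Y q) q) / (\<delta> * (real N)\<^sup>2))"
    using E al big by (intro mult_left_mono diff_mono mult_nonneg_nonneg) simp_all
  from order.trans[OF this main[unfolded eq]] have G: "c * (exp (- ?H - \<delta> / (\<kappa> * w) - 2 * real n / ?a\<^sup>2) * (1 - 1 / ?a) *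
      (1 - dev N T w / (w - \<kappa>) - (\<Sum>q<n. dev N q (Y q)) / (real N * \<delta>))) \<le> c * ?G"
    using c_pos by (intro mult_left_mono) simp_all
  let ?Q = "graph_exp (\<lambda>R. path_exp {..<N} R n (damping 2 {..<N} R))"
  have Q: "c\<^sup>2 * (n / ?a) * ?Q \<le> c\<^sup>2 * (n / ?a) * (exp (- 2 * ?H + 2 * \<delta> / (\<kappa> * w) + 4 * real n / ?a\<^sup>2) +
      dev N T w / (w - \<kappa>) + (\<Sum>q<n. dev N q (Y q)) / (real N * \<delta>))"
    using path_prod_dev_le[OF N n \<kappa> \<delta> _ Y, of 2] a0 by (intro mult_left_mono) simp_all
  have "mean_unexplored n - mean_unexplored (Suc n) \<ge> alive ?a n + real N * (c / real N) * ?G -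
     c / real N * boundary N * (real N)\<^sup>2 / ?a - (real N * (c / real N))\<^sup>2 * (n / ?a) * ?Q"
    using mean_unexplored_Suc_le[OF D a0, of n] by (simp only: alive_def)
  moreover have "real N * (c / real N) = c" "c / real N * boundary N * (real N)\<^sup>2 / ?a = c * boundary N / \<kappa>"
    using N by (simp_all add: power2_eq_square)
  ultimately have "unexplored_mean N n - unexplored_mean N (Suc n) \<ge> alive ?a n + c * ?G -
     c * boundary N / \<kappa> - c\<^sup>2 * (n / ?a) * ?Q"
    using N by (simp add: unexplored_mean_eq)
  with al G Q show ?thesis by linarith
qed

section \<open>The limit profile and its regularity\<close>

definition y :: "real \<Rightarrow> real" where "y t = 1 - z t"

lemma y_bounds: "t \<ge> 0 \<Longrightarrow> 0 \<le> y t" "t \<ge> 0 \<Longrightarrow> y t \<le> 1"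
  using z_bounds[of t] by (auto simp: y_def)

lemma y_limit: "t \<ge> 0 \<Longrightarrow> (\<lambda>N. unexplored_mean N (nat \<lfloor>t * real N\<rfloor>) / real N) \<longlonglongrightarrow> y t"
  unfolding y_def by (rule unexplored_mean_limit)

lemma floor_time_mono: "0 \<le> s \<Longrightarrow> s \<le> t \<Longrightarrow> nat \<lfloor>s * real N\<rfloor> \<le> nat \<lfloor>t * real N\<rfloor>"
  by (intro nat_mono Archimedean_Field.floor_mono mult_right_mono) simp_all

lemma y_antimono: "0 \<le> s \<Longrightarrow> s \<le> t \<Longrightarrow> y t \<le> y s"
proof -
  assume st: "0 \<le> s" "s \<le> t"
  show "y t \<le> y s"
  proof (rule tendsto_le[OF _ y_limit y_limit])
    have "unexplored_mean N (nat \<lfloor>t * real N\<rfloor>) / real N \<le> unexplored_mean N (nat \<lfloor>s * real N\<rfloor>) / real N" if N: "N \<ge> 1" for N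
    proof -
      interpret random_points "unif N" r "c / real N" N by (rule points[OF N])
      show ?thesis
        using mean_unexplored_antimono[OF floor_time_mono[OF st]] N by (simp add: unexplored_mean_eq divide_right_mono)
    qed
    then show "\<forall>\<^sub>F N in sequentially. unexplored_mean N (nat \<lfloor>t * real N\<rfloor>) / real N \<le> unexplored_mean N (nat \<lfloor>s * real N\<rfloor>) / real N"
      by (intro eventually_sequentiallyI[of 1])
  qed (use st in auto)
qed

lemma floor_ratio_limit: "t \<ge> 0 \<Longrightarrow> (\<lambda>N. real (nat \<lfloor>t * real N\<rfloor>) / real N) \<longlonglongrightarrow> t"
proof -
  assume t: "t \<ge> 0"
  have "(\<lambda>N. t - 1 / real N) \<longlonglongrightarrow> t - 0" by (intro tendsto_intros lim_1_over_n)
  then have lo: "(\<lambda>N. t - 1 / real N) \<longlonglongrightarrow> t" by simp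
  show ?thesis
  proof (rule tendsto_sandwich[OF _ _ lo tendsto_const])
    have *: "t - 1 / real N \<le> real (nat \<lfloor>t * real N\<rfloor>) / real N \<and> real (nat \<lfloor>t * real N\<rfloor>) / real N \<le> t" if "N \<ge> 1" for N
    proof -
      have "t * real N - 1 \<le> real (nat \<lfloor>t * real N\<rfloor>)" using t by linarith
      moreover have "real (nat \<lfloor>t * real N\<rfloor>) \<le> t * real N" using t by simp
      ultimately have "(t * real N - 1) / real N \<le> real (nat \<lfloor>t * real N\<rfloor>) / real N \<and>
          real (nat \<lfloor>t * real N\<rfloor>) / real N \<le> t * real N / real N"
        by (intro conjI divide_right_mono) simp_all
      then show ?thesis using that by (simp add: diff_divide_distrib)
    qed
    show "\<forall>\<^sub>F N in sequentially. t - 1 / real N \<le> real (nat \<lfloor>t * real N\<rfloor>) / real N"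
      "\<forall>\<^sub>F N in sequentially. real (nat \<lfloor>t * real N\<rfloor>) / real N \<le> t"
      using * by (auto intro: eventually_sequentiallyI[of 1])
  qed
qed

lemma sum_steps_le:
  fixes f :: "nat \<Rightarrow> real"
  assumes "\<And>n. m \<le> n \<Longrightarrow> n < k \<Longrightarrow> f n - f (Suc n) \<le> B" "m \<le> k"
  shows "f m - f k \<le> (real k - real m) * B"
  using assms(2,1)
proof (induction k rule: dec_induct)
  case (step k)
  have "f m - f k \<le> (real k - real m) * B" by (rule step.IH) (use step.prems in auto)
  moreover have "f k - f (Suc k) \<le> B" using step by simp
  ultimately show ?case by (simp add: algebra_simps)
qed simp

text \<open>The steps between the two times are telescoped; there are about (t - s) N of them, and
  division by N leaves the factor \<open>t - s\<close>.\<close>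

lemma limit_increment_le:
  assumes st: "0 \<le> s" "s \<le> t" and B: "B \<longlonglongrightarrow> b"
    and ev: "\<forall>\<^sub>F N in sequentially. \<forall>n. nat \<lfloor>s * real N\<rfloor> \<le> n \<and> n < nat \<lfloor>t * real N\<rfloor> \<longrightarrow>
       unexplored_mean N n - unexplored_mean N (Suc n) \<le> B N"
  shows "y s - y t \<le> (t - s) * b"
proof (rule tendsto_le[of sequentially])
  let ?s = "\<lambda>N. nat \<lfloor>s * real N\<rfloor>" and ?t = "\<lambda>N. nat \<lfloor>t * real N\<rfloor>"
  show "(\<lambda>N. unexplored_mean N (?s N) / real N - unexplored_mean N (?t N) / real N) \<longlonglongrightarrow> y s - y t"
    using st by (intro tendsto_diff y_limit) auto
  show "(\<lambda>N. (real (?t N) / real N - real (?s N) / real N) * B N) \<longlonglongrightarrow> (t - s) * b"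
    using st by (intro tendsto_mult tendsto_diff floor_ratio_limit B) auto
  show "\<forall>\<^sub>F N in sequentially. unexplored_mean N (?s N) / real N - unexplored_mean N (?t N) / real N \<le>
      (real (?t N) / real N - real (?s N) / real N) * B N"
    using ev
  proof eventually_elim
    case (elim N)
    then have "unexplored_mean N (?s N) - unexplored_mean N (?t N) \<le> (real (?t N) - real (?s N)) * B N"
      using floor_time_mono[OF st] by (intro sum_steps_le) auto
    from divide_right_mono[OF this, of "real N"] show ?case
      by (simp add: diff_divide_distrib left_diff_distrib)
  qed
qed simp

lemma limit_increment_ge:
  assumes st: "0 \<le> s" "s \<le> t" and B: "B \<longlonglongrightarrow> b"
    and ev: "\<forall>\<^sub>F N in sequentially. \<forall>n. nat \<lfloor>s * real N\<rfloor> \<le> n \<and> n < nat \<lfloor>t * real N\<rfloor> \<longrightarrow>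
       unexplored_mean N n - unexplored_mean N (Suc n) \<ge> B N"
  shows "y s - y t \<ge> (t - s) * b"
proof (rule tendsto_le[of sequentially])
  let ?s = "\<lambda>N. nat \<lfloor>s * real N\<rfloor>" and ?t = "\<lambda>N. nat \<lfloor>t * real N\<rfloor>"
  show "(\<lambda>N. unexplored_mean N (?s N) / real N - unexplored_mean N (?t N) / real N) \<longlonglongrightarrow> y s - y t"
    using st by (intro tendsto_diff y_limit) auto
  show "(\<lambda>N. (real (?t N) / real N - real (?s N) / real N) * B N) \<longlonglongrightarrow> (t - s) * b"
    using st by (intro tendsto_mult tendsto_diff floor_ratio_limit B) auto
  show "\<forall>\<^sub>F N in sequentially. unexplored_mean N (?s N) / real N - unexplored_mean N (?t N) / real N \<ge>
      (real (?t N) / real N - real (?s N) / real N) * B N"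
    using ev
  proof eventually_elim
    case (elim N)
    then have "- unexplored_mean N (?s N) - - unexplored_mean N (?t N) \<le> (real (?t N) - real (?s N)) * - B N"
      using floor_time_mono[OF st] by (intro sum_steps_le) (auto simp: algebra_simps)
    from divide_right_mono[OF this, of "real N"] show ?case
      by (simp add: diff_divide_distrib left_diff_distrib)
  qed
qed simp

lemma y_Lipschitz: "0 \<le> s \<Longrightarrow> s \<le> t \<Longrightarrow> y s - y t \<le> (t - s) * (1 + c)"
  by (rule limit_increment_le[of s t "\<lambda>_. 1 + c"])
    (auto intro!: eventually_sequentiallyI[of 1] step_le_const)

lemma y_0: "y 0 = 1"
proof (rule LIMSEQ_unique[OF y_limit])
  have "unexplored_mean N (nat \<lfloor>0 * real N\<rfloor>) / real N = 1" if N: "N \<ge> 1" for N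
  proof -
    interpret random_points "unif N" r "c / real N" N by (rule points[OF N])
    show ?thesis using N by (simp add: unexplored_mean_eq mean_unexplored_def graph_exp_const)
  qed
  then have "\<forall>\<^sub>F N in sequentially. unexplored_mean N (nat \<lfloor>0 * real N\<rfloor>) / real N = 1"
    by (intro eventually_sequentiallyI[of 1])
  then show "(\<lambda>N. unexplored_mean N (nat \<lfloor>0 * real N\<rfloor>) / real N) \<longlonglongrightarrow> 1"
    by (rule tendsto_eventually)
qed simp

text \<open>Each step explores at least one point, so N steps exhaust the graph; this bounds the
  hitting time.\<close>

lemma y_1: "y 1 = 0"
proof (rule LIMSEQ_unique[OF y_limit])
  have "unexplored_mean N (nat \<lfloor>1 * real N\<rfloor>) / real N = 0" if N: "N \<ge> 1" for N
  proof -
    interpret random_points "unif N" r "c / real N" N by (rule points[OF N])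
    show ?thesis using N by (simp add: unexplored_mean_eq mean_unexplored_card)
  qed
  then have "\<forall>\<^sub>F N in sequentially. unexplored_mean N (nat \<lfloor>1 * real N\<rfloor>) / real N = 0"
    by (intro eventually_sequentiallyI[of 1])
  then show "(\<lambda>N. unexplored_mean N (nat \<lfloor>1 * real N\<rfloor>) / real N) \<longlonglongrightarrow> 0"
    by (rule tendsto_eventually)
qed simp


text \<open>Convergence of \<open>dev\<close> is known at each fixed time only. The average over q
  is the integral over s of a step function, to which dominated convergence applies; the Lipschitz
  bound absorbs the difference between s and its grid point q / N.\<close>

lemma dev_average_limit:
  assumes t: "t \<ge> 0"
  shows "(\<lambda>N. (\<Sum>q<nat \<lfloor>t * real N\<rfloor>. dev N q (y (real q / real N))) / real N) \<longlonglongrightarrow> 0"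
proof -
  let ?T = "\<lambda>N. nat \<lfloor>t * real N\<rfloor>"
  let ?d = "\<lambda>N q. dev N q (y (real q / real N))"
  let ?g = "\<lambda>N s. \<Sum>q<?T N. ?d N q * indicator {real q / real N..<real (Suc q) / real N} s"
  have g_eq: "?g N s = (if s \<ge> 0 \<and> nat \<lfloor>s * real N\<rfloor> < ?T N then ?d N (nat \<lfloor>s * real N\<rfloor>) else 0)"
    if N: "N \<ge> 1" for N s
  proof -
    \<comment> \<open>Each \<open>s \<ge> 0\<close> lies in exactly one cell, the one whose index is
      the floor of s N, so the sum defining \<open>?g\<close> has at most one nonzero term.\<close>
    have ind: "indicator {real q / real N..<real (Suc q) / real N} s =
        (if s \<ge> 0 \<and> q = nat \<lfloor>s * real N\<rfloor> then 1 else 0 :: real)" for q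
    proof -
      have "s \<in> {real q / real N..<real (Suc q) / real N} \<longleftrightarrow> real q \<le> s * real N \<and> s * real N < real q + 1"
        using N by (simp add: field_simps)
      also have "\<dots> \<longleftrightarrow> s * real N \<ge> 0 \<and> q = nat \<lfloor>s * real N\<rfloor>" by linarith
      also have "s * real N \<ge> 0 \<longleftrightarrow> s \<ge> 0" using N by (simp add: zero_le_mult_iff)
      finally show ?thesis by (simp add: indicator_def)
    qed
    show ?thesis
      unfolding ind by (cases "s \<ge> 0") (simp_all add: if_distrib cong: if_cong)
  qed
  have d01: "0 \<le> ?d N q \<and> ?d N q \<le> 1" if "N \<ge> 1" for N q
    using dev_nonneg dev_le_1[OF that] y_bounds by simp
  have "(\<lambda>N. \<integral>s. ?g (Suc N) s \<partial>lborel) \<longlonglongrightarrow> (\<integral>(s::real). 0 \<partial>lborel)"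
  proof (rule integral_dominated_convergence[where w = "indicator {0..t + 1}"])
    show "AE s in lborel. (\<lambda>N. ?g (Suc N) s) \<longlonglongrightarrow> 0"
    proof (rule AE_I2)
      fix s :: real
      have "(\<lambda>N. ?g N s) \<longlonglongrightarrow> 0"
      proof (cases "s \<ge> 0")
        case True
        have "(\<lambda>N. dev N (nat \<lfloor>s * real N\<rfloor>) (1 - z s) + (1 + c) * (1 / real N)) \<longlonglongrightarrow> 0 + (1 + c) * 0"
          by (intro tendsto_add tendsto_mult tendsto_const dev_limit[OF True] lim_1_over_n)
        then have lim: "(\<lambda>N. dev N (nat \<lfloor>s * real N\<rfloor>) (1 - z s) + (1 + c) * (1 / real N)) \<longlonglongrightarrow> 0" by simp
        have "0 \<le> ?g N s \<and> ?g N s \<le> dev N (nat \<lfloor>s * real N\<rfloor>) (1 - z s) + (1 + c) * (1 / real N)"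
          if N: "N \<ge> 1" for N
        proof -
          let ?q = "nat \<lfloor>s * real N\<rfloor>"
          have "0 \<le> s * real N" using True by simp
          then have q: "real ?q \<le> s * real N" "s * real N \<le> real ?q + 1" by linarith+
          then have q': "real ?q / real N \<le> s" "s - real ?q / real N \<le> 1 / real N"
            using N divide_right_mono[OF q(2), of "real N"] by (simp_all add: divide_le_eq add_divide_distrib)
          have "?d N ?q \<le> dev N ?q (y s) + \<bar>y (real ?q / real N) - y s\<bar>" by (rule dev_diff_le[OF N])
          also have "\<bar>y (real ?q / real N) - y s\<bar> = y (real ?q / real N) - y s"
            using y_antimono[OF _ q'(1)] by simp
          also have "\<dots> \<le> (s - real ?q / real N) * (1 + c)"
            by (rule y_Lipschitz[OF _ q'(1)]) simp
          also have "\<dots> \<le> 1 / real N * (1 + c)"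
            using q'(2) c_pos by (intro mult_right_mono) simp_all
          finally have "?d N ?q \<le> dev N ?q (1 - z s) + (1 + c) * (1 / real N)"
            by (simp add: y_def mult.commute)
          moreover have "0 \<le> dev N ?q (1 - z s) + (1 + c) * (1 / real N)"
            using dev_nonneg c_pos by simp
          ultimately show ?thesis
            unfolding g_eq[OF N] using d01[OF N] by (cases "?q < ?T N") (simp_all add: True dev_nonneg)
        qed
        then show ?thesis
          by (intro tendsto_sandwich[OF _ _ tendsto_const lim]) (auto intro: eventually_sequentiallyI[of 1])
      next
        case False
        then have "?g N s = 0" if "N \<ge> 1" for N using g_eq[OF that, of s] by simp
        then show ?thesis
          by (intro tendsto_eventually eventually_sequentiallyI[of 1])
      qed
      then show "(\<lambda>N. ?g (Suc N) s) \<longlonglongrightarrow> 0" by (rule LIMSEQ_Suc)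
    qed
    show "AE s in lborel. norm (?g (Suc N) s) \<le> indicator {0..t + 1} s" for N
    proof (rule AE_I2)
      fix s :: real
      have N: "Suc N \<ge> 1" by simp
      show "norm (?g (Suc N) s) \<le> indicator {0..t + 1} s"
      proof (cases "s \<ge> 0 \<and> nat \<lfloor>s * real (Suc N)\<rfloor> < ?T (Suc N)")
        case True
        then have "s < t"
        proof -
          have "\<lfloor>s * real (Suc N)\<rfloor> < \<lfloor>t * real (Suc N)\<rfloor>" using True by simp
          then have "s * real (Suc N) < t * real (Suc N)"
            by (meson leD leI Archimedean_Field.floor_mono)
          then show ?thesis by simp
        qed
        then show ?thesis
          unfolding g_eq[OF N] using True d01[OF N, of "nat \<lfloor>s * real (Suc N)\<rfloor>"] by (simp del: of_nat_Suc)
      next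
        case False
        show ?thesis unfolding g_eq[OF N] if_not_P[OF False] by simp
      qed
    qed
    show "?g (Suc N) \<in> borel_measurable lborel" for N
      by (intro borel_measurable_sum borel_measurable_times borel_measurable_const borel_measurable_indicator) simp
    show "integrable lborel (indicator {0..t + 1} :: real \<Rightarrow> real)"
      by (rule integrable_real_indicator) (simp, simp add: emeasure_lborel_Icc_eq)
  qed simp_all
  moreover have int: "(\<integral>s. ?g N s \<partial>lborel) = (\<Sum>q<?T N. ?d N q) / real N" if N: "N \<ge> 1" for N
  proof -
    have "(\<integral>s. ?g N s \<partial>lborel) = (\<Sum>q<?T N. \<integral>s. ?d N q * indicator {real q / real N..<real (Suc q) / real N} s \<partial>lborel)"
      by (rule Bochner_Integration.integral_sum) (simp add: emeasure_lborel_Ico divide_right_mono)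
    also have "\<dots> = (\<Sum>q<?T N. ?d N q * (1 / real N))"
      by (rule sum.cong) (simp_all add: divide_right_mono add_divide_distrib)
    finally show ?thesis by (simp add: sum_divide_distrib)
  qed
  moreover have "(\<integral>s. ?g (Suc N) s \<partial>lborel) = (\<Sum>q<?T (Suc N). ?d (Suc N) q) / real (Suc N)" for N
    by (rule int) simp
  ultimately have "(\<lambda>N. (\<Sum>q<?T (Suc N). ?d (Suc N) q) / real (Suc N)) \<longlonglongrightarrow> 0"
    by (simp only: Bochner_Integration.integral_zero)
  then show ?thesis by (rule LIMSEQ_imp_Suc)
qed

lemma y_continuous: "continuous_on {0..} y"
proof (rule continuous_onI)
  fix s e :: real assume s: "s \<in> {0..}" and e: "e > 0"
  have lip: "\<bar>y a - y b\<bar> \<le> \<bar>a - b\<bar> * (1 + c)" if "a \<ge> 0" "b \<ge> 0" for a b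
    using that y_Lipschitz[of a b] y_Lipschitz[of b a] y_antimono[of a b] y_antimono[of b a]
    by (cases "a \<le> b") (simp_all add: abs_minus_commute)
  show "\<exists>d>0. \<forall>x\<in>{0..}. dist x s < d \<longrightarrow> dist (y x) (y s) \<le> e"
  proof (intro exI[of _ "e / (1 + c)"] conjI ballI impI)
    show "e / (1 + c) > 0" using e c_pos by simp
    fix x assume x: "x \<in> {0..}" "dist x s < e / (1 + c)"
    then have "\<bar>x - s\<bar> * (1 + c) \<le> e"
      using c_pos by (simp add: dist_real_def pos_less_divide_eq)
    then show "dist (y x) (y s) \<le> e" using lip[of x s] x s by (simp add: dist_real_def)
  qed
qed

section \<open>Riemann sums for the integral of 1 / y\<close>

definition I :: "real \<Rightarrow> real" where "I t = integral {0..t} (\<lambda>s. 1 / y s)"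

lemma inverse_y_integrable:
  assumes "0 \<le> a" "y t > 0" "b \<le> t"
  shows "(\<lambda>s. 1 / y s) integrable_on {a..b}"
proof (rule integrable_continuous_interval)
  have "y s > 0" if "s \<in> {a..b}" for s
    using that assms y_antimono[of s t] by auto
  then show "continuous_on {a..b} (\<lambda>s. 1 / y s)"
    using assms by (intro continuous_intros continuous_on_subset[OF y_continuous]) force+
qed

lemma integral_inverse_y_bounds:
  assumes "0 \<le> a" "a \<le> b" "b \<le> t" "y t > 0"
  shows "(b - a) / y a \<le> integral {a..b} (\<lambda>s. 1 / y s)" "integral {a..b} (\<lambda>s. 1 / y s) \<le> (b - a) / y b"
    and "I b = I a + integral {a..b} (\<lambda>s. 1 / y s)"
proof -
  have int: "(\<lambda>s. 1 / y s) integrable_on {a..b}" using assms by (intro inverse_y_integrable)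
  have yb: "y b > 0" using y_antimono[of b t] assms by simp
  have bnd: "1 / y a \<le> 1 / y s" "1 / y s \<le> 1 / y b" if "s \<in> {a..b}" for s
  proof -
    have "y b \<le> y s" "y s \<le> y a" using that assms y_antimono[of s b] y_antimono[of a s] by auto
    then show "1 / y a \<le> 1 / y s" "1 / y s \<le> 1 / y b" using yb by (auto intro!: divide_left_mono mult_pos_pos)
  qed
  have "integral {a..b} (\<lambda>s. 1 / y a) \<le> integral {a..b} (\<lambda>s. 1 / y s)"
    by (intro integral_le int bnd integrable_const_ivl) simp_all
  then show "(b - a) / y a \<le> integral {a..b} (\<lambda>s. 1 / y s)" using assms by simp
  have "integral {a..b} (\<lambda>s. 1 / y s) \<le> integral {a..b} (\<lambda>s. 1 / y b)"
    by (intro integral_le int bnd integrable_const_ivl) simp_all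
  then show "integral {a..b} (\<lambda>s. 1 / y s) \<le> (b - a) / y b" using assms by simp
  show "I b = I a + integral {a..b} (\<lambda>s. 1 / y s)"
    unfolding I_def using assms
    by (intro Henstock_Kurzweil_Integration.integral_combine[symmetric] inverse_y_integrable) auto
qed

text \<open>Since 1 / y increases, sums over left endpoints are lower sums. The excess of the upper
  sums telescopes, with \<open>y 0 = 1\<close> supplying the term - 1.\<close>

lemma harmonic_bounds:
  assumes N: "N \<ge> 1" and n: "real n / real N \<le> t" and yt: "y t > 0"
  shows "(\<Sum>q<n. 1 / (real N * y (real q / real N))) \<le> I (real n / real N) \<and>
    I (real n / real N) \<le> (\<Sum>q<n. 1 / (real N * y (real q / real N))) + (1 / y (real n / real N) - 1) / real N"
  using n
proof (induction n)
  case 0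
  then show ?case by (simp add: I_def y_0)
next
  case (Suc n)
  let ?a = "real n / real N" and ?b = "real (Suc n) / real N"
  have ab: "?a \<le> ?b" "?b \<le> t" "?b - ?a = 1 / real N" "0 \<le> ?a"
    using Suc.prems by (simp_all add: divide_right_mono add_divide_distrib)
  have IH: "(\<Sum>q<n. 1 / (real N * y (real q / real N))) \<le> I ?a"
    "I ?a \<le> (\<Sum>q<n. 1 / (real N * y (real q / real N))) + (1 / y ?a - 1) / real N"
    using Suc.IH ab by auto
  have "1 / (real N * y ?a) \<le> integral {?a..?b} (\<lambda>s. 1 / y s)"
    "integral {?a..?b} (\<lambda>s. 1 / y s) \<le> 1 / (real N * y ?b)"
    "I ?b = I ?a + integral {?a..?b} (\<lambda>s. 1 / y s)"
    using integral_inverse_y_bounds[OF ab(4,1,2) yt] unfolding ab(3) by simp_all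
  moreover have "(1 / y ?a - 1) / real N = 1 / (real N * y ?a) - 1 / real N"
    "(1 / y ?b - 1) / real N = 1 / (real N * y ?b) - 1 / real N"
    by (simp_all add: diff_divide_distrib mult.commute)
  moreover have "(\<Sum>q<Suc n. 1 / (real N * y (real q / real N))) =
      (\<Sum>q<n. 1 / (real N * y (real q / real N))) + 1 / (real N * y ?a)"
    by simp
  ultimately show ?case using IH by linarith
qed

text \<open>Of the two terms 1 / (N y t) lost in the lower bound, one comes from rounding
  \<open>s\<close> down to the grid and one from the Riemann sum.\<close>

lemma harmonic_sandwich:
  assumes N: "N \<ge> 1" and st: "0 \<le> s" "s \<le> t" and yt: "y t > 0"
    and n: "nat \<lfloor>s * real N\<rfloor> \<le> n" "n < nat \<lfloor>t * real N\<rfloor>"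
  shows "(\<Sum>q<n. 1 / (real N * y (real q / real N))) \<le> I t"
    and "(\<Sum>q<n. 1 / (real N * y (real q / real N))) \<ge> I s - 2 / (real N * y t)"
    and "real n \<le> t * real N"
    and "\<And>q. q < n \<Longrightarrow> y (real q / real N) \<ge> y t"
proof -
  have t: "0 \<le> t" using st by simp
  show nt: "real n \<le> t * real N" using n(2) t by linarith
  then have nt': "real n / real N \<le> t" using N by (simp add: divide_le_eq)
  show ge: "y (real q / real N) \<ge> y t" if "q < n" for q
  proof (rule y_antimono)
    have "real q / real N \<le> real n / real N" using that by (intro divide_right_mono) simp_all
    then show "real q / real N \<le> t" using nt' by simp
  qed simp
  have "I (real n / real N) \<le> I t"
    using integral_inverse_y_bounds(1,3)[of "real n / real N" t t] nt' yt
    by (smt (verit) divide_nonneg_nonneg of_nat_0_le_iff y_bounds(1))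
  then show "(\<Sum>q<n. 1 / (real N * y (real q / real N))) \<le> I t"
    using harmonic_bounds[OF N nt' yt] by linarith
  let ?m = "nat \<lfloor>s * real N\<rfloor>"
  have m: "real ?m \<le> s * real N" "s * real N \<le> real ?m + 1"
  proof -
    have "0 \<le> s * real N" using st by simp
    then show "real ?m \<le> s * real N" "s * real N \<le> real ?m + 1" by linarith+
  qed
  then have m': "real ?m / real N \<le> s" "s - real ?m / real N \<le> 1 / real N"
    using N divide_right_mono[OF m(2), of "real N"] by (simp_all add: divide_le_eq add_divide_distrib)
  then have mt: "real ?m / real N \<le> t" using st by simp
  have ys: "y s \<ge> y t" "y (real ?m / real N) \<ge> y t" using st m' mt by (auto intro!: y_antimono)
  have "I s \<le> I (real ?m / real N) + (s - real ?m / real N) / y s"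
    using integral_inverse_y_bounds(2,3)[OF _ m'(1) st(2) yt] by simp
  also have "(s - real ?m / real N) / y s \<le> (1 / real N) / y t"
    using m' ys yt by (intro frac_le) simp_all
  also have "I (real ?m / real N) \<le> (\<Sum>q<?m. 1 / (real N * y (real q / real N))) + (1 / y (real ?m / real N) - 1) / real N"
    using harmonic_bounds[OF N mt yt] by simp
  also have "(1 / y (real ?m / real N) - 1) / real N \<le> (1 / y t) / real N"
  proof (rule divide_right_mono)
    have "1 / y (real ?m / real N) \<le> 1 / y t" using ys yt by (intro divide_left_mono mult_pos_pos) simp_all
    then show "1 / y (real ?m / real N) - 1 \<le> 1 / y t" by simp
  qed simp
  also have "(\<Sum>q<?m. 1 / (real N * y (real q / real N))) \<le> (\<Sum>q<n. 1 / (real N * y (real q / real N)))"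
    using n(1) y_bounds by (intro sum_mono2) auto
  finally show "(\<Sum>q<n. 1 / (real N * y (real q / real N))) \<ge> I s - 2 / (real N * y t)"
    by (simp add: mult.commute)
qed


section \<open>Differential inequalities in integrated form\<close>

lemma time_ratio_le:
  assumes "N \<ge> 1" "\<kappa> > 0" "real n \<le> t * real N"
  shows "real n / (\<kappa> * real N)\<^sup>2 \<le> t / \<kappa>\<^sup>2 * (1 / real N)" "real n / (\<kappa> * real N) \<le> t / \<kappa>"
proof -
  have "real n / (\<kappa> * real N)\<^sup>2 \<le> (t * real N) / (\<kappa> * real N)\<^sup>2"
    by (rule divide_right_mono[OF assms(3)]) simp
  also have "\<dots> = t / \<kappa>\<^sup>2 * (1 / real N)" using assms(1) by (simp add: power2_eq_square)
  finally show "real n / (\<kappa> * real N)\<^sup>2 \<le> t / \<kappa>\<^sup>2 * (1 / real N)" .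
  have "real n / (\<kappa> * real N) \<le> (t * real N) / (\<kappa> * real N)"
    using assms by (intro divide_right_mono) simp_all
  also have "\<dots> = t / \<kappa>" using assms(1) by simp
  finally show "real n / (\<kappa> * real N) \<le> t / \<kappa>" .
qed

definition sum_dev :: "real \<Rightarrow> nat \<Rightarrow> real" where
  "sum_dev t N = (\<Sum>q<nat \<lfloor>t * real N\<rfloor>. dev N q (y (real q / real N))) / real N"

lemma sum_dev_ge:
  assumes "n \<le> nat \<lfloor>t * real N\<rfloor>" "\<delta> > 0"
  shows "(\<Sum>q<n. dev N q (y (real q / real N))) / (real N * \<delta>) \<le> sum_dev t N / \<delta>"
proof -
  have "(\<Sum>q<n. dev N q (y (real q / real N))) \<le> (\<Sum>q<nat \<lfloor>t * real N\<rfloor>. dev N q (y (real q / real N)))"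
    using assms(1) by (intro sum_mono2 dev_nonneg) auto
  then have "(\<Sum>q<n. dev N q (y (real q / real N))) / (real N * \<delta>) \<le>
      (\<Sum>q<nat \<lfloor>t * real N\<rfloor>. dev N q (y (real q / real N))) / (real N * \<delta>)"
    using assms(2) by (intro divide_right_mono) simp_all
  then show ?thesis by (simp add: sum_dev_def)
qed

lemma sum_dev_limit: "t \<ge> 0 \<Longrightarrow> (\<lambda>N. sum_dev t N / \<delta>) \<longlonglongrightarrow> 0"
  using tendsto_divide[OF dev_average_limit[of t] tendsto_const[of \<delta>]] unfolding sum_dev_def
  by (cases "\<delta> = 0") simp_all

lemma dev_limit': "t \<ge> 0 \<Longrightarrow> (\<lambda>N. dev N (nat \<lfloor>t * real N\<rfloor>) (y t) / a) \<longlonglongrightarrow> 0"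
  using tendsto_divide[OF dev_limit[of t] tendsto_const[of a]] unfolding y_def
  by (cases "a = 0") simp_all

text \<open>For fixed \<open>\<epsilon>\<close> all other errors vanish as N grows, since
  \<open>dev\<close> and its time average tend to 0; \<open>\<epsilon>\<close> itself is sent to 0
  afterwards.\<close>

lemma increment_le_approx:
  assumes st: "0 \<le> s" "s \<le> t" and yt: "y t > 0" and \<epsilon>: "\<epsilon> > 0"
  shows "y s - y t \<le> (t - s) * (1 + c * exp (- I s + \<epsilon>))"
proof -
  define w where "w = y t"
  define \<kappa> where "\<kappa> = w / 2"
  \<comment> \<open>Chosen so that the contribution \<open>\<delta> / (\<kappa> * w)\<close> of the
    deviations to the exponent is exactly \<open>\<epsilon>\<close>.\<close>
  define \<delta> where "\<delta> = \<epsilon> * (\<kappa> * w)"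
  have pos: "w > 0" "\<kappa> > 0" "\<kappa> < w" "\<delta> > 0" "t \<ge> 0" using yt \<epsilon> st by (auto simp: w_def \<kappa>_def \<delta>_def)
  have \<delta>': "\<delta> / (\<kappa> * w) = \<epsilon>" using pos by (simp add: \<delta>_def)
  let ?B = "\<lambda>N. 1 + c * (exp (- I s + 2 / w * (1 / real N) + \<epsilon> + t / \<kappa>\<^sup>2 * (1 / real N)) +
      dev N (nat \<lfloor>t * real N\<rfloor>) w / (w - \<kappa>) + sum_dev t N / \<delta>)"
  have "?B \<longlonglongrightarrow> 1 + c * (exp (- I s + 2 / w * 0 + \<epsilon> + t / \<kappa>\<^sup>2 * 0) + 0 + 0)"
    unfolding w_def
    by (intro tendsto_intros lim_1_over_n sum_dev_limit dev_limit' pos)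
  then have B: "?B \<longlonglongrightarrow> 1 + c * exp (- I s + \<epsilon>)" by simp
  show ?thesis
  proof (rule limit_increment_le[OF st B], rule eventually_sequentiallyI[of 1], intro allI impI)
    fix N n :: nat
    assume N: "1 \<le> N" and n: "nat \<lfloor>s * real N\<rfloor> \<le> n \<and> n < nat \<lfloor>t * real N\<rfloor>"
    let ?H = "\<Sum>q<n. 1 / (real N * y (real q / real N))"
    note hs = harmonic_sandwich[OF N st yt] n
    have H: "?H \<ge> I s - 2 / (real N * w)" and nt: "real n \<le> t * real N" using hs by (auto simp: w_def)
    have "unexplored_mean N n - unexplored_mean N (Suc n) \<le>
      1 + c * (exp (- ?H + \<delta> / (\<kappa> * w) + n / (\<kappa> * real N)\<^sup>2) +
      dev N (nat \<lfloor>t * real N\<rfloor>) w / (w - \<kappa>) + (\<Sum>q<n. dev N q (y (real q / real N))) / (real N * \<delta>))"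
    proof (rule step_le[OF N _ pos(2,3,4)])
      show "y (real q / real N) \<ge> w" if "q < n" for q using hs(4)[of n q] n that by (simp add: w_def)
    qed (use n in simp)
    also have "\<dots> \<le> ?B N"
    proof (intro add_left_mono mult_left_mono add_mono order.refl)
      have "- ?H + \<delta> / (\<kappa> * w) + n / (\<kappa> * real N)\<^sup>2 \<le> - I s + 2 / w * (1 / real N) + \<epsilon> + t / \<kappa>\<^sup>2 * (1 / real N)"
        using H time_ratio_le(1)[OF N pos(2) nt] unfolding \<delta>' by (simp add: mult.commute)
      then show "exp (- ?H + \<delta> / (\<kappa> * w) + n / (\<kappa> * real N)\<^sup>2) \<le> exp (- I s + 2 / w * (1 / real N) + \<epsilon> + t / \<kappa>\<^sup>2 * (1 / real N))"
        by simp
      show "(\<Sum>q<n. dev N q (y (real q / real N))) / (real N * \<delta>) \<le> sum_dev t N / \<delta>"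
        using n pos by (intro sum_dev_ge) simp_all
    qed (use c_pos in simp)
    finally show "unexplored_mean N n - unexplored_mean N (Suc n) \<le> ?B N" .
  qed
qed

lemma increment_le:
  assumes st: "0 \<le> s" "s \<le> t" and yt: "y t > 0"
  shows "y s - y t \<le> (t - s) * (1 + c * exp (- I s))"
proof (rule tendsto_lowerbound[where F = "at_right 0"])
  have "((\<lambda>\<epsilon>. (t - s) * (1 + c * exp (- I s + \<epsilon>))) \<longlongrightarrow> (t - s) * (1 + c * exp (- I s + 0))) (at_right 0)"
    by (intro tendsto_intros)
  then show "((\<lambda>\<epsilon>. (t - s) * (1 + c * exp (- I s + \<epsilon>))) \<longlongrightarrow> (t - s) * (1 + c * exp (- I s))) (at_right 0)"
    by simp
  show "\<forall>\<^sub>F \<epsilon> in at_right 0. y s - y t \<le> (t - s) * (1 + c * exp (- I s + \<epsilon>))"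
    using increment_le_approx[OF assms] by (simp add: eventually_at_filter)
qed simp

lemma increment_ge_approx:
  assumes st: "0 \<le> s" "s \<le> t" and yt: "y t > 0" and \<epsilon>: "\<epsilon> > 0"
  shows "y s - y t \<ge> (t - s) * (1 + c * exp (- I t - \<epsilon>) - 3 * c\<^sup>2 * t / y t * exp (- 2 * I s + 2 * \<epsilon>))"
proof -
  define w where "w = y t"
  \<comment> \<open>With this threshold the factor n / (kappa N) of the correction term is at most
    \<open>3 * t / w\<close>, which is where the 3 of the lower equation arises.\<close>
  define \<kappa> where "\<kappa> = w / 3"
  define \<delta> where "\<delta> = \<epsilon> * (\<kappa> * w)"
  have pos: "w > 0" "\<kappa> > 0" "\<kappa> < w" "\<delta> > 0" "t \<ge> 0" using yt \<epsilon> st by (auto simp: w_def \<kappa>_def \<delta>_def)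
  have \<delta>': "\<delta> / (\<kappa> * w) = \<epsilon>" "2 * \<delta> / (\<kappa> * w) = 2 * \<epsilon>" using pos by (simp_all add: \<delta>_def)
  let ?f = "\<lambda>N. dev N (nat \<lfloor>t * real N\<rfloor>) w / (w - \<kappa>)" and ?E = "\<lambda>N. sum_dev t N / \<delta>"
  let ?g = "\<lambda>N. exp (- I t - \<epsilon> - 2 * t / \<kappa>\<^sup>2 * (1 / real N)) * (1 - 1 / \<kappa> * (1 / real N)) * (1 - ?f N - ?E N)"
  let ?h = "\<lambda>N. exp (- 2 * I s + 4 / w * (1 / real N) + 2 * \<epsilon> + 4 * t / \<kappa>\<^sup>2 * (1 / real N)) + ?f N + ?E N"
  let ?B = "\<lambda>N. (1 - ?f N) + c * ?g N - c * boundary N / \<kappa> - c\<^sup>2 * (t / \<kappa>) * ?h N"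
  have f0: "?f \<longlonglongrightarrow> 0" unfolding w_def by (rule dev_limit'[OF pos(5)])
  have E0: "?E \<longlonglongrightarrow> 0" by (rule sum_dev_limit[OF pos(5)])
  have "?B \<longlonglongrightarrow> (1 - 0) + c * (exp (- I t - \<epsilon> - 2 * t / \<kappa>\<^sup>2 * 0) * (1 - 1 / \<kappa> * 0) * (1 - 0 - 0)) - c * 0 / \<kappa> -
      c\<^sup>2 * (t / \<kappa>) * (exp (- 2 * I s + 4 / w * 0 + 2 * \<epsilon> + 4 * t / \<kappa>\<^sup>2 * 0) + 0 + 0)"
    using pos by (intro tendsto_intros lim_1_over_n boundary_limit f0 E0) simp_all
  then have B: "?B \<longlonglongrightarrow> 1 + c * exp (- I t - \<epsilon>) - 3 * c\<^sup>2 * t / y t * exp (- 2 * I s + 2 * \<epsilon>)"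
    using pos by (simp add: \<kappa>_def w_def mult_ac)
  have "\<forall>\<^sub>F N in sequentially. 2 * r / (real N / lam) powr (1 / DIM('a)) < 1"
    using order_tendstoD(2)[OF margin_limit, of 1] by simp
  \<comment> \<open>Eventually \<open>1 - ?f N - ?E N\<close> is positive, as the multiplication of
    inequalities below requires.\<close>
  moreover have "\<forall>\<^sub>F N in sequentially. ?f N + ?E N < 1"
    using order_tendstoD(2)[OF tendsto_add[OF f0 E0], of 1] by simp
  moreover have "\<forall>\<^sub>F N in sequentially. 2 / \<kappa> < real N"
    using filterlim_real_sequentially by (simp add: filterlim_at_top_dense)
  moreover have "\<forall>\<^sub>F N in sequentially. N \<ge> 1"
    by (rule eventually_ge_at_top)
  ultimately have ev: "\<forall>\<^sub>F N in sequentially. \<forall>n. nat \<lfloor>s * real N\<rfloor> \<le> n \<and> n < nat \<lfloor>t * real N\<rfloor> \<longrightarrow>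
       unexplored_mean N n - unexplored_mean N (Suc n) \<ge> ?B N"
  proof eventually_elim
    case (elim N)
    note N = elim(4)
    have big: "2 * r < (real N / lam) powr (1 / DIM('a))" "\<kappa> * real N \<ge> 2"
      using elim N lam pos by (simp_all add: divide_less_eq mult.commute less_imp_le)
    show ?case
    proof (intro allI impI)
      fix n assume n: "nat \<lfloor>s * real N\<rfloor> \<le> n \<and> n < nat \<lfloor>t * real N\<rfloor>"
      let ?H = "\<Sum>q<n. 1 / (real N * y (real q / real N))"
      let ?e = "(\<Sum>q<n. dev N q (y (real q / real N))) / (real N * \<delta>)"
      note hs = harmonic_sandwich[OF N st yt] n
      have H: "?H \<ge> I s - 2 / (real N * w)" "?H \<le> I t" and nt: "real n \<le> t * real N" using hs by (auto simp: w_def)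
      have e: "?e \<le> ?E N" using n pos by (intro sum_dev_ge) simp_all
      note ratio = time_ratio_le[OF N pos(2) nt]
      have *: "unexplored_mean N n - unexplored_mean N (Suc n) \<ge>
        (1 - ?f N) +
        c * (exp (- ?H - \<delta> / (\<kappa> * w) - 2 * real n / (\<kappa> * real N)\<^sup>2) * (1 - 1 / (\<kappa> * real N)) * (1 - ?f N - ?e)) -
        c * boundary N / \<kappa> -
        c\<^sup>2 * (n / (\<kappa> * real N)) * (exp (- 2 * ?H + 2 * \<delta> / (\<kappa> * w) + 4 * real n / (\<kappa> * real N)\<^sup>2) + ?f N + ?e)"
      proof (rule step_ge[OF N _ pos(2,3,4) _ big])
        show "y (real q / real N) \<ge> w" if "q < n" for q using hs(4)[of n q] n that by (simp add: w_def)
      qed (use n in simp)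
      have g: "?g N \<le> exp (- ?H - \<delta> / (\<kappa> * w) - 2 * real n / (\<kappa> * real N)\<^sup>2) * (1 - 1 / (\<kappa> * real N)) * (1 - ?f N - ?e)"
      proof (intro mult_mono)
        show "exp (- I t - \<epsilon> - 2 * t / \<kappa>\<^sup>2 * (1 / real N)) \<le> exp (- ?H - \<delta> / (\<kappa> * w) - 2 * real n / (\<kappa> * real N)\<^sup>2)"
          using H(2) ratio(1) unfolding \<delta>' by simp
        show "1 - 1 / \<kappa> * (1 / real N) \<le> 1 - 1 / (\<kappa> * real N)" by simp
      qed (use e elim big in simp_all)
      have h: "c\<^sup>2 * (n / (\<kappa> * real N)) * (exp (- 2 * ?H + 2 * \<delta> / (\<kappa> * w) + 4 * real n / (\<kappa> * real N)\<^sup>2) + ?f N + ?e) \<le>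
          c\<^sup>2 * (t / \<kappa>) * ?h N"
      proof (intro mult_mono add_mono order.refl e mult_nonneg_nonneg add_nonneg_nonneg)
        have "- 2 * ?H + 2 * \<delta> / (\<kappa> * w) + 4 * real n / (\<kappa> * real N)\<^sup>2 \<le>
            - 2 * I s + 4 / w * (1 / real N) + 2 * \<epsilon> + 4 * t / \<kappa>\<^sup>2 * (1 / real N)"
        proof -
          have "4 * real n / (\<kappa> * real N)\<^sup>2 \<le> 4 * t / \<kappa>\<^sup>2 * (1 / real N)"
            using mult_left_mono[OF ratio(1), of 4] by simp
          moreover have "2 * (2 / (real N * w)) = 4 / w * (1 / real N)" by (simp add: mult.commute)
          ultimately show ?thesis using H(1) unfolding \<delta>' by linarith
        qed
        then show "exp (- 2 * ?H + 2 * \<delta> / (\<kappa> * w) + 4 * real n / (\<kappa> * real N)\<^sup>2) \<le>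
            exp (- 2 * I s + 4 / w * (1 / real N) + 2 * \<epsilon> + 4 * t / \<kappa>\<^sup>2 * (1 / real N))" by simp
        show "real n / (\<kappa> * real N) \<le> t / \<kappa>" by (rule ratio(2))
        show "0 \<le> ?f N" using dev_nonneg pos by simp
        show "0 \<le> ?e" using pos by (intro divide_nonneg_nonneg sum_nonneg dev_nonneg) simp_all
      qed (use pos in simp_all)
      from g have "c * ?g N \<le> c * (exp (- ?H - \<delta> / (\<kappa> * w) - 2 * real n / (\<kappa> * real N)\<^sup>2) * (1 - 1 / (\<kappa> * real N)) * (1 - ?f N - ?e))"
        using c_pos by (intro mult_left_mono) simp_all
      with * h show "?B N \<le> unexplored_mean N n - unexplored_mean N (Suc n)" by linarith
    qed
  qed
  show ?thesis by (rule limit_increment_ge[OF st B ev])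
qed

lemma increment_ge:
  assumes st: "0 \<le> s" "s \<le> t" and yt: "y t > 0"
  shows "y s - y t \<ge> (t - s) * (1 + c * exp (- I t) - 3 * c\<^sup>2 * t / y t * exp (- 2 * I s))"
proof (rule tendsto_upperbound[where F = "at_right 0"])
  let ?R = "\<lambda>\<epsilon>. (t - s) * (1 + c * exp (- I t - \<epsilon>) - 3 * c\<^sup>2 * t / y t * exp (- 2 * I s + 2 * \<epsilon>))"
  have "(?R \<longlongrightarrow> ?R 0) (at_right 0)"
    by (intro tendsto_intros)
  then show "(?R \<longlongrightarrow> (t - s) * (1 + c * exp (- I t) - 3 * c\<^sup>2 * t / y t * exp (- 2 * I s))) (at_right 0)"
    by simp
  show "\<forall>\<^sub>F \<epsilon> in at_right 0. y s - y t \<ge> ?R \<epsilon>"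
    using increment_ge_approx[OF assms] by (simp add: eventually_at_filter)
qed simp

end

section \<open>Comparison through one-sided difference quotients\<close>

lemma continuous_on_at_right:
  fixes f :: "real \<Rightarrow> real"
  assumes "continuous_on {a..b} f" "a \<le> s" "s < b"
  shows "(f \<longlongrightarrow> f s) (at_right s)"
proof -
  have "continuous_on {s..b} f" using assms by (auto intro: continuous_on_subset)
  then have "(f \<longlongrightarrow> f s) (at s within {s..b})" using assms by (auto simp: continuous_on_def)
  then show ?thesis using assms(3) by (simp add: at_within_Icc_at_right)
qed

text \<open>The growth condition is asked for only where \<open>f s \<ge> 0\<close>: a function that
  starts at or below 0 can become positive only by growing from such a point.\<close>

lemma right_derivative_nonpos_imp_nonpos:
  fixes f :: "real \<Rightarrow> real"
  assumes ab: "a \<le> b" and cont: "continuous_on {a..b} f" and fa: "f a \<le> 0"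
    and der: "\<And>s. a \<le> s \<Longrightarrow> s < b \<Longrightarrow> f s \<ge> 0 \<Longrightarrow>
      \<exists>R L. (R \<longlongrightarrow> L) (at_right s) \<and> L \<le> 0 \<and> (\<forall>\<^sub>F t in at_right s. f t - f s \<le> R t * (t - s))"
  shows "f b \<le> 0"
proof (rule field_le_epsilon)
  fix e :: real assume e: "e > 0"
  define \<epsilon> where "\<epsilon> = e / (b - a + 1)"
  have \<epsilon>: "\<epsilon> > 0" using e ab by (simp add: \<epsilon>_def)
  \<comment> \<open>Tilting by a small slope makes the growth strictly negative. At the last point
    \<open>s\<close> with \<open>g s \<le> 0\<close> one has \<open>g s = 0\<close>, hence
    \<open>f s \<ge> 0\<close>, and just to the right of it \<open>g\<close> would have to fall
    below 0.\<close>
  define g where "g t = f t - \<epsilon> * (t - a)" for t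
  have cg: "continuous_on {a..b} g" unfolding g_def by (intro continuous_intros cont)
  have "g b \<le> 0"
  proof (rule ccontr)
    assume "\<not> g b \<le> 0"
    then have gb: "g b > 0" by simp
    let ?S = "{a..b} \<inter> g -` {..0}"
    have "closed ?S" by (rule continuous_closed_preimage[OF cg]) simp_all
    then have "compact ?S" by (auto intro: bounded_subset[of "{a..b}"] simp: compact_eq_bounded_closed)
    moreover have "?S \<noteq> {}" using fa ab by (auto simp: g_def)
    ultimately obtain s where s: "s \<in> ?S" "\<And>t. t \<in> ?S \<Longrightarrow> t \<le> s"
      using compact_attains_sup[of ?S] by blast
    then have sb: "a \<le> s" "s < b" "g s \<le> 0" using gb by (auto simp: less_le)
    have gpos: "g t > 0" if "s < t" "t \<le> b" for t
      using s(2)[of t] that sb by force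
    have ev: "\<forall>\<^sub>F t in at_right s. s < t \<and> t < b"
      using sb by (auto simp: eventually_at_right_field)
    have tg: "(g \<longlongrightarrow> g s) (at_right s)"
      by (rule continuous_on_at_right[OF cg sb(1,2)])
    have "g s \<ge> 0"
      by (rule tendsto_lowerbound[OF tg]) (use gpos in \<open>auto intro: eventually_mono[OF ev] less_imp_le\<close>)
    then have "g s = 0" using sb by simp
    then have "f s \<ge> 0" using \<epsilon> sb by (simp add: g_def)
    from der[OF sb(1,2) this] obtain R L where R: "(R \<longlongrightarrow> L) (at_right s)" "L \<le> 0"
      "\<forall>\<^sub>F t in at_right s. f t - f s \<le> R t * (t - s)" by blast
    have "\<forall>\<^sub>F t in at_right s. R t < \<epsilon>" using order_tendstoD(2)[OF R(1), of \<epsilon>] R(2) \<epsilon> by simp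
    with R(3) ev have "\<forall>\<^sub>F t in at_right s. False"
    proof eventually_elim
      case (elim t)
      have "g t - g s = (f t - f s) - \<epsilon> * (t - s)" by (simp add: g_def algebra_simps)
      also have "\<dots> \<le> (R t - \<epsilon>) * (t - s)" using elim by (simp add: algebra_simps)
      also have "\<dots> < 0" using elim by (intro mult_neg_pos) simp_all
      finally show ?case using gpos[of t] elim sb by simp
    qed
    then show False by simp
  qed
  have "\<epsilon> * (b - a) \<le> e" using e ab by (simp add: \<epsilon>_def field_simps)
  with \<open>g b \<le> 0\<close> show "f b \<le> 0 + e" by (simp add: g_def)
qed

lemma continuous_on_le_endpoint:
  fixes f :: "real \<Rightarrow> real"
  assumes "a < b" "continuous_on {a..b} f" "\<And>s. a \<le> s \<Longrightarrow> s < b \<Longrightarrow> f s \<le> k"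
  shows "f b \<le> k"
  by (rule continuous_le_on_closure[of "{a..<b}"]) (use assms in \<open>auto simp: closure_atLeastLessThan\<close>)

section \<open>The survival function and the rate\<close>

definition elapsed :: "(real \<Rightarrow> real) \<Rightarrow> real \<Rightarrow> real" where
  "elapsed y t = integral {0..t} (\<lambda>s. 1 / y s)"

text \<open>In terms of \<open>y = 1 - u\<close> and \<open>X = exp (- \<integral> 1 / y)\<close>, the quotient \<open>y / X\<close> is linear in the
  upper equation and satisfies a closed scalar equation in the lower one.\<close>

definition rate :: "(real \<Rightarrow> real) \<Rightarrow> real \<Rightarrow> real" where
  "rate y t = y t * exp (elapsed y t)"

locale positive_profile =
  fixes y :: "real \<Rightarrow> real" and T :: real
  assumes T: "T \<ge> 0" and cont: "continuous_on {0..T} y"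
    and pos: "\<And>t. 0 \<le> t \<Longrightarrow> t \<le> T \<Longrightarrow> y t > 0"
begin

lemma elapsed_derivative:
  "0 \<le> t \<Longrightarrow> t \<le> T \<Longrightarrow> (elapsed y has_real_derivative 1 / y t) (at t within {0..T})"
  unfolding elapsed_def[abs_def]
  by (rule integral_has_real_derivative) (use pos in \<open>force intro!: continuous_intros cont\<close>)+

lemma elapsed_0: "elapsed y 0 = 0"
  by (simp add: elapsed_def)

lemma continuous_elapsed: "continuous_on {0..T} (elapsed y)"
  by (rule DERIV_continuous_on) (use elapsed_derivative in auto)

lemma continuous_rate: "continuous_on {0..T} (rate y)"
  unfolding rate_def by (intro continuous_intros cont continuous_elapsed)

lemma rate_pos: "0 \<le> t \<Longrightarrow> t \<le> T \<Longrightarrow> rate y t > 0"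
  by (simp add: rate_def pos)

lemma elapsed_derivative_at: "0 < t \<Longrightarrow> t < T \<Longrightarrow> (elapsed y has_real_derivative 1 / y t) (at t)"
  using elapsed_derivative[of t] by (simp add: at_within_Icc_at)

lemma elapsed_right_quotient:
  assumes "0 \<le> s" "s < T"
  shows "((\<lambda>t. (exp (elapsed y t) - exp (elapsed y s)) / (t - s)) \<longlongrightarrow> exp (elapsed y s) / y s) (at_right s)"
proof -
  have "((\<lambda>t. exp (elapsed y t)) has_real_derivative exp (elapsed y s) * (1 / y s)) (at s within {s..T})"
    using assms by (intro DERIV_exp[THEN DERIV_chain2] DERIV_subset[OF elapsed_derivative]) auto
  then show ?thesis
    using assms by (simp add: has_field_derivative_iff at_within_Icc_at_right)
qed

lemma right_limits:
  assumes "0 \<le> s" "s < T"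
  shows "(y \<longlongrightarrow> y s) (at_right s)" "(elapsed y \<longlongrightarrow> elapsed y s) (at_right s)"
proof -
  have "(f \<longlongrightarrow> f s) (at_right s)" if "continuous_on {0..T} f" for f :: "real \<Rightarrow> real"
    by (rule continuous_on_at_right[OF that assms])
  then show "(y \<longlongrightarrow> y s) (at_right s)" "(elapsed y \<longlongrightarrow> elapsed y s) (at_right s)"
    using cont continuous_elapsed by auto
qed

end

lemma rate_mono_imp_profile_mono:
  assumes "positive_profile y1 T" "positive_profile y2 T"
    and le: "\<And>t. 0 \<le> t \<Longrightarrow> t \<le> T \<Longrightarrow> rate y2 t \<le> rate y1 t"
  shows "y2 T \<le> y1 T"
proof -
  interpret p1: positive_profile y1 T by fact
  interpret p2: positive_profile y2 T by fact
  let ?D = "\<lambda>t. exp (- elapsed y1 t) - exp (- elapsed y2 t)"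
  have "?D 0 \<le> ?D T"
  proof (rule DERIV_nonneg_imp_increasing_open[OF p1.T])
    show "continuous_on {0..T} ?D"
      by (intro continuous_intros p1.continuous_elapsed p2.continuous_elapsed)
    fix t assume t: "0 < t" "t < T"
    have "(?D has_real_derivative exp (- elapsed y1 t) * - (1 / y1 t) - exp (- elapsed y2 t) * - (1 / y2 t)) (at t)"
      by (intro DERIV_diff DERIV_exp[THEN DERIV_chain2] DERIV_minus p1.elapsed_derivative_at p2.elapsed_derivative_at t)
    moreover have "exp (- elapsed y1 t) * - (1 / y1 t) - exp (- elapsed y2 t) * - (1 / y2 t) = 1 / rate y2 t - 1 / rate y1 t"
      by (simp add: rate_def exp_minus divide_inverse)
    moreover have "1 / rate y1 t \<le> 1 / rate y2 t"
      using le[of t] p1.rate_pos[of t] p2.rate_pos[of t] t by (intro divide_left_mono) simp_all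
    ultimately show "\<exists>d. (?D has_real_derivative d) (at t) \<and> d \<ge> 0" by (intro exI conjI) auto
  qed
  then have X: "exp (- elapsed y2 T) \<le> exp (- elapsed y1 T)" by (simp add: p1.elapsed_0 p2.elapsed_0)
  have eq: "y T = rate y T * exp (- elapsed y T)" for y by (simp add: rate_def exp_minus)
  show ?thesis
    unfolding eq[of y1] eq[of y2]
    using le[of T] X p1.T p2.rate_pos[of T] p1.rate_pos[of T] by (intro mult_mono) simp_all
qed

section \<open>Stopped solutions\<close>

lemma stopped_solution_profile:
  assumes "stopped_solution F u" "T \<ge> 0" "\<And>s. 0 \<le> s \<Longrightarrow> s \<le> T \<Longrightarrow> u s < 1"
  shows "positive_profile (\<lambda>t. 1 - u t) T"
proof
  have "continuous_on {0..} u" using assms(1) unfolding stopped_solution_def by (elim conjE)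
  then have "continuous_on {0..T} u" by (rule continuous_on_subset) auto
  then show "continuous_on {0..T} (\<lambda>t. 1 - u t)" by (intro continuous_intros)
qed (use assms(2,3) in auto)

text \<open>In the product rule the derivative 1 / y of \<open>elapsed\<close> cancels the factor y,
  so only 1 - F times the exponential remains.\<close>

lemma stopped_solution_rate_derivative:
  assumes u: "stopped_solution F u" and lt: "T \<ge> 0" "\<And>s. 0 \<le> s \<Longrightarrow> s \<le> T \<Longrightarrow> u s < 1"
    and t: "0 \<le> t" "t \<le> T"
  shows "(rate (\<lambda>t. 1 - u t) has_real_derivative
     (1 - F t (u t) (exp (- elapsed (\<lambda>t. 1 - u t) t))) * exp (elapsed (\<lambda>t. 1 - u t) t)) (at t within {0..T})"
proof -
  let ?y = "\<lambda>t. 1 - u t" and ?F = "F t (u t) (exp (- elapsed (\<lambda>t. 1 - u t) t))"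
  interpret positive_profile ?y T by (rule stopped_solution_profile[OF u lt])
  have "\<forall>t\<ge>0. (\<forall>s\<in>{0..t}. u s < 1) \<longrightarrow>
      (u has_real_derivative F t (u t) (exp (- elapsed ?y t))) (at t within {0..})"
    using u unfolding stopped_solution_def elapsed_def by (elim conjE)
  moreover have "\<forall>s\<in>{0..t}. u s < 1" using lt(2) t by simp
  ultimately have "(u has_real_derivative ?F) (at t within {0..})" using t(1) by blast
  then have "(u has_real_derivative ?F) (at t within {0..T})"
    by (rule DERIV_subset) auto
  from DERIV_mult[OF DERIV_diff[OF DERIV_const this] DERIV_chain2[OF DERIV_exp elapsed_derivative[OF t]]]
  have "(rate ?y has_real_derivative (0 - ?F) * exp (elapsed ?y t) + exp (elapsed ?y t) * (1 / ?y t) * ?y t) (at t within {0..T})"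
    unfolding rate_def[abs_def] .
  moreover have "(0 - ?F) * exp (elapsed ?y t) + exp (elapsed ?y t) * (1 / ?y t) * ?y t = (1 - ?F) * exp (elapsed ?y t)"
    using pos[OF t] by (simp add: left_diff_distrib)
  ultimately show ?thesis by simp
qed

lemma stopped_solution_rate_0: "stopped_solution F u \<Longrightarrow> rate (\<lambda>t. 1 - u t) 0 = 1"
  by (simp add: stopped_solution_def rate_def elapsed_def)

lemma upper_rate:
  assumes u: "stopped_solution (upper_rhs c) u" and lt: "T \<ge> 0" "\<And>s. 0 \<le> s \<Longrightarrow> s \<le> T \<Longrightarrow> u s < 1"
  shows "rate (\<lambda>t. 1 - u t) T = 1 - c * T"
proof (cases "T = 0")
  case True
  then show ?thesis using stopped_solution_rate_0[OF u] by simp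
next
  case False
  let ?h = "rate (\<lambda>t. 1 - u t)"
  interpret positive_profile "\<lambda>t. 1 - u t" T by (rule stopped_solution_profile[OF u lt])
  have "(?h has_real_derivative - c) (at t within {0..T})" if "0 \<le> t" "t \<le> T" for t
    using stopped_solution_rate_derivative[OF u lt that] by (simp add: upper_rhs_def mult.assoc flip: exp_add)
  then have "(?h has_real_derivative - c) (at t)" if "0 < t" "t < T" for t
    using that by (simp add: at_within_Icc_at[symmetric])
  from DERIV_add[OF this DERIV_cmult[OF DERIV_ident, of c]]
  have "((\<lambda>t. ?h t + c * t) has_real_derivative 0) (at t)" if "0 < t" "t < T" for t
    using that by simp
  moreover have "continuous_on {0..T} (\<lambda>t. ?h t + c * t)"
    by (intro continuous_intros continuous_rate)
  ultimately have "?h T + c * T = ?h 0 + c * 0"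
    using False T by (intro DERIV_isconst_end) auto
  then show ?thesis using stopped_solution_rate_0[OF u] by simp
qed

lemma lower_rate_derivative:
  assumes u: "stopped_solution (lower_rhs c) u" and lt: "T \<ge> 0" "\<And>s. 0 \<le> s \<Longrightarrow> s \<le> T \<Longrightarrow> u s < 1"
    and t: "0 \<le> t" "t \<le> T"
  shows "(rate (\<lambda>t. 1 - u t) has_real_derivative - c + 3 * c\<^sup>2 * t / rate (\<lambda>t. 1 - u t) t) (at t within {0..T})"
proof -
  interpret positive_profile "\<lambda>t. 1 - u t" T by (rule stopped_solution_profile[OF u lt])
  let ?e = "exp (elapsed (\<lambda>t. 1 - u t) t)"
  have alg: "(1 - (1 + c * (1 - 3 * c * t / v * inverse e) * inverse e)) * e = - c + 3 * c\<^sup>2 * t / (v * e)"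
    if "e > 0" "v > 0" for e v :: real
  proof -
    have "(1 - (1 + c * (1 - w * i) * i)) * e = - c * (1 - w * i) * (i * e)" for w i
      by (simp add: algebra_simps)
    from this[of "3 * c * t / v" "inverse e"]
    have "(1 - (1 + c * (1 - 3 * c * t / v * inverse e) * inverse e)) * e = - c * (1 - 3 * c * t / v * inverse e)"
      using that by simp
    also have "\<dots> = - c + 3 * c\<^sup>2 * t / (v * e)"
      by (simp add: power2_eq_square right_diff_distrib divide_inverse)
    finally show ?thesis .
  qed
  have "(1 - lower_rhs c t (u t) (exp (- elapsed (\<lambda>t. 1 - u t) t))) * ?e = - c + 3 * c\<^sup>2 * t / rate (\<lambda>t. 1 - u t) t"
    unfolding lower_rhs_def rate_def exp_minus by (rule alg) (use pos[OF t] in simp_all)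
  then show ?thesis using stopped_solution_rate_derivative[OF u lt t] by simp
qed

lemma continuous_first_one:
  fixes u :: "real \<Rightarrow> real"
  assumes cont: "continuous_on {0..t} u" and u0: "u 0 = 0" and ge: "\<exists>s\<in>{0..t}. u s \<ge> 1"
  obtains t1 where "0 < t1" "t1 \<le> t" "u t1 = 1" "\<And>s. 0 \<le> s \<Longrightarrow> s < t1 \<Longrightarrow> u s < 1"
proof -
  let ?S = "{0..t} \<inter> u -` {1..}"
  have "closed ?S" by (rule continuous_closed_preimage[OF cont]) simp_all
  then have "compact ?S" by (auto intro: bounded_subset[of "{0..t}"] simp: compact_eq_bounded_closed)
  moreover have "?S \<noteq> {}" using ge by auto
  ultimately obtain t1 where t1: "t1 \<in> ?S" "\<And>s. s \<in> ?S \<Longrightarrow> t1 \<le> s"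
    using compact_attains_inf[of ?S] by blast
  have t10: "0 < t1" using t1(1) u0 by (cases "t1 = 0") auto
  have lt: "u s < 1" if "0 \<le> s" "s < t1" for s
    using t1(2)[of s] t1(1) that by force
  have "u t1 \<le> 1"
    using t10 lt t1(1) by (intro continuous_on_le_endpoint[of 0 t1 u] continuous_on_subset[OF cont]) (auto intro: less_imp_le)
  with t1 t10 lt that show ?thesis by auto
qed

text \<open>Trades the integral in the equation for a second unknown: the equation for
  \<open>X\<close> says that \<open>- ln X\<close> is an antiderivative of 1 / (1 - g), so
  \<open>X\<close> is the exponential that \<open>F\<close> receives.\<close>

lemma stopped_solution_construct:
  assumes \<tau>: "\<tau> > 0" and g: "continuous_on {0..\<tau>} g" "g 0 = 0" "g \<tau> = 1"
    and lt: "\<And>t. 0 \<le> t \<Longrightarrow> t < \<tau> \<Longrightarrow> g t < 1"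
    and X: "X 0 = 1" "\<And>t. 0 \<le> t \<Longrightarrow> t < \<tau> \<Longrightarrow> X t > 0"
      "\<And>t. 0 \<le> t \<Longrightarrow> t < \<tau> \<Longrightarrow> (X has_real_derivative - (X t / (1 - g t))) (at t)"
    and der: "\<And>t. 0 \<le> t \<Longrightarrow> t < \<tau> \<Longrightarrow> (g has_real_derivative F t (g t) (X t)) (at t)"
  shows "stopped_solution F (\<lambda>t. g (min t \<tau>))"
  unfolding stopped_solution_def
proof (intro conjI allI impI)
  show "g (min 0 \<tau>) = 0" using \<tau> g by simp
  show "continuous_on {0..} (\<lambda>t. g (min t \<tau>))"
    using \<tau> by (intro continuous_on_compose2[OF g(1)] continuous_intros) auto
  fix t :: real assume t: "0 \<le> t"
  show "g (min t \<tau>) = 1" if "\<exists>s\<in>{0..t}. g (min s \<tau>) = 1"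
  proof -
    from that obtain s where s: "0 \<le> s" "s \<le> t" "g (min s \<tau>) = 1" by auto
    then have "s \<ge> \<tau>" using lt[of s] by (cases "s < \<tau>") auto
    then show ?thesis using s g by simp
  qed
  assume "\<forall>s\<in>{0..t}. g (min s \<tau>) < 1"
  then have "g (min t \<tau>) < 1" using t by simp
  then have t\<tau>: "t < \<tau>" using g(3) by (cases "t < \<tau>") simp_all
  have "((\<lambda>s. 1 / (1 - g (min s \<tau>))) has_integral (- ln (X t)) - (- ln (X 0))) {0..t}"
  proof (rule fundamental_theorem_of_calculus[OF t])
    fix s assume s: "s \<in> {0..t}"
    then have s': "0 \<le> s" "s < \<tau>" using t\<tau> by auto
    have "((\<lambda>s. - ln (X s)) has_real_derivative - (1 / X s * - (X s / (1 - g s)))) (at s)"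
      by (rule DERIV_minus[OF DERIV_chain2[OF DERIV_ln_divide[OF X(2)[OF s']] X(3)[OF s']]])
    moreover have "- (1 / X s * - (X s / (1 - g s))) = 1 / (1 - g (min s \<tau>))"
      using X(2)[OF s'] s' by simp
    ultimately show "((\<lambda>s. - ln (X s)) has_vector_derivative 1 / (1 - g (min s \<tau>))) (at s within {0..t})"
      by (simp add: has_real_derivative_iff_has_vector_derivative[symmetric] has_field_derivative_at_within)
  qed
  then have "integral {0..t} (\<lambda>s. 1 / (1 - g (min s \<tau>))) = - ln (X t)"
    using X(1) by (simp add: integral_unique)
  then have eX: "exp (- integral {0..t} (\<lambda>s. 1 / (1 - g (min s \<tau>)))) = X t"
    using X(2)[OF t t\<tau>] by simp
  have "(g has_real_derivative F t (g t) (X t)) (at t within {0..})"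
    by (rule has_field_derivative_at_within[OF der[OF t t\<tau>]])
  then have "((\<lambda>t. g (min t \<tau>)) has_real_derivative F t (g t) (X t)) (at t within {0..})"
    by (rule has_field_derivative_transform_within[where d = "\<tau> - t"]) (use t t\<tau> in \<open>auto simp: dist_real_def\<close>)
  then show "((\<lambda>t. g (min t \<tau>)) has_real_derivative
      F t (g (min t \<tau>)) (exp (- integral {0..t} (\<lambda>s. 1 / (1 - g (min s \<tau>)))))) (at t within {0..})"
    unfolding eX using t\<tau> by simp
qed

section \<open>Explicit solutions\<close>

lemma stopped_solution_0: "stopped_solution F u \<Longrightarrow> u 0 = 0"
  unfolding stopped_solution_def by (elim conjE)

lemma stopped_solution_continuous: "stopped_solution F u \<Longrightarrow> continuous_on {0..} u"
  unfolding stopped_solution_def by (elim conjE)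

text \<open>From h = 1 - c t one gets X' = - 1 / (1 - c t), hence X = 1 + ln (1 - c t) / c, and 1 -
  h X is the stated formula. The end point \<open>\<tau>\<close> is the zero of X, reached while 1 -
  c t is still exp (- c).\<close>

lemma upper_solution_eq:
  assumes c: "c > 0"
  defines "g \<equiv> \<lambda>t. c * t + (t - 1 / c) * ln (1 - c * t)" and "\<tau> \<equiv> (1 - exp (- c)) / c"
  shows "stopped_solution (upper_rhs c) (\<lambda>t. g (min t \<tau>))" "upper_explicit c = (\<lambda>t. g (min t \<tau>))"
proof -
  let ?X = "\<lambda>t. 1 + ln (1 - c * t) / c"
  have \<tau>: "\<tau> > 0" using c by (simp add: \<tau>_def)
  have c\<tau>: "1 - c * \<tau> = exp (- c)" using c by (simp add: \<tau>_def)
  have pos: "1 - c * t \<ge> exp (- c)" if "t \<le> \<tau>" for t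
  proof -
    have "c * t \<le> c * \<tau>" using that c by (intro mult_left_mono) simp_all
    then show ?thesis using c\<tau> by linarith
  qed
  have pos': "1 - c * t > 0" if "t \<le> \<tau>" for t
    using pos[OF that] exp_gt_zero[of "- c"] by linarith
  have g: "1 - g t = (1 - c * t) * ?X t" if "t \<le> \<tau>" for t
    using c by (simp add: g_def field_simps)
  have X: "?X t > 0" if "t < \<tau>" for t
  proof -
    have "exp (- c) < 1 - c * t" using mult_strict_left_mono[OF that c] c\<tau> by linarith
    then have "ln (exp (- c)) < ln (1 - c * t)" by (subst ln_less_cancel_iff) (use pos'[of t] that in simp_all)
    then show ?thesis using c by (simp add: field_simps)
  qed
  have lt: "g t < 1" if "t < \<tau>" for t
    using g[of t] mult_pos_pos[OF pos'[of t] X[OF that]] that by simp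
  have g\<tau>: "g \<tau> = 1" using g[of \<tau>] c by (simp add: c\<tau>)
  have g0: "g 0 = 0" by (simp add: g_def)
  show "stopped_solution (upper_rhs c) (\<lambda>t. g (min t \<tau>))"
  proof (rule stopped_solution_construct[OF \<tau> _ g0 g\<tau> lt, where X = ?X])
    show "continuous_on {0..\<tau>} g"
      unfolding g_def by (intro continuous_intros) (use pos' in force)
    show "?X 0 = 1" by simp
    fix t assume t: "0 \<le> t" "t < \<tau>"
    have p: "1 - c * t > 0" using pos'[of t] t by simp
    have D1: "((\<lambda>t. c * t) has_real_derivative c) (at t)" using DERIV_cmult[OF DERIV_ident, of c] by simp
    have "((\<lambda>t. 1 - c * t) has_real_derivative 0 - c) (at t)" by (rule DERIV_diff[OF DERIV_const D1])
    from DERIV_chain2[OF DERIV_ln_divide[OF p] this]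
    have D: "((\<lambda>t. ln (1 - c * t)) has_real_derivative 1 / (1 - c * t) * (0 - c)) (at t)" .
    show "?X t > 0" by (rule X[OF t(2)])
    have "(?X has_real_derivative 0 + (1 / (1 - c * t) * (0 - c)) / c) (at t)"
      by (rule DERIV_add[OF DERIV_const DERIV_cdivide[OF D]])
    moreover have "0 + (1 / (1 - c * t) * (0 - c)) / c = - (?X t / (1 - g t))"
      using g[of t] X[OF t(2)] t c by simp
    ultimately show "(?X has_real_derivative - (?X t / (1 - g t))) (at t)" by simp
    have D2: "((\<lambda>t. t - 1 / c) has_real_derivative 1 - 0) (at t)" by (rule DERIV_diff[OF DERIV_ident DERIV_const])
    have "(g has_real_derivative c + ((1 - 0) * ln (1 - c * t) + 1 / (1 - c * t) * (0 - c) * (t - 1 / c))) (at t)"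
      unfolding g_def by (rule DERIV_add[OF D1 DERIV_mult[OF D2 D]])
    moreover have "c + ((1 - 0) * ln (1 - c * t) + 1 / (1 - c * t) * (0 - c) * (t - 1 / c)) = upper_rhs c t (g t) (?X t)"
    proof -
      have "(0 - c) * (t - 1 / c) = 1 - c * t" using c by (simp add: field_simps)
      then have "1 / (1 - c * t) * (0 - c) * (t - 1 / c) = 1" using p by (simp only: mult.assoc) simp
      then show ?thesis using c by (simp add: upper_rhs_def field_simps)
    qed
    ultimately show "(g has_real_derivative upper_rhs c t (g t) (?X t)) (at t)" by simp
  qed
  have "(\<exists>s\<in>{0..t}. g s = 1) \<longleftrightarrow> \<tau> \<le> t" for t
  proof
    assume "\<exists>s\<in>{0..t}. g s = 1"
    then obtain s where "s \<le> t" "g s = 1" by auto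
    then show "\<tau> \<le> t" using lt[of s] by (cases "s < \<tau>") auto
  next
    assume "\<tau> \<le> t"
    then show "\<exists>s\<in>{0..t}. g s = 1" using g\<tau> \<tau> by (intro bexI[of _ \<tau>]) auto
  qed
  then show "upper_explicit c = (\<lambda>t. g (min t \<tau>))"
    unfolding upper_explicit_def stop_at_one_def g_def[symmetric] by (auto simp: g\<tau> fun_eq_iff min_def)
qed

text \<open>With \<open>X\<close> as independent variable, the time \<open>t\<close> at which \<open>exp (- \<integral> 1 / (1 - l)) = X\<close> solves the
  linear equation \<open>t'' = c t' + 3 c\<^sup>2 t\<close>, with \<open>t = 0\<close> and \<open>t' = - 1\<close> at \<open>X = 1\<close>.\<close>

lemma lower_solution_exists:
  assumes c: "c > 0"
  shows "\<exists>l. stopped_solution (lower_rhs c) l"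
proof -
  \<comment> \<open>\<open>\<alpha>\<close> and \<open>\<beta>\<close> are the roots of x^2 = c x +
    3 c^2, the characteristic equation.\<close>
  define \<alpha> where "\<alpha> = c * (1 + sqrt 13) / 2"
  define \<beta> where "\<beta> = c * (1 - sqrt 13) / 2"
  have sq: "sqrt 13 > 1" by simp
  have \<alpha>: "\<alpha> > 0" using c sq by (simp add: \<alpha>_def add_pos_pos)
  have \<beta>: "\<beta> < 0" using c sq by (simp add: \<beta>_def mult_pos_neg)
  have root: "(c * k / 2)\<^sup>2 = c * (c * k / 2) + 3 * c\<^sup>2" if "k * k = 2 * k + 12" for k
  proof -
    have "(c * k / 2)\<^sup>2 = c\<^sup>2 * (k * k) / 4" by (simp add: power2_eq_square)
    then show ?thesis unfolding that by (simp add: power2_eq_square algebra_simps)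
  qed
  have root\<alpha>: "\<alpha>\<^sup>2 = c * \<alpha> + 3 * c\<^sup>2" unfolding \<alpha>_def by (rule root) (simp add: algebra_simps)
  have root\<beta>: "\<beta>\<^sup>2 = c * \<beta> + 3 * c\<^sup>2" unfolding \<beta>_def by (rule root) (simp add: algebra_simps)
  define d where "d = \<alpha> - \<beta>"
  have d: "d > 0" using \<alpha> \<beta> by (simp add: d_def)
  define A where "A x = exp (\<alpha> * (x - 1))" for x
  define B where "B x = exp (\<beta> * (x - 1))" for x
  have A0: "A x > 0" and B0: "B x > 0" for x by (simp_all add: A_def B_def)
  have E: "((\<lambda>x. exp (k * (x - 1))) has_real_derivative k * exp (k * (x - 1))) (at x)" for k x :: real
    by (auto intro!: derivative_eq_intros)
  have DA: "(A has_real_derivative \<alpha> * A x) (at x)" for x using E[of \<alpha> x] by (simp add: A_def[abs_def])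
  have DB: "(B has_real_derivative \<beta> * B x) (at x)" for x using E[of \<beta> x] by (simp add: B_def[abs_def])
  \<comment> \<open>The time as a function of X, with \<open>\<phi> 1 = 0\<close> and derivative
    \<open>\<psi> 1 = - 1\<close>. As X' = - 1 / h, the quotient h is
    \<open>- \<psi> (X t)\<close>.\<close>
  define \<phi> where "\<phi> x = (B x - A x) / d" for x
  define \<psi> where "\<psi> x = (\<beta> * B x - \<alpha> * A x) / d" for x
  have D\<phi>: "(\<phi> has_real_derivative \<psi> x) (at x)" for x
    unfolding \<phi>_def[abs_def] \<psi>_def by (rule DERIV_cdivide[OF DERIV_diff[OF DB DA]])
  have D\<psi>: "(\<psi> has_real_derivative c * \<psi> x + 3 * c\<^sup>2 * \<phi> x) (at x)" for x
  proof -
    have "(\<psi> has_real_derivative (\<beta> * (\<beta> * B x) - \<alpha> * (\<alpha> * A x)) / d) (at x)"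
      unfolding \<psi>_def[abs_def] by (rule DERIV_cdivide[OF DERIV_diff[OF DERIV_cmult[OF DB] DERIV_cmult[OF DA]]])
    moreover have "\<beta> * (\<beta> * B x) - \<alpha> * (\<alpha> * A x) = c * (\<beta> * B x - \<alpha> * A x) + 3 * c\<^sup>2 * (B x - A x)"
    proof -
      have "\<beta> * (\<beta> * B x) - \<alpha> * (\<alpha> * A x) = \<beta>\<^sup>2 * B x - \<alpha>\<^sup>2 * A x" by (simp add: power2_eq_square)
      then show ?thesis by (simp add: root\<alpha> root\<beta> algebra_simps)
    qed
    ultimately show ?thesis by (simp add: \<phi>_def \<psi>_def add_divide_distrib)
  qed
  have \<psi>neg: "\<psi> x < 0" for x
    unfolding \<psi>_def using mult_neg_pos[OF \<beta> B0[of x]] mult_pos_pos[OF \<alpha> A0[of x]] d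
    by (intro divide_neg_pos) linarith+
  have anti: "\<phi> b < \<phi> a" if "a < b" for a b
    by (rule DERIV_neg_imp_decreasing[OF that]) (use D\<phi> \<psi>neg in blast)
  have inj: "inj \<phi>"
  proof (rule injI)
    fix a b assume "\<phi> a = \<phi> b"
    then show "a = b" using anti[of a b] anti[of b a] by (cases a b rule: linorder_cases) auto
  qed
  have cont: "isCont \<phi> x" for x using D\<phi> by (rule DERIV_isCont)
  define X where "X = inv \<phi>"
  have X\<phi>: "X (\<phi> x) = x" for x unfolding X_def by (rule inv_f_f[OF inj])
  \<comment> \<open>X runs through \<open>{0..1}\<close>; the larger interval from - 1 to 2 makes
    the end points interior, so that the inverse function has two-sided derivatives there.\<close>
  have surj: "\<exists>x. \<phi> x = t \<and> - 1 \<le> x \<and> x \<le> 2" if "\<phi> 2 \<le> t" "t \<le> \<phi> (- 1)" for t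
    using IVT2[of \<phi> 2 t "- 1"] that cont by auto
  have \<phi>X: "\<phi> (X t) = t" if "\<phi> 2 \<le> t" "t \<le> \<phi> (- 1)" for t
    using surj[OF that] X\<phi> by auto
  have \<phi>1: "\<phi> 1 = 0" by (simp add: \<phi>_def A_def B_def)
  define \<tau> where "\<tau> = \<phi> 0"
  have \<tau>: "\<tau> > 0" using anti[of 0 1] \<phi>1 by (simp add: \<tau>_def)
  have range: "\<phi> 2 < t" "t < \<phi> (- 1)" if "0 \<le> t" "t \<le> \<tau>" for t
    using anti[of 1 2] anti[of "- 1" 0] \<phi>1 that by (simp_all add: \<tau>_def)
  have contX: "isCont X t" if "0 \<le> t" "t \<le> \<tau>" for t
  proof -
    have "isCont X (\<phi> (X t))" by (rule isCont_inverse_function[of 1]) (simp_all add: X\<phi> cont)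
    then show ?thesis using \<phi>X range[OF that] by simp
  qed
  have DX: "(X has_real_derivative inverse (\<psi> (X t))) (at t)" if "0 \<le> t" "t \<le> \<tau>" for t
    by (rule DERIV_inverse_function[OF D\<phi> _ range[OF that] _ contX[OF that]])
      (use \<psi>neg[of "X t"] \<phi>X in auto)
  have Xpos: "X t > 0" if "0 \<le> t" "t < \<tau>" for t
  proof (rule ccontr)
    assume "\<not> X t > 0"
    then have "\<phi> (X t) \<ge> \<tau>" using anti[of "X t" 0] by (cases "X t = 0") (auto simp: \<tau>_def)
    then show False using \<phi>X[of t] range[of t] that by simp
  qed
  \<comment> \<open>This is 1 - h X.\<close>
  define g where "g t = 1 + X t * \<psi> (X t)" for t
  have "stopped_solution (lower_rhs c) (\<lambda>t. g (min t \<tau>))"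
  proof (rule stopped_solution_construct[OF \<tau>, where X = X])
    have X0: "X 0 = 1" using X\<phi>[of 1] \<phi>1 by simp
    have X\<tau>: "X \<tau> = 0" using X\<phi>[of 0] by (simp add: \<tau>_def)
    show "X 0 = 1" by (rule X0)
    show "g 0 = 0" using d by (simp add: g_def X0 \<psi>_def A_def B_def d_def divide_eq_minus_1_iff field_simps)
    show "g \<tau> = 1" by (simp add: g_def X\<tau>)
    show "continuous_on {0..\<tau>} g"
    proof (rule continuous_at_imp_continuous_on, rule ballI)
      fix t assume "t \<in> {0..\<tau>}"
      then have cX: "isCont X t" using contX by simp
      show "isCont g t" unfolding g_def[abs_def]
        by (intro isCont_add isCont_mult continuous_const cX isCont_o2[OF cX DERIV_isCont[OF D\<psi>]])
    qed
    fix t assume t: "0 \<le> t" "t < \<tau>"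
    have p: "X t > 0" by (rule Xpos[OF t])
    then show "X t > 0" .
    have m: "X t * \<psi> (X t) < 0" using p \<psi>neg by (rule mult_pos_neg)
    then show "g t < 1" by (simp add: g_def)
    have "inverse (\<psi> (X t)) = - (X t / (1 - g t))" using p by (simp add: g_def divide_inverse)
    then show "(X has_real_derivative - (X t / (1 - g t))) (at t)" using DX[of t] t by simp
    have \<phi>t: "\<phi> (X t) = t" using \<phi>X range[of t] t by simp
    have "(g has_real_derivative 0 + (inverse (\<psi> (X t)) * \<psi> (X t) + (c * \<psi> (X t) + 3 * c\<^sup>2 * \<phi> (X t)) * inverse (\<psi> (X t)) * X t)) (at t)"
      unfolding g_def[abs_def]
      by (rule DERIV_add[OF DERIV_const DERIV_mult[OF DX DERIV_chain2[OF D\<psi> DX]]]) (use t in simp_all)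
    moreover have "0 + (inverse p * p + (c * p + 3 * c\<^sup>2 * t) * inverse p * x) = 1 + c * (1 - 3 * c * t / - (x * p) * x) * x"
      if "p < 0" "x > 0" for p x :: real
      using that by (simp add: power2_eq_square field_simps)
    ultimately show "(g has_real_derivative lower_rhs c t (g t) (X t)) (at t)"
      using \<psi>neg[of "X t"] p by (simp add: lower_rhs_def g_def \<phi>t)
  qed
  then show ?thesis by blast
qed

section \<open>Uniqueness for the upper equation\<close>

lemma upper_solution_le:
  assumes u: "stopped_solution (upper_rhs c) u" "stopped_solution (upper_rhs c) v"
    and T: "T \<ge> 0" "\<And>s. 0 \<le> s \<Longrightarrow> s \<le> T \<Longrightarrow> u s < 1" "\<And>s. 0 \<le> s \<Longrightarrow> s \<le> T \<Longrightarrow> v s < 1"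
  shows "u T \<le> v T"
proof -
  have "1 - v T \<le> 1 - u T"
  proof (rule rate_mono_imp_profile_mono[of "\<lambda>t. 1 - u t" T "\<lambda>t. 1 - v t"])
    show "positive_profile (\<lambda>t. 1 - u t) T" "positive_profile (\<lambda>t. 1 - v t) T"
      using u T by (auto intro: stopped_solution_profile)
    fix t assume t: "0 \<le> t" "t \<le> T"
    have "rate (\<lambda>t. 1 - v t) t = 1 - c * t" "rate (\<lambda>t. 1 - u t) t = 1 - c * t"
      using t T by (auto intro!: upper_rate u)
    then show "rate (\<lambda>t. 1 - v t) t \<le> rate (\<lambda>t. 1 - u t) t" by simp
  qed
  then show ?thesis by simp
qed

text \<open>By continuity a value of at least 1 is reached only through 1 itself, after which the
  solution is frozen.\<close>

lemma stopped_solution_eq_1: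
  assumes u: "stopped_solution F u" and t: "0 \<le> t" and s: "\<exists>s\<in>{0..t}. u s \<ge> 1"
  shows "u t = 1"
proof -
  note cont = stopped_solution_continuous[OF u] and u0 = stopped_solution_0[OF u]
  have "continuous_on {0..t} u" using cont by (rule continuous_on_subset) auto
  from continuous_first_one[OF this u0 s] obtain t1 where "0 < t1" "t1 \<le> t" "u t1 = 1" by blast
  then have "\<exists>s\<in>{0..t}. u s = 1" by (intro bexI[of _ t1]) simp_all
  moreover have "\<forall>t\<ge>0. (\<exists>s\<in>{0..t}. u s = 1) \<longrightarrow> u t = 1"
    using u unfolding stopped_solution_def by (elim conjE)
  ultimately show ?thesis using t by blast
qed

text \<open>Before the first time at which \<open>u\<close> equals 1 the comparison gives
  \<open>u \<le> v\<close>; by continuity this would force \<open>v \<ge> 1\<close> at that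
  time.\<close>

lemma upper_solution_lt_1:
  assumes u: "stopped_solution (upper_rhs c) u" "stopped_solution (upper_rhs c) v"
    and T: "\<And>s. 0 \<le> s \<Longrightarrow> s \<le> T \<Longrightarrow> v s < 1" and s: "0 \<le> s" "s \<le> T"
  shows "u s < 1"
proof (rule ccontr)
  assume "\<not> u s < 1"
  then have ex: "\<exists>s\<in>{0..T}. u s \<ge> 1" using s by (intro bexI[of _ s]) auto
  note cont = stopped_solution_continuous[OF u(1)] stopped_solution_continuous[OF u(2)]
    and u0 = stopped_solution_0[OF u(1)]
  have "continuous_on {0..T} u" using cont(1) by (rule continuous_on_subset) auto
  from continuous_first_one[OF this u0 ex] obtain t1 where t1: "0 < t1" "t1 \<le> T" "u t1 = 1"
    "\<And>s. 0 \<le> s \<Longrightarrow> s < t1 \<Longrightarrow> u s < 1" by blast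
  have "u t1 - v t1 \<le> 0"
  proof (rule continuous_on_le_endpoint[OF t1(1), of "\<lambda>t. u t - v t"])
    show "continuous_on {0..t1} (\<lambda>t. u t - v t)"
      by (intro continuous_intros continuous_on_subset[OF cont(1)] continuous_on_subset[OF cont(2)]) auto
    fix s assume "0 \<le> s" "s < t1"
    then have "u s \<le> v s" using t1 T by (intro upper_solution_le[OF u]) auto
    then show "u s - v s \<le> 0" by simp
  qed
  then show False using t1 T[of t1] by simp
qed

lemma upper_solution_unique:
  assumes u: "stopped_solution (upper_rhs c) u" "stopped_solution (upper_rhs c) v" and t: "t \<ge> 0"
  shows "u t = v t"
proof (cases "(\<forall>s\<in>{0..t}. u s < 1) \<or> (\<forall>s\<in>{0..t}. v s < 1)")
  case True
  then have "(\<forall>s\<in>{0..t}. u s < 1) \<and> (\<forall>s\<in>{0..t}. v s < 1)"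
    using upper_solution_lt_1[OF u, of t] upper_solution_lt_1[OF u(2,1), of t] by auto
  then show ?thesis
    using upper_solution_le[OF u t] upper_solution_le[OF u(2,1) t] by (intro antisym) auto
next
  case False
  then have "\<exists>s\<in>{0..t}. u s \<ge> 1" "\<exists>s\<in>{0..t}. v s \<ge> 1" by (auto simp: not_less)
  then show ?thesis using stopped_solution_eq_1[OF u(1) t] stopped_solution_eq_1[OF u(2) t] by simp
qed

section \<open>Comparison\<close>

context sequential_adsorption
begin

lemma I_eq_elapsed: "I = elapsed y"
  by (simp add: I_def elapsed_def fun_eq_iff)

lemma profile: "T \<ge> 0 \<Longrightarrow> y T > 0 \<Longrightarrow> positive_profile y T"
proof
  assume T: "T \<ge> 0" "y T > 0"
  show "T \<ge> 0" by (rule T)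
  show "continuous_on {0..T} y" by (rule continuous_on_subset[OF y_continuous]) auto
  show "y t > 0" if "0 \<le> t" "t \<le> T" for t using y_antimono[OF that] T by simp
qed

lemma rate_increment:
  "rate y t - rate y s = exp (I t) * (y t - y s) + y s * (exp (I t) - exp (I s))"
  by (simp add: rate_def I_eq_elapsed algebra_simps)

text \<open>Since \<open>y\<close> is not known to be differentiable, \<open>increment_le\<close> is
  inserted into the discrete product rule \<open>rate_increment\<close>, and only the resulting
  bound is passed to a limit.\<close>

lemma rate_ge:
  assumes T: "T \<ge> 0" "y T > 0"
  shows "1 - c * T \<le> rate y T"
proof -
  interpret positive_profile y T by (rule profile[OF assms])
  let ?f = "\<lambda>t. (1 - c * t) - rate y t"
  have "?f T \<le> 0"
  proof (rule right_derivative_nonpos_imp_nonpos[OF T(1), of ?f])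
    show "continuous_on {0..T} ?f" by (intro continuous_intros continuous_rate)
    show "?f 0 \<le> 0" by (simp add: rate_def elapsed_0 y_0)
    fix s assume s: "0 \<le> s" "s < T"
    have ys: "y s > 0" using pos s by simp
    \<comment> \<open>A bound for the right difference quotient of \<open>?f\<close>; in the limit
      both exp (I s) and c cancel and 0 is left.\<close>
    let ?R = "\<lambda>t. - c + exp (I t) * (1 + c * exp (- I s)) - y s * ((exp (I t) - exp (I s)) / (t - s))"
    have "(?R \<longlongrightarrow> - c + exp (I s) * (1 + c * exp (- I s)) - y s * (exp (I s) / y s)) (at_right s)"
      unfolding I_eq_elapsed by (intro tendsto_intros right_limits[OF s] elapsed_right_quotient[OF s])
    moreover have "- c + exp (I s) * (1 + c * exp (- I s)) - y s * (exp (I s) / y s) = 0"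
      using ys by (simp add: distrib_left exp_minus)
    moreover have "\<forall>\<^sub>F t in at_right s. ?f t - ?f s \<le> ?R t * (t - s)"
      unfolding eventually_at_right_field
    proof (intro exI[of _ T] conjI allI impI)
      show "s < T" by (rule s)
      fix t assume t: "s < t" "t < T"
      have "y s - y t \<le> (t - s) * (1 + c * exp (- I s))"
        using s t pos by (intro increment_le) simp_all
      from mult_left_mono[OF this, of "exp (I t)"]
      have "exp (I t) * (y t - y s) \<ge> - (exp (I t) * (1 + c * exp (- I s)) * (t - s))"
        by (simp add: algebra_simps)
      moreover have "y s * (exp (I t) - exp (I s)) = y s * ((exp (I t) - exp (I s)) / (t - s)) * (t - s)"
        using t by simp
      moreover have "?f t - ?f s = - c * (t - s) - (rate y t - rate y s)" by (simp add: algebra_simps)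
      ultimately have "?f t - ?f s \<le> - c * (t - s) + exp (I t) * (1 + c * exp (- I s)) * (t - s) -
          y s * ((exp (I t) - exp (I s)) / (t - s)) * (t - s)"
        unfolding rate_increment by linarith
      then show "?f t - ?f s \<le> ?R t * (t - s)" by (simp only: left_diff_distrib distrib_right)
    qed
    ultimately show "\<exists>R L. (R \<longlongrightarrow> L) (at_right s) \<and> L \<le> 0 \<and> (\<forall>\<^sub>F t in at_right s. ?f t - ?f s \<le> R t * (t - s))"
      by (intro exI[of _ ?R] exI[of _ 0]) simp
  qed
  then show ?thesis by simp
qed

lemma rate_le_lower:
  assumes T: "T \<ge> 0" "y T > 0" and l: "stopped_solution (lower_rhs c) l"
    and lt: "\<And>s. 0 \<le> s \<Longrightarrow> s \<le> T \<Longrightarrow> l s < 1"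
  shows "rate y T \<le> rate (\<lambda>t. 1 - l t) T"
proof -
  interpret positive_profile y T by (rule profile[OF T])
  interpret L: positive_profile "\<lambda>t. 1 - l t" T by (rule stopped_solution_profile[OF l T(1) lt])
  let ?h = "rate (\<lambda>t. 1 - l t)"
  let ?f = "\<lambda>t. rate y t - ?h t"
  have "?f T \<le> 0"
  proof (rule right_derivative_nonpos_imp_nonpos[OF T(1), of ?f])
    show "continuous_on {0..T} ?f" by (intro continuous_intros continuous_rate L.continuous_rate)
    show "?f 0 \<le> 0" using stopped_solution_rate_0[OF l] by (simp add: rate_def elapsed_0 y_0)
    fix s assume s: "0 \<le> s" "s < T" and ge: "?f s \<ge> 0"
    have ys: "y s > 0" using pos s by simp
    let ?A = "\<lambda>t. 1 + c * exp (- I t) - 3 * c\<^sup>2 * t / y t * exp (- 2 * I s)"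
    let ?R = "\<lambda>t. y s * ((exp (I t) - exp (I s)) / (t - s)) - exp (I t) * ?A t - (?h t - ?h s) / (t - s)"
    let ?d = "- c + 3 * c\<^sup>2 * s / ?h s"
    have "(?h has_real_derivative ?d) (at s within {s..T})"
      by (rule DERIV_subset[OF lower_rate_derivative[OF l T(1) lt]]) (use s in auto)
    then have h: "((\<lambda>t. (?h t - ?h s) / (t - s)) \<longlongrightarrow> ?d) (at_right s)"
      using s by (simp add: has_field_derivative_iff at_within_Icc_at_right)
    have "(?R \<longlongrightarrow> y s * (exp (I s) / y s) - exp (I s) * ?A s - ?d) (at_right s)"
      unfolding I_eq_elapsed using ys
      by (intro tendsto_intros right_limits[OF s] elapsed_right_quotient[OF s] h) simp
    moreover have "y s * (exp (I s) / y s) - exp (I s) * ?A s - ?d \<le> 0"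
    proof -
      have e: "exp (I s) * exp (- I s) = 1" "exp (I s) * exp (- 2 * I s) = exp (- I s)"
        by (simp_all add: exp_add[symmetric])
      have "exp (I s) * ?A s = exp (I s) + c * (exp (I s) * exp (- I s)) - 3 * c\<^sup>2 * s / y s * (exp (I s) * exp (- 2 * I s))"
        by (simp only: distrib_left right_diff_distrib mult.assoc mult.left_commute mult_1_right)
      also have "\<dots> = exp (I s) + c - 3 * c\<^sup>2 * s / rate y s"
        unfolding e by (simp add: rate_def I_eq_elapsed exp_minus divide_inverse)
      finally have "y s * (exp (I s) / y s) - exp (I s) * ?A s - ?d = 3 * c\<^sup>2 * s / rate y s - 3 * c\<^sup>2 * s / ?h s"
        using ys by simp
      \<comment> \<open>The term 3 c^2 s / h decreases in h, so the inequality points the right way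
        where \<open>rate y s \<ge> ?h s\<close>; hence the sign condition in the comparison
        principle.\<close>
      moreover have "3 * c\<^sup>2 * s / rate y s \<le> 3 * c\<^sup>2 * s / ?h s"
        using ge s rate_pos[of s] L.rate_pos[of s] by (intro divide_left_mono mult_pos_pos) simp_all
      ultimately show ?thesis by simp
    qed
    moreover have "\<forall>\<^sub>F t in at_right s. ?f t - ?f s \<le> ?R t * (t - s)"
      unfolding eventually_at_right_field
    proof (intro exI[of _ T] conjI allI impI)
      show "s < T" by (rule s)
      fix t assume t: "s < t" "t < T"
      have "(t - s) * ?A t \<le> y s - y t"
        using s t pos by (intro increment_ge) simp_all
      from mult_left_mono[OF this, of "exp (I t)"]
      have "exp (I t) * (y t - y s) \<le> - (exp (I t) * ?A t * (t - s))"
        by (simp add: algebra_simps)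
      moreover have "y s * (exp (I t) - exp (I s)) = y s * ((exp (I t) - exp (I s)) / (t - s)) * (t - s)"
        "?h t - ?h s = (?h t - ?h s) / (t - s) * (t - s)"
        using t by simp_all
      moreover have "?f t - ?f s = (rate y t - rate y s) - (?h t - ?h s)" by simp
      ultimately have "?f t - ?f s \<le> y s * ((exp (I t) - exp (I s)) / (t - s)) * (t - s) - exp (I t) * ?A t * (t - s) -
          (?h t - ?h s) / (t - s) * (t - s)"
        unfolding rate_increment by linarith
      then show "?f t - ?f s \<le> ?R t * (t - s)" by (simp only: left_diff_distrib)
    qed
    ultimately show "\<exists>R L. (R \<longlongrightarrow> L) (at_right s) \<and> L \<le> 0 \<and> (\<forall>\<^sub>F t in at_right s. ?f t - ?f s \<le> R t * (t - s))"
      by blast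
  qed
  then show ?thesis by simp
qed

lemma z_le_upper:
  assumes u: "stopped_solution (upper_rhs c) u" and t: "t \<ge> 0" "y t > 0"
  shows "z t \<le> u t"
proof (cases "\<forall>s\<in>{0..t}. u s < 1")
  case True
  have "1 - u t \<le> y t"
  proof (rule rate_mono_imp_profile_mono[of y t "\<lambda>t. 1 - u t"])
    show "positive_profile y t" by (rule profile[OF t])
    show "positive_profile (\<lambda>t. 1 - u t) t" by (rule stopped_solution_profile[OF u t(1)]) (use True in simp)
    fix s assume s: "0 \<le> s" "s \<le> t"
    have "rate (\<lambda>t. 1 - u t) s = 1 - c * s" by (rule upper_rate[OF u s(1)]) (use True s in simp)
    also have "\<dots> \<le> rate y s" using y_antimono[OF s] t s by (intro rate_ge) simp_all
    finally show "rate (\<lambda>t. 1 - u t) s \<le> rate y s" .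
  qed
  then show ?thesis by (simp add: y_def)
next
  case False
  then have "u t = 1" by (intro stopped_solution_eq_1[OF u t(1)]) (auto simp: not_less)
  then show ?thesis using z_bounds[OF t(1)] by simp
qed

lemma lower_le_z_below_one:
  assumes l: "stopped_solution (lower_rhs c) l" and t: "t \<ge> 0" "y t > 0"
    and lt: "\<And>s. 0 \<le> s \<Longrightarrow> s \<le> t \<Longrightarrow> l s < 1"
  shows "l t \<le> z t"
proof -
  have "y t \<le> 1 - l t"
  proof (rule rate_mono_imp_profile_mono[of "\<lambda>t. 1 - l t" t y])
    show "positive_profile y t" by (rule profile[OF t])
    show "positive_profile (\<lambda>t. 1 - l t) t" by (rule stopped_solution_profile[OF l t(1) lt])
    fix s assume s: "0 \<le> s" "s \<le> t"
    show "rate y s \<le> rate (\<lambda>t. 1 - l t) s"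
      using y_antimono[OF s] t s lt by (intro rate_le_lower[OF _ _ l]) simp_all
  qed
  then show ?thesis by (simp add: y_def)
qed

text \<open>If \<open>l\<close> reached 1 at a first time \<open>t1 \<le> t\<close>, the bound valid
  before \<open>t1\<close> would pass to \<open>t1\<close> by continuity and give
  \<open>z t1 \<ge> 1\<close>, contrary to \<open>y t1 \<ge> y t\<close> and
  \<open>y t > 0\<close>.\<close>

lemma lower_le_z:
  assumes l: "stopped_solution (lower_rhs c) l" and t: "t \<ge> 0" "y t > 0"
  shows "l t \<le> z t"
proof (rule lower_le_z_below_one[OF l t], rule ccontr)
  fix s assume s: "0 \<le> s" "s \<le> t" "\<not> l s < 1"
  then have ex: "\<exists>s\<in>{0..t}. l s \<ge> 1" by (intro bexI[of _ s]) auto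
  note cont = stopped_solution_continuous[OF l]
  have "continuous_on {0..t} l" using cont by (rule continuous_on_subset) auto
  from continuous_first_one[OF this stopped_solution_0[OF l] ex] obtain t1 where t1: "0 < t1" "t1 \<le> t" "l t1 = 1"
    "\<And>s. 0 \<le> s \<Longrightarrow> s < t1 \<Longrightarrow> l s < 1" by blast
  have "l t1 - (1 - y t1) \<le> 0"
  proof (rule continuous_on_le_endpoint[OF t1(1), of "\<lambda>t. l t - (1 - y t)"])
    show "continuous_on {0..t1} (\<lambda>t. l t - (1 - y t))"
      by (intro continuous_intros continuous_on_subset[OF cont] continuous_on_subset[OF y_continuous]) auto
    fix s assume s: "0 \<le> s" "s < t1"
    have "l s \<le> z s"
      using s t1 t y_antimono[of s t] by (intro lower_le_z_below_one[OF l]) simp_all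
    then show "l s - (1 - y s) \<le> 0" by (simp add: y_def)
  qed
  moreover have "y t1 \<ge> y t" using t1 by (intro y_antimono) simp_all
  ultimately show False using t1 t by simp
qed

text \<open>Before the infimum \<open>y\<close> is positive and the comparison applies; at the
  infimum \<open>y\<close> vanishes, so the bounds are carried there by continuity.\<close>

lemma bounds_up_to_hitting_time:
  assumes l: "stopped_solution (lower_rhs c) l" and u: "stopped_solution (upper_rhs c) u"
    and t: "0 \<le> t" "t \<le> Inf {t. t > 0 \<and> z t = 1}"
  shows "l t \<le> z t \<and> z t \<le> u t"
proof -
  let ?S = "{t. t > 0 \<and> z t = 1}"
  have bdd: "bdd_below ?S" by (rule bdd_belowI[of _ 0]) auto
  have before: "l s \<le> z s \<and> z s \<le> u s" if s: "0 \<le> s" "s < Inf ?S" for s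
  proof -
    have "y s > 0"
    proof (cases "s = 0")
      case False
      then have "z s \<noteq> 1" using s cInf_lower[OF _ bdd, of s] by auto
      then show ?thesis using y_bounds(1)[OF s(1)] by (simp add: y_def)
    qed (simp add: y_0)
    then show ?thesis using lower_le_z[OF l s(1)] z_le_upper[OF u s(1)] by simp
  qed
  show ?thesis
  proof (cases "t < Inf ?S")
    case True
    then show ?thesis using before t by simp
  next
    case False
    then have tS: "t = Inf ?S" using t by simp
    \<comment> \<open>Time 1 belongs to the set, so its infimum is a genuine one. The Lipschitz
      bound from \<open>y 0 = 1\<close> then keeps it away from 0, so there are earlier times from
      which to pass to the limit.\<close>
    have ne: "?S \<noteq> {}" using y_1 by (auto simp: y_def intro!: exI[of _ 1])
    have "1 / (1 + c) \<le> Inf ?S"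
    proof (rule cInf_greatest[OF ne])
      fix s assume "s \<in> ?S"
      then have "1 \<le> s * (1 + c)" using y_Lipschitz[of 0 s] by (simp add: y_0) (simp add: y_def)
      then show "1 / (1 + c) \<le> s" using c_pos by (simp add: divide_le_eq)
    qed
    then have t0: "0 < t" using c_pos tS by (auto intro: less_le_trans[of 0 "1 / (1 + c)"])
    have cz: "continuous_on {0..t} (\<lambda>t. 1 - y t)"
      by (intro continuous_intros continuous_on_subset[OF y_continuous]) auto
    have cl: "continuous_on {0..t} l" and cu: "continuous_on {0..t} u"
      by (auto intro: continuous_on_subset[OF stopped_solution_continuous[OF l]] continuous_on_subset[OF stopped_solution_continuous[OF u]])
    have before': "l s - (1 - y s) \<le> 0" "(1 - y s) - u s \<le> 0" if "0 \<le> s" "s < t" for s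
      using before[of s] that tS by (simp_all add: y_def)
    have "l t - (1 - y t) \<le> 0"
      by (rule continuous_on_le_endpoint[OF t0 continuous_on_diff[OF cl cz] before'(1)])
    moreover have "(1 - y t) - u t \<le> 0"
      by (rule continuous_on_le_endpoint[OF t0 continuous_on_diff[OF cz cu] before'(2)])
    ultimately show ?thesis by (simp add: y_def)
  qed
qed

end

theorem proposition3p3:
  fixes lam r c Tstar :: real
    and M :: "'w measure"
    and C :: "nat \<Rightarrow> 'a::euclidean_space set"
    and Z :: "nat \<Rightarrow> nat \<Rightarrow> 'w \<Rightarrow> nat"
    and z :: "real \<Rightarrow> real"
  assumes "lam > 0" and "r > 0"
    and "\<And>N. N \<ge> 1 \<Longrightarrow> cube_of_volume (real N / lam) (C N)"
    and "prob_space M"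
    and "\<And>N n. N \<ge> 1 \<Longrightarrow> Z N n \<in> measurable M (count_space UNIV)"
    and "\<And>N n. N \<ge> 1 \<Longrightarrow> distr M (count_space UNIV) (Z N n) = explored_count_law r N (C N) n"
    and "\<And>t. t \<ge> 0 \<Longrightarrow> z t \<in> {0..1}"
    and "\<And>t. t \<ge> 0 \<Longrightarrow>
           AE \<omega> in M. (\<lambda>N. real (Z N (nat \<lfloor>t * real N\<rfloor>) \<omega>) / real N) \<longlonglongrightarrow> z t"
    and "\<And>t. t \<ge> 0 \<Longrightarrow>
           (\<lambda>N. \<integral>\<omega>. \<bar>real (Z N (nat \<lfloor>t * real N\<rfloor>) \<omega>) / real N - z t\<bar> \<partial>M) \<longlonglongrightarrow> 0"
    and "Tstar = Inf {t. t > 0 \<and> z t = 1}"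
    and "c = lam * measure lborel (ball (0::'a) r)"
  shows "(\<exists>l. stopped_solution (lower_rhs c) l) \<and>
         stopped_solution (upper_rhs c) (upper_explicit c) \<and>
         (\<forall>u. stopped_solution (upper_rhs c) u \<longrightarrow> (\<forall>t\<ge>0. u t = upper_explicit c t)) \<and>
         (\<forall>l u. stopped_solution (lower_rhs c) l \<longrightarrow> stopped_solution (upper_rhs c) u \<longrightarrow>
            (\<forall>t\<in>{0..Tstar}. l t \<le> z t \<and> z t \<le> u t))"
proof -
  interpret M: prob_space M by (rule assms(4))
  interpret sequential_adsorption M lam r c C Z z
    by unfold_locales (fact assms)+
  have upper: "stopped_solution (upper_rhs c) (upper_explicit c)"
    using upper_solution_eq[OF c_pos] by simp
  show ?thesis
  proof (intro conjI allI impI ballI)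
    show "\<exists>l. stopped_solution (lower_rhs c) l" by (rule lower_solution_exists[OF c_pos])
    show "stopped_solution (upper_rhs c) (upper_explicit c)" by (rule upper)
    show "u t = upper_explicit c t" if "stopped_solution (upper_rhs c) u" "0 \<le> t" for u t
      by (rule upper_solution_unique[OF that(1) upper that(2)])
    fix l u t
    assume l: "stopped_solution (lower_rhs c) l" and u: "stopped_solution (upper_rhs c) u"
      and t: "t \<in> {0..Tstar}"
    show "l t \<le> z t" "z t \<le> u t"
      using bounds_up_to_hitting_time[OF l u] t by (auto simp: assms(10))
  qed
qed

end
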